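(* Let $\Lambda$ be a ring such that $\mathcal{T}_r(\Lambda)=\mathcal{T}_\ell(\Lambda)$. Then there is an isomorphism of monoids between $V_r(\Lambda)\sqcup B_r(\Lambda)$ and $V_\ell(\Lambda)\sqcup B_\ell(\Lambda)$.
   Context: Rings are associative with $1$. The trace of a right $\Lambda$-module $M$ is the two-sided ideal $\mathrm{Tr}_\Lambda(M)=\sum_{f\in\mathrm{Hom}_\Lambda(M,\Lambda)}f(M)$; similarly for left modules. $\mathcal{T}_r(\Lambda)$ (resp. $\mathcal{T}_\ell(\Lambda)$) is the set of ideals of $\Lambda$ that are traces of countably generated projective right (resp. left) $\Lambda$-modules. $V_r(\Lambda)$ (resp. $V_r^*(\Lambda)$) is the set of isomorphism classes $[P]$ of finitely generated (resp. countably generated) projective right $\Lambda$-modules, a commutative monoid under $[P]+[P']=[P\oplus P']$; $V_\ell(\Lambda)$, $V^*_\ell(\Lambda)$ are the analogous monoids for left modules. A countably generated projective right $\Lambda$-module $P$ is relatively big if there is a countably generated projective right $\Lambda$-module $P'$ with trace ideal $J$ such that $P\oplus P'^{(\omega)}\cong P$ and $P/PJ$ is finitely generated. $B_r(\Lambda)\subseteq V_r^*(\Lambda)$ is the set of isomorphism classes of relatively big projective right modules that are not finitely generated; $V_r(\Lambda)\sqcup B_r(\Lambda)$ is a submonoid of $V_r^*(\Lambda)$, consisting of the classes of all relatively big projective right modules. $B_\ell(\Lambda)$ is defined analogously for left modules. *)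

theory Defs
  imports "HOL-Algebra.Module" "HOL-Algebra.AbelCoset" "HOL-Algebra.Generated_Groups"
    "HOL-Library.Countable_Set"
begin

section \<open>Modules over a ring with one\<close>

text \<open>
  The library's locale of modules requires a commutative ring; its record type does not, and is
  reused here (the fields \<open>mult\<close> and \<open>one\<close> of that record play no role).  The record only has a
  scalar multiplication written on the left, so for a right module \<open>a \<odot>\<^bsub>M\<^esub> x\<close> stands
  for \<open>x \<cdot> a\<close>; note the order of the factors in \<open>smult_assoc\<close>.
\<close>

locale right_module = R?: ring R + M?: abelian_group M
  for R :: "('a, 'r) ring_scheme" (structure) and M :: "('a, 'm, 'k) module_scheme" (structure) +
  assumes smult_closed:
      "\<lbrakk>a \<in> carrier R; x \<in> carrier M\<rbrakk> \<Longrightarrow> a \<odot>\<^bsub>M\<^esub> x \<in> carrier M"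
    and smult_l_distr:
      "\<lbrakk>a \<in> carrier R; b \<in> carrier R; x \<in> carrier M\<rbrakk>
        \<Longrightarrow> (a \<oplus>\<^bsub>R\<^esub> b) \<odot>\<^bsub>M\<^esub> x = a \<odot>\<^bsub>M\<^esub> x \<oplus>\<^bsub>M\<^esub> b \<odot>\<^bsub>M\<^esub> x"
    and smult_r_distr:
      "\<lbrakk>a \<in> carrier R; x \<in> carrier M; y \<in> carrier M\<rbrakk>
        \<Longrightarrow> a \<odot>\<^bsub>M\<^esub> (x \<oplus>\<^bsub>M\<^esub> y) = a \<odot>\<^bsub>M\<^esub> x \<oplus>\<^bsub>M\<^esub> a \<odot>\<^bsub>M\<^esub> y"
    and smult_assoc:
      "\<lbrakk>a \<in> carrier R; b \<in> carrier R; x \<in> carrier M\<rbrakk>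
        \<Longrightarrow> (a \<otimes>\<^bsub>R\<^esub> b) \<odot>\<^bsub>M\<^esub> x = b \<odot>\<^bsub>M\<^esub> (a \<odot>\<^bsub>M\<^esub> x)"
    and smult_one:
      "x \<in> carrier M \<Longrightarrow> \<one>\<^bsub>R\<^esub> \<odot>\<^bsub>M\<^esub> x = x"

locale left_module = R?: ring R + M?: abelian_group M
  for R :: "('a, 'r) ring_scheme" (structure) and M :: "('a, 'm, 'k) module_scheme" (structure) +
  assumes smult_closed:
      "\<lbrakk>a \<in> carrier R; x \<in> carrier M\<rbrakk> \<Longrightarrow> a \<odot>\<^bsub>M\<^esub> x \<in> carrier M"
    and smult_l_distr:
      "\<lbrakk>a \<in> carrier R; b \<in> carrier R; x \<in> carrier M\<rbrakk>
        \<Longrightarrow> (a \<oplus>\<^bsub>R\<^esub> b) \<odot>\<^bsub>M\<^esub> x = a \<odot>\<^bsub>M\<^esub> x \<oplus>\<^bsub>M\<^esub> b \<odot>\<^bsub>M\<^esub> x"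
    and smult_r_distr:
      "\<lbrakk>a \<in> carrier R; x \<in> carrier M; y \<in> carrier M\<rbrakk>
        \<Longrightarrow> a \<odot>\<^bsub>M\<^esub> (x \<oplus>\<^bsub>M\<^esub> y) = a \<odot>\<^bsub>M\<^esub> x \<oplus>\<^bsub>M\<^esub> a \<odot>\<^bsub>M\<^esub> y"
    and smult_assoc:
      "\<lbrakk>a \<in> carrier R; b \<in> carrier R; x \<in> carrier M\<rbrakk>
        \<Longrightarrow> (a \<otimes>\<^bsub>R\<^esub> b) \<odot>\<^bsub>M\<^esub> x = a \<odot>\<^bsub>M\<^esub> (b \<odot>\<^bsub>M\<^esub> x)"
    and smult_one:
      "x \<in> carrier M \<Longrightarrow> \<one>\<^bsub>R\<^esub> \<odot>\<^bsub>M\<^esub> x = x"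

definition mhom :: "('a, 'r) ring_scheme \<Rightarrow> ('a, 'm, 'k) module_scheme \<Rightarrow>
    ('a, 'n, 'l) module_scheme \<Rightarrow> ('m \<Rightarrow> 'n) set" where
  "mhom R M N = {f \<in> carrier M \<rightarrow> carrier N.
     (\<forall>x\<in>carrier M. \<forall>y\<in>carrier M. f (x \<oplus>\<^bsub>M\<^esub> y) = f x \<oplus>\<^bsub>N\<^esub> f y) \<and>
     (\<forall>a\<in>carrier R. \<forall>x\<in>carrier M. f (a \<odot>\<^bsub>M\<^esub> x) = a \<odot>\<^bsub>N\<^esub> f x)}"

definition miso :: "('a, 'r) ring_scheme \<Rightarrow> ('a, 'm, 'k) module_scheme \<Rightarrow>
    ('a, 'n, 'l) module_scheme \<Rightarrow> bool" where
  "miso R M N \<longleftrightarrow> (\<exists>f\<in>mhom R M N. bij_betw f (carrier M) (carrier N))"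

definition mspan :: "('a, 'r) ring_scheme \<Rightarrow> ('a, 'm, 'k) module_scheme \<Rightarrow> 'm set \<Rightarrow> 'm set" where
  "mspan R M S = \<Inter>{N. submodule N R M \<and> S \<subseteq> N}"

definition finitely_generated :: "('a, 'r) ring_scheme \<Rightarrow> ('a, 'm, 'k) module_scheme \<Rightarrow> bool" where
  "finitely_generated R M \<longleftrightarrow> (\<exists>S\<subseteq>carrier M. finite S \<and> mspan R M S = carrier M)"

definition countably_generated :: "('a, 'r) ring_scheme \<Rightarrow> ('a, 'm, 'k) module_scheme \<Rightarrow> bool" where
  "countably_generated R M \<longleftrightarrow> (\<exists>S\<subseteq>carrier M. countable S \<and> mspan R M S = carrier M)"

text \<open>The ring as a right module over itself: \<open>x \<cdot> a = x \<otimes> a\<close>.\<close>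

definition regular_module :: "('a, 'r) ring_scheme \<Rightarrow> ('a, 'a) module" where
  "regular_module R = \<lparr>carrier = carrier R, mult = mult R, one = one R, zero = zero R, add = add R,
     smult = (\<lambda>a x. x \<otimes>\<^bsub>R\<^esub> a)\<rparr>"

definition dsum :: "('a, 'm, 'k) module_scheme \<Rightarrow> ('a, 'n, 'l) module_scheme \<Rightarrow>
    ('a, 'm \<times> 'n) module" where
  "dsum M N = \<lparr>carrier = carrier M \<times> carrier N, mult = undefined, one = undefined,
     zero = (\<zero>\<^bsub>M\<^esub>, \<zero>\<^bsub>N\<^esub>),
     add = (\<lambda>x y. (fst x \<oplus>\<^bsub>M\<^esub> fst y, snd x \<oplus>\<^bsub>N\<^esub> snd y)),
     smult = (\<lambda>a x. (a \<odot>\<^bsub>M\<^esub> fst x, a \<odot>\<^bsub>N\<^esub> snd x))\<rparr>"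

text \<open>The direct sum \<open>M\<^sup>(\<^sup>I\<^sup>)\<close> of copies of \<open>M\<close> indexed by \<open>I\<close>.\<close>

definition copower :: "('a, 'm, 'k) module_scheme \<Rightarrow> 'i set \<Rightarrow> ('a, 'i \<Rightarrow> 'm) module" where
  "copower M I = \<lparr>carrier = {u \<in> I \<rightarrow>\<^sub>E carrier M. finite {i \<in> I. u i \<noteq> \<zero>\<^bsub>M\<^esub>}},
     mult = undefined, one = undefined,
     zero = (\<lambda>i\<in>I. \<zero>\<^bsub>M\<^esub>),
     add = (\<lambda>u v. \<lambda>i\<in>I. u i \<oplus>\<^bsub>M\<^esub> v i),
     smult = (\<lambda>a u. \<lambda>i\<in>I. a \<odot>\<^bsub>M\<^esub> u i)\<rparr>"

definition quotient_module :: "('a, 'm, 'k) module_scheme \<Rightarrow> 'm set \<Rightarrow> ('a, 'm set) module" where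
  "quotient_module M N = \<lparr>carrier = a_rcosets\<^bsub>M\<^esub> N, mult = undefined, one = undefined,
     zero = N, add = set_add M,
     smult = (\<lambda>a X. \<Union>x\<in>X. N +>\<^bsub>M\<^esub> (a \<odot>\<^bsub>M\<^esub> x))\<rparr>"

text \<open>\<open>PJ\<close>, the additive subgroup generated by the products \<open>x \<cdot> a\<close>.\<close>

definition module_ideal_prod :: "('a, 'm, 'k) module_scheme \<Rightarrow> 'a set \<Rightarrow> 'm set" where
  "module_ideal_prod P J = generate (add_monoid P) {a \<odot>\<^bsub>P\<^esub> x | a x. a \<in> J \<and> x \<in> carrier P}"

text \<open>The sum of the subgroups \<open>f(M)\<close> is the additive subgroup generated by their union.\<close>

definition trace_ideal :: "('a, 'r) ring_scheme \<Rightarrow> ('a, 'm, 'k) module_scheme \<Rightarrow> 'a set" where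
  "trace_ideal R M =
     generate (add_monoid R) (\<Union>f\<in>mhom R M (regular_module R). f ` carrier M)"

text \<open>
  Projectivity is the lifting property.  A definition cannot quantify over types, so the test
  modules are taken on two fixed types, large enough to contain the free module on \<open>carrier P\<close> and
  \<open>P\<close> itself; \<open>projective_lifting\<close> below derives the lifting property for all types.
\<close>

definition projective :: "('a, 'r) ring_scheme \<Rightarrow> ('a, 'm) module \<Rightarrow> bool" where
  "projective R P \<longleftrightarrow> right_module R P \<and>
     (\<forall>(M :: ('a, 'm \<Rightarrow> 'a) module) (N :: ('a, 'm) module).
        \<forall>g\<in>mhom R M N. \<forall>f\<in>mhom R P N.
          right_module R M \<and> right_module R N \<and> g ` carrier M = carrier N \<longrightarrow>
          (\<exists>h\<in>mhom R P M. \<forall>x\<in>carrier P. g (h x) = f x))"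

definition cg_projective :: "('a, 'r) ring_scheme \<Rightarrow> ('a, 'm) module \<Rightarrow> bool" where
  "cg_projective R P \<longleftrightarrow> projective R P \<and> countably_generated R P"

text \<open>
  Every countably generated projective module is isomorphic to one whose carrier consists of
  functions from \<open>nat\<close> to the ring (see \<open>cg_projective_representative\<close> below).  Modules on this
  carrier type therefore represent all isomorphism classes.
\<close>

type_synonym 'a cmod = "('a, nat \<Rightarrow> 'a) module"

definition trace_ideals_r :: "('a, 'r) ring_scheme \<Rightarrow> 'a set set" where
  "trace_ideals_r R = {trace_ideal R P | P :: 'a cmod. cg_projective R P}"

definition relatively_big :: "('a, 'r) ring_scheme \<Rightarrow> ('a, 'm) module \<Rightarrow> bool" where
  "relatively_big R P \<longleftrightarrow> cg_projective R P \<and>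
     (\<exists>P' :: 'a cmod. cg_projective R P' \<and>
        miso R (dsum P (copower P' (UNIV :: nat set))) P \<and>
        finitely_generated R (quotient_module P (module_ideal_prod P (trace_ideal R P'))))"

definition iso_class :: "('a, 'r) ring_scheme \<Rightarrow> ('a, 'm) module \<Rightarrow> 'a cmod set" where
  "iso_class R P = {Q. right_module R Q \<and> miso R P Q}"

text \<open>
  The monoid \<open>V\<^sub>r\<^sup>*\<close>.  The classes \<open>[P \<oplus> P']\<close> in the union all coincide, and the unit is the class of
  zero modules.
\<close>

definition V_star_r :: "('a, 'r) ring_scheme \<Rightarrow> 'a cmod set monoid" where
  "V_star_r R = \<lparr>carrier = {iso_class R P | P :: 'a cmod. cg_projective R P},
     mult = (\<lambda>A B. \<Union>P\<in>A. \<Union>P'\<in>B. iso_class R (dsum P P')),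
     one = {Z. right_module R Z \<and> carrier Z = {\<zero>\<^bsub>Z\<^esub>}}\<rparr>"

definition V_r :: "('a, 'r) ring_scheme \<Rightarrow> 'a cmod set set" where
  "V_r R = {iso_class R P | P :: 'a cmod. projective R P \<and> finitely_generated R P}"

definition B_r :: "('a, 'r) ring_scheme \<Rightarrow> 'a cmod set set" where
  "B_r R = {iso_class R P | P :: 'a cmod. relatively_big R P \<and> \<not> finitely_generated R P}"

text \<open>The submonoid of \<open>V\<^sub>r\<^sup>*\<close> on \<open>V\<^sub>r \<squnion> B\<^sub>r\<close>.\<close>

definition VB_r :: "('a, 'r) ring_scheme \<Rightarrow> 'a cmod set monoid" where
  "VB_r R = (V_star_r R)\<lparr>carrier := V_r R \<union> B_r R\<rparr>"


section \<open>Left modules\<close>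

text \<open>Left modules are right modules over the opposite ring (see \<open>left_module_iff\<close>).\<close>

definition opp :: "('a, 'r) ring_scheme \<Rightarrow> ('a, 'r) ring_scheme" where
  "opp R = R\<lparr>mult := (\<lambda>x y. y \<otimes>\<^bsub>R\<^esub> x)\<rparr>"

definition trace_ideals_l :: "('a, 'r) ring_scheme \<Rightarrow> 'a set set" where
  "trace_ideals_l R = trace_ideals_r (opp R)"

definition VB_l :: "('a, 'r) ring_scheme \<Rightarrow> 'a cmod set monoid" where
  "VB_l R = VB_r (opp R)"

lemma opp_simps [simp]:
  "carrier (opp R) = carrier R" "zero (opp R) = zero R" "one (opp R) = one R"
  "add (opp R) = add R" "x \<otimes>\<^bsub>opp R\<^esub> y = y \<otimes>\<^bsub>R\<^esub> x"
  by (simp_all add: opp_def)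

lemma opp_opp [simp]: "opp (opp R) = R"
  by (simp add: opp_def)

lemma smult_regular_opp: "a \<odot>\<^bsub>regular_module (opp R)\<^esub> x = a \<otimes>\<^bsub>R\<^esub> x"
  by (simp add: regular_module_def)

lemma ring_opp:
  assumes "ring R" shows "ring (opp R)"
proof -
  interpret ring R by fact
  show ?thesis
  proof (rule ringI)
    show "abelian_group (opp R)"
      by (rule abelian_groupI)
        (auto simp: a_ac intro: bexI [of _ "\<ominus>\<^bsub>R\<^esub> _"] l_neg)
    show "monoid (opp R)"
      by (rule monoidI) (auto simp: m_assoc)
  qed (auto simp: l_distr r_distr)
qed

lemma left_module_iff: "left_module R M \<longleftrightarrow> right_module (opp R) M"
proof
  assume "left_module R M"
  then show "right_module (opp R) M"
    by (auto simp: left_module_def left_module_axioms_def right_module_def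
        right_module_axioms_def ring_opp)
next
  assume r: "right_module (opp R) M"
  then have "ring (opp (opp R))"
    by (simp add: right_module_def ring_opp del: opp_opp)
  with r show "left_module R M"
    by (auto simp: left_module_def left_module_axioms_def right_module_def
        right_module_axioms_def)
qed


section \<open>Adequacy of the carrier types\<close>

lemma mhomD:
  assumes "f \<in> mhom R M N"
  shows "\<And>x. x \<in> carrier M \<Longrightarrow> f x \<in> carrier N"
    and "\<And>x y. \<lbrakk>x \<in> carrier M; y \<in> carrier M\<rbrakk> \<Longrightarrow> f (x \<oplus>\<^bsub>M\<^esub> y) = f x \<oplus>\<^bsub>N\<^esub> f y"
    and "\<And>a x. \<lbrakk>a \<in> carrier R; x \<in> carrier M\<rbrakk> \<Longrightarrow> f (a \<odot>\<^bsub>M\<^esub> x) = a \<odot>\<^bsub>N\<^esub> f x"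
  using assms by (auto simp: mhom_def)

lemma mhom_comp: "\<lbrakk>f \<in> mhom R L M; g \<in> mhom R M N\<rbrakk> \<Longrightarrow> (\<lambda>x. g (f x)) \<in> mhom R L N"
  unfolding mhom_def by (simp add: Pi_iff)

context right_module
begin

lemma smult_zero_right: 
  assumes "a \<in> carrier R" shows "a \<odot>\<^bsub>M\<^esub> \<zero>\<^bsub>M\<^esub> = \<zero>\<^bsub>M\<^esub>"
proof -
  have "a \<odot>\<^bsub>M\<^esub> \<zero>\<^bsub>M\<^esub> \<oplus>\<^bsub>M\<^esub> a \<odot>\<^bsub>M\<^esub> \<zero>\<^bsub>M\<^esub> = a \<odot>\<^bsub>M\<^esub> \<zero>\<^bsub>M\<^esub>"
    using smult_r_distr [of a "\<zero>\<^bsub>M\<^esub>" "\<zero>\<^bsub>M\<^esub>"] assms by simp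
  then show ?thesis using assms smult_closed
    by (metis M.add.l_cancel_one' M.zero_closed)
qed

lemma smult_zero_left: 
  assumes "x \<in> carrier M" shows "\<zero>\<^bsub>R\<^esub> \<odot>\<^bsub>M\<^esub> x = \<zero>\<^bsub>M\<^esub>"
proof -
  have "\<zero>\<^bsub>R\<^esub> \<odot>\<^bsub>M\<^esub> x \<oplus>\<^bsub>M\<^esub> \<zero>\<^bsub>R\<^esub> \<odot>\<^bsub>M\<^esub> x = \<zero>\<^bsub>R\<^esub> \<odot>\<^bsub>M\<^esub> x"
    using smult_l_distr [of "\<zero>\<^bsub>R\<^esub>" "\<zero>\<^bsub>R\<^esub>" x] assms by simp
  then show ?thesis using assms smult_closed
    by (metis M.add.l_cancel_one' R.zero_closed)
qed

lemma smult_minus: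
  assumes "x \<in> carrier M" shows "(\<ominus>\<^bsub>R\<^esub> \<one>\<^bsub>R\<^esub>) \<odot>\<^bsub>M\<^esub> x = \<ominus>\<^bsub>M\<^esub> x"
proof -
  have "(\<ominus>\<^bsub>R\<^esub> \<one>\<^bsub>R\<^esub>) \<odot>\<^bsub>M\<^esub> x \<oplus>\<^bsub>M\<^esub> x = \<zero>\<^bsub>M\<^esub>"
    using smult_l_distr [of "\<ominus>\<^bsub>R\<^esub> \<one>\<^bsub>R\<^esub>" "\<one>\<^bsub>R\<^esub>" x] assms
    by (simp add: smult_zero_left smult_one R.l_neg)
  then show ?thesis using assms smult_closed
    by (metis M.minus_equality R.a_inv_closed R.one_closed)
qed

lemma submoduleI':
  assumes "H \<subseteq> carrier M" "\<zero>\<^bsub>M\<^esub> \<in> H"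
    and "\<And>x y. \<lbrakk>x \<in> H; y \<in> H\<rbrakk> \<Longrightarrow> x \<oplus>\<^bsub>M\<^esub> y \<in> H"
    and "\<And>a x. \<lbrakk>a \<in> carrier R; x \<in> H\<rbrakk> \<Longrightarrow> a \<odot>\<^bsub>M\<^esub> x \<in> H"
  shows "submodule H R M"
proof (intro submodule.intro subgroup.intro submodule_axioms.intro)
  fix x assume "x \<in> H"
  then show "inv\<^bsub>add_monoid M\<^esub> x \<in> H"
    using assms(4) [of "\<ominus>\<^bsub>R\<^esub> \<one>\<^bsub>R\<^esub>" x] assms(1) smult_minus by (auto simp: a_inv_def)
qed (use assms in auto)

lemma submodule_right_module:
  assumes "submodule H R M" shows "right_module R (M\<lparr>carrier := H\<rparr>)"
proof -
  interpret H: submodule H R M by fact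
  have sub: "H \<subseteq> carrier M" using H.subset by simp
  have "abelian_group (M\<lparr>carrier := H\<rparr>)"
  proof (rule abelian_groupI)
    fix x assume x: "x \<in> carrier (M\<lparr>carrier := H\<rparr>)"
    then have "\<ominus>\<^bsub>M\<^esub> x \<in> H" using H.m_inv_closed by (simp add: a_inv_def)
    then show "\<exists>y\<in>carrier (M\<lparr>carrier := H\<rparr>). y \<oplus>\<^bsub>M\<lparr>carrier := H\<rparr>\<^esub> x = \<zero>\<^bsub>M\<lparr>carrier := H\<rparr>\<^esub>"
      using x sub by (auto intro!: bexI [of _ "\<ominus>\<^bsub>M\<^esub> x"] M.l_neg)
  qed (use sub H.m_closed H.one_closed in \<open>auto simp: M.a_ac subset_iff\<close>)
  then show ?thesis
    using sub H.smult_closed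
    by (auto intro!: right_module.intro right_module_axioms.intro R.ring_axioms
        simp: smult_l_distr smult_r_distr smult_assoc smult_one subset_iff)
qed

end

lemma mhom_zero:
  assumes "right_module R M" "right_module R N" "f \<in> mhom R M N"
  shows "f \<zero>\<^bsub>M\<^esub> = \<zero>\<^bsub>N\<^esub>"
proof -
  interpret M: right_module R M by fact
  interpret N: right_module R N by fact
  have "f (\<zero>\<^bsub>R\<^esub> \<odot>\<^bsub>M\<^esub> \<zero>\<^bsub>M\<^esub>) = \<zero>\<^bsub>R\<^esub> \<odot>\<^bsub>N\<^esub> f \<zero>\<^bsub>M\<^esub>"
    using mhomD(3) [OF assms(3)] by simp
  then show ?thesis
    using mhomD(1) [OF assms(3)] by (simp add: M.smult_zero_left N.smult_zero_left)
qed

lemma mhom_image_submodule: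
  assumes "right_module R M" "right_module R N" "f \<in> mhom R M N"
  shows "submodule (f ` carrier M) R N"
proof -
  interpret M: right_module R M by fact
  interpret N: right_module R N by fact
  note f = mhomD [OF assms(3)]
  show ?thesis
  proof (rule N.submoduleI')
    show "\<zero>\<^bsub>N\<^esub> \<in> f ` carrier M" using mhom_zero [OF assms] by (metis M.zero_closed imageI)
  qed (auto simp: f simp flip: f(2,3) intro!: imageI M.smult_closed)
qed

lemma mhom_finsum:
  assumes "right_module R M" "right_module R N" "f \<in> mhom R M N"
    and "finite A" "u \<in> A \<rightarrow> carrier M"
  shows "f (finsum M u A) = finsum N (\<lambda>i. f (u i)) A"
  using assms(4,5)
proof (induction A)
  case empty
  interpret M: right_module R M by fact
  interpret N: right_module R N by fact
  show ?case by (simp add: mhom_zero [OF assms(1-3)])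
next
  case (insert i A)
  interpret M: right_module R M by fact
  interpret N: right_module R N by fact
  note f = mhomD [OF assms(3)]
  have "finsum M u (insert i A) = u i \<oplus>\<^bsub>M\<^esub> finsum M u A"
    using insert by (intro M.finsum_insert) auto
  moreover have "finsum N (\<lambda>i. f (u i)) (insert i A) = f (u i) \<oplus>\<^bsub>N\<^esub> finsum N (\<lambda>i. f (u i)) A"
    using insert f(1) by (intro N.finsum_insert) auto
  moreover have "u \<in> A \<rightarrow> carrier M" "u i \<in> carrier M" using insert by auto
  ultimately show ?case using insert f by simp
qed

lemma regular_right_module:
  assumes "ring R" shows "right_module R (regular_module R)"
proof -
  interpret ring R by fact
  have "abelian_group (regular_module R)"
    by (rule abelian_groupI)
      (auto simp: regular_module_def a_ac intro: bexI [of _ "\<ominus>\<^bsub>R\<^esub> _"] l_neg)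
  then show ?thesis
    by (auto intro!: right_module.intro right_module_axioms.intro ring_axioms
        simp: regular_module_def l_distr r_distr m_assoc)
qed

lemma copower_right_module:
  assumes "right_module R M" shows "right_module R (copower M I)"
proof -
  interpret right_module R M by fact
  let ?C = "copower M I"
  have supp: "finite {i \<in> I. u i \<oplus>\<^bsub>M\<^esub> v i \<noteq> \<zero>\<^bsub>M\<^esub>}"
    if "finite {i \<in> I. u i \<noteq> \<zero>\<^bsub>M\<^esub>}" "finite {i \<in> I. v i \<noteq> \<zero>\<^bsub>M\<^esub>}" for u v
    by (rule finite_subset [OF _ finite_UnI [OF that]]) auto
  have supp': "finite {i \<in> I. a \<odot>\<^bsub>M\<^esub> u i \<noteq> \<zero>\<^bsub>M\<^esub>}"
    if "finite {i \<in> I. u i \<noteq> \<zero>\<^bsub>M\<^esub>}" "a \<in> carrier R" for u a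
    by (rule finite_subset [OF _ that(1)]) (auto simp: that smult_zero_right)
  have mem: "u i \<in> carrier M" if "u \<in> I \<rightarrow>\<^sub>E carrier M" "i \<in> I" for u i using that by auto
  have [simp]: "{i \<in> I. (\<lambda>i\<in>I. h i) i \<noteq> \<zero>\<^bsub>M\<^esub>} = {i \<in> I. h i \<noteq> \<zero>\<^bsub>M\<^esub>}" for h :: "_ \<Rightarrow> _" by auto
  have res: "(\<lambda>i\<in>I. u i) = u" if "u \<in> I \<rightarrow>\<^sub>E carrier M" for u
    using that by (simp add: PiE_restrict)
  have cl_add: "x \<oplus>\<^bsub>?C\<^esub> y \<in> carrier ?C" if "x \<in> carrier ?C" "y \<in> carrier ?C" for x y
    using that by (auto simp: copower_def supp simp del: restrict_apply)
  have cl_smult: "a \<odot>\<^bsub>?C\<^esub> x \<in> carrier ?C" if "a \<in> carrier R" "x \<in> carrier ?C" for a x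
    using that by (auto simp: copower_def supp' intro!: smult_closed simp del: restrict_apply)
  have eqI: "x = y" if "x \<in> carrier ?C" "y \<in> carrier ?C" "\<And>i. i \<in> I \<Longrightarrow> x i = y i" for x y
    using that by (auto simp: copower_def intro: PiE_ext)
  have addi: "(x \<oplus>\<^bsub>?C\<^esub> y) i = x i \<oplus>\<^bsub>M\<^esub> y i" and smulti: "(a \<odot>\<^bsub>?C\<^esub> x) i = a \<odot>\<^bsub>M\<^esub> x i"
    and zeroi: "\<zero>\<^bsub>?C\<^esub> i = \<zero>\<^bsub>M\<^esub>"
    if "i \<in> I" for x y i a using that by (auto simp: copower_def)
  have mm: "x i \<in> carrier M" if "x \<in> carrier ?C" "i \<in> I" for x i
    using that by (auto simp: copower_def)
  have cl_zero: "\<zero>\<^bsub>?C\<^esub> \<in> carrier ?C" by (auto simp: copower_def)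
  have "abelian_group ?C"
  proof (rule abelian_groupI)
    fix x assume x: "x \<in> carrier ?C"
    show "\<exists>y\<in>carrier ?C. y \<oplus>\<^bsub>?C\<^esub> x = \<zero>\<^bsub>?C\<^esub>"
    proof
      show "(\<ominus>\<^bsub>R\<^esub> \<one>\<^bsub>R\<^esub>) \<odot>\<^bsub>?C\<^esub> x \<in> carrier ?C" using x by (simp add: cl_smult)
      then show "(\<ominus>\<^bsub>R\<^esub> \<one>\<^bsub>R\<^esub>) \<odot>\<^bsub>?C\<^esub> x \<oplus>\<^bsub>?C\<^esub> x = \<zero>\<^bsub>?C\<^esub>"
        using x by (intro eqI cl_add cl_zero)
          (auto simp: addi smulti zeroi mm smult_minus M.l_neg)
    qed
  qed (auto intro!: eqI cl_add cl_zero simp: addi zeroi mm M.a_ac)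
  then show ?thesis
    by (auto intro!: right_module.intro right_module_axioms.intro R.ring_axioms eqI cl_add cl_smult
        simp: addi smulti mm smult_l_distr smult_r_distr smult_assoc smult_one smult_closed)
qed

text \<open>The homomorphism from the free module on \<open>I\<close> determined by the images of the basis.\<close>

definition free_map :: "('a, 'm, 'k) module_scheme \<Rightarrow> ('a, 'r) ring_scheme \<Rightarrow> 'i set \<Rightarrow> ('i \<Rightarrow> 'm) \<Rightarrow> ('i \<Rightarrow> 'a) \<Rightarrow> 'm"
  where "free_map M R I m u = finsum M (\<lambda>i. u i \<odot>\<^bsub>M\<^esub> m i) {i \<in> I. u i \<noteq> \<zero>\<^bsub>R\<^esub>}"

lemma free_map_superset:
  assumes "right_module R M" "m \<in> I \<rightarrow> carrier M" "u \<in> carrier (copower (regular_module R) I)"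
    and "finite A" "{i \<in> I. u i \<noteq> \<zero>\<^bsub>R\<^esub>} \<subseteq> A" "A \<subseteq> I"
  shows "free_map M R I m u = finsum M (\<lambda>i. u i \<odot>\<^bsub>M\<^esub> m i) A"
proof -
  interpret right_module R M by fact
  have u: "u i \<in> carrier R" if "i \<in> I" for i
    using assms(3) that by (auto simp: copower_def regular_module_def)
  show ?thesis unfolding free_map_def
    using assms by (intro M.add.finprod_mono_neutral_cong_left)
     (auto simp: u smult_closed smult_zero_left Pi_iff subset_iff)
qed

lemma free_map_mhom:
  assumes "right_module R M" "m \<in> I \<rightarrow> carrier M"
  shows "free_map M R I m \<in> mhom R (copower (regular_module R) I) M"
proof -
  interpret right_module R M by fact
  let ?C = "copower (regular_module R) I"
  note sup = free_map_superset [OF assms]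
  have m: "m i \<in> carrier M" if "i \<in> I" for i using assms that by auto
  have u: "u i \<in> carrier R" if "u \<in> carrier ?C" "i \<in> I" for u i
    using that by (auto simp: copower_def regular_module_def)
  have fin: "finite {i \<in> I. u i \<noteq> \<zero>\<^bsub>R\<^esub>}" if "u \<in> carrier ?C" for u
    using that by (auto simp: copower_def regular_module_def)
  interpret C: right_module R ?C
    by (intro copower_right_module regular_right_module R.ring_axioms)
  have addi: "(x \<oplus>\<^bsub>?C\<^esub> y) i = x i \<oplus>\<^bsub>R\<^esub> y i" and smulti: "(a \<odot>\<^bsub>?C\<^esub> x) i = x i \<otimes>\<^bsub>R\<^esub> a"
    if "i \<in> I" for x y i a using that by (auto simp: copower_def regular_module_def)
  show ?thesis unfolding mhom_def
  proof (intro CollectI conjI ballI)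
    show "free_map M R I m \<in> carrier ?C \<rightarrow> carrier M"
      unfolding free_map_def using u m by (auto intro!: M.finsum_closed smult_closed)
  next
    fix x y assume xy: "x \<in> carrier ?C" "y \<in> carrier ?C"
    let ?A = "{i \<in> I. x i \<noteq> \<zero>\<^bsub>R\<^esub>} \<union> {i \<in> I. y i \<noteq> \<zero>\<^bsub>R\<^esub>}"
    have xyc: "x \<oplus>\<^bsub>?C\<^esub> y \<in> carrier ?C" using xy by simp
    have "free_map M R I m (x \<oplus>\<^bsub>?C\<^esub> y) = finsum M (\<lambda>i. (x \<oplus>\<^bsub>?C\<^esub> y) i \<odot>\<^bsub>M\<^esub> m i) ?A"
      using xy fin by (intro sup xyc) (auto simp: addi)
    also have "\<dots> = finsum M (\<lambda>i. x i \<odot>\<^bsub>M\<^esub> m i \<oplus>\<^bsub>M\<^esub> y i \<odot>\<^bsub>M\<^esub> m i) ?A"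
      using xy u m by (intro M.finsum_cong') (auto simp: addi smult_l_distr smult_closed)
    also have "\<dots> = finsum M (\<lambda>i. x i \<odot>\<^bsub>M\<^esub> m i) ?A \<oplus>\<^bsub>M\<^esub> finsum M (\<lambda>i. y i \<odot>\<^bsub>M\<^esub> m i) ?A"
      using xy u m by (intro M.finsum_addf) (auto simp: smult_closed)
    also have "finsum M (\<lambda>i. x i \<odot>\<^bsub>M\<^esub> m i) ?A = free_map M R I m x"
      using xy fin by (intro sup [symmetric]) auto
    also have "finsum M (\<lambda>i. y i \<odot>\<^bsub>M\<^esub> m i) ?A = free_map M R I m y"
      using xy fin by (intro sup [symmetric]) auto
    finally show "free_map M R I m (x \<oplus>\<^bsub>?C\<^esub> y) = free_map M R I m x \<oplus>\<^bsub>M\<^esub> free_map M R I m y" .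
  next
    fix a x assume ax: "a \<in> carrier R" "x \<in> carrier ?C"
    let ?A = "{i \<in> I. x i \<noteq> \<zero>\<^bsub>R\<^esub>}"
    have axc: "a \<odot>\<^bsub>?C\<^esub> x \<in> carrier ?C" using ax by (simp add: C.smult_closed)
    have "(\<lambda>x. a \<odot>\<^bsub>M\<^esub> x) (finsum M (\<lambda>i. x i \<odot>\<^bsub>M\<^esub> m i) A) = finsum M (\<lambda>i. a \<odot>\<^bsub>M\<^esub> (x i \<odot>\<^bsub>M\<^esub> m i)) A"
      if "finite A" "A \<subseteq> I" for A using that
    proof (induction A)
      case (insert i A)
      then have "finsum M (\<lambda>i. x i \<odot>\<^bsub>M\<^esub> m i) (insert i A) = x i \<odot>\<^bsub>M\<^esub> m i \<oplus>\<^bsub>M\<^esub> finsum M (\<lambda>i. x i \<odot>\<^bsub>M\<^esub> m i) A"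
        using ax u m by (intro M.finsum_insert) (auto simp: smult_closed)
      moreover have "finsum M (\<lambda>i. a \<odot>\<^bsub>M\<^esub> (x i \<odot>\<^bsub>M\<^esub> m i)) (insert i A) =
          a \<odot>\<^bsub>M\<^esub> (x i \<odot>\<^bsub>M\<^esub> m i) \<oplus>\<^bsub>M\<^esub> finsum M (\<lambda>i. a \<odot>\<^bsub>M\<^esub> (x i \<odot>\<^bsub>M\<^esub> m i)) A"
        using insert ax u m by (intro M.finsum_insert) (auto simp: smult_closed subset_iff)
      moreover have "finsum M (\<lambda>i. x i \<odot>\<^bsub>M\<^esub> m i) A \<in> carrier M"
        using insert ax u m by (intro M.finsum_closed) (auto simp: smult_closed)
      ultimately show ?case using insert ax u m by (simp add: smult_r_distr smult_closed)
    qed (simp add: smult_zero_right ax)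
    from this [of ?A] fin ax have "a \<odot>\<^bsub>M\<^esub> free_map M R I m x = finsum M (\<lambda>i. a \<odot>\<^bsub>M\<^esub> (x i \<odot>\<^bsub>M\<^esub> m i)) ?A"
      by (auto simp: free_map_def)
    also have "\<dots> = finsum M (\<lambda>i. (a \<odot>\<^bsub>?C\<^esub> x) i \<odot>\<^bsub>M\<^esub> m i) ?A"
      using ax u m by (intro M.finsum_cong') (auto simp: smulti smult_assoc smult_closed)
    also have "\<dots> = free_map M R I m (a \<odot>\<^bsub>?C\<^esub> x)"
      using ax fin by (intro sup [symmetric] axc) (auto simp: smulti)
    finally show "free_map M R I m (a \<odot>\<^bsub>?C\<^esub> x) = a \<odot>\<^bsub>M\<^esub> free_map M R I m x" ..
  qed
qed

lemma mspan_mem_submodule: "\<lbrakk>submodule N R M; S \<subseteq> N; mspan R M S = carrier M\<rbrakk> \<Longrightarrow> carrier M \<subseteq> N"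
  by (auto simp: mspan_def)

lemma free_map_surj:
  assumes "right_module R M" "m \<in> I \<rightarrow> carrier M" "mspan R M (m ` I) = carrier M"
  shows "free_map M R I m ` carrier (copower (regular_module R) I) = carrier M"
proof -
  interpret right_module R M by fact
  let ?C = "copower (regular_module R) I"
  have hom: "free_map M R I m \<in> mhom R ?C M" by (rule free_map_mhom) fact+
  have "submodule (free_map M R I m ` carrier ?C) R M"
    by (intro mhom_image_submodule [OF _ _ hom] copower_right_module regular_right_module)
     (use assms R.ring_axioms in auto)
  moreover have "m i \<in> free_map M R I m ` carrier ?C" if i: "i \<in> I" for i
  proof
    let ?e = "\<lambda>j\<in>I. if j = i then \<one>\<^bsub>R\<^esub> else \<zero>\<^bsub>R\<^esub>"
    have "finite {j \<in> I. ?e j \<noteq> \<zero>\<^bsub>R\<^esub>}"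
      by (rule finite_subset [of _ "{i}"]) (auto split: if_splits)
    then show e: "?e \<in> carrier ?C"
      by (auto simp: copower_def regular_module_def)
    have "free_map M R I m ?e = finsum M (\<lambda>j. ?e j \<odot>\<^bsub>M\<^esub> m j) {i}"
      using i by (intro free_map_superset assms e) (auto split: if_splits)
    also have "\<dots> = m i"
    proof -
      have "m i \<in> carrier M" using i assms(2) by auto
      then show ?thesis using i by (simp add: smult_one)
    qed
    finally show "m i = free_map M R I m ?e" ..
  qed
  ultimately have "carrier M \<subseteq> free_map M R I m ` carrier ?C"
    using assms(3) by (intro mspan_mem_submodule) auto
  then show ?thesis using mhomD(1) [OF hom] by auto
qed

lemma mspan_subset_carrier: "right_module R M \<Longrightarrow> S \<subseteq> carrier M \<Longrightarrow> S \<subseteq> mspan R M S \<and> mspan R M S \<subseteq> carrier M"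
proof -
  assume "right_module R M" and S: "S \<subseteq> carrier M"
  then interpret right_module R M by simp
  have "submodule (carrier M) R M" by (rule submoduleI') (auto simp: smult_closed)
  then show ?thesis using S by (auto simp: mspan_def)
qed

lemma projective_splits_free:
  fixes P :: "('a, 'm) module"
  assumes "projective R P"
  shows "\<exists>s\<in>mhom R P (copower (regular_module R) (carrier P)).
    \<forall>x\<in>carrier P. free_map P R (carrier P) (\<lambda>x. x) (s x) = x"
proof -
  have P: "right_module R P" using assms by (simp add: projective_def)
  then interpret right_module R P .
  let ?C = "copower (regular_module R) (carrier P)"
  let ?g = "free_map P R (carrier P) (\<lambda>x. x)"
  have C: "right_module R ?C"
    by (intro copower_right_module regular_right_module R.ring_axioms)
  have g: "?g \<in> mhom R ?C P" by (rule free_map_mhom [OF P]) auto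
  have "?g ` carrier ?C = carrier P"
    using mspan_subset_carrier [OF P, of "carrier P"] by (intro free_map_surj [OF P]) auto
  moreover have "(\<lambda>x. x) \<in> mhom R P P" by (auto simp: mhom_def)
  ultimately show ?thesis using assms P C g unfolding projective_def by metis
qed

theorem projective_lifting:
  fixes P :: "('a, 'm) module" and M :: "('a, 'n, 'k) module_scheme"
    and N :: "('a, 'o, 'l) module_scheme"
  assumes "projective R P" "right_module R M" "right_module R N"
    and "g \<in> mhom R M N" "g ` carrier M = carrier N" "f \<in> mhom R P N"
  shows "\<exists>h\<in>mhom R P M. \<forall>x\<in>carrier P. g (h x) = f x"
proof -
  have P: "right_module R P" using assms by (simp add: projective_def)
  interpret P: right_module R P by (rule P)
  interpret M: right_module R M by fact
  interpret N: right_module R N by fact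
  let ?C = "copower (regular_module R) (carrier P)"
  obtain s where s: "s \<in> mhom R P ?C"
    and id: "\<And>x. x \<in> carrier P \<Longrightarrow> free_map P R (carrier P) (\<lambda>x. x) (s x) = x"
    using projective_splits_free [OF assms(1)] by blast
  have "\<exists>m. m \<in> carrier M \<and> g m = f x" if "x \<in> carrier P" for x
    using that assms(5) mhomD(1) [OF assms(6)] by (metis imageE)
  then obtain m where m: "\<And>x. x \<in> carrier P \<Longrightarrow> m x \<in> carrier M \<and> g (m x) = f x"
    by metis
  let ?h = "\<lambda>x. free_map M R (carrier P) m (s x)"
  have hom: "free_map M R (carrier P) m \<in> mhom R ?C M"
    using m by (intro free_map_mhom assms) auto
  show ?thesis
  proof
    show "?h \<in> mhom R P M" by (rule mhom_comp [OF s hom])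
    show "\<forall>x\<in>carrier P. g (?h x) = f x"
    proof
      fix x assume x: "x \<in> carrier P"
      then have sx: "s x \<in> carrier ?C" using mhomD(1) [OF s] by simp
      let ?A = "{y \<in> carrier P. s x y \<noteq> \<zero>\<^bsub>R\<^esub>}"
      have fin: "finite ?A" and c: "\<And>y. y \<in> carrier P \<Longrightarrow> s x y \<in> carrier R"
        using sx by (auto simp: copower_def regular_module_def)
      have "g (?h x) = finsum N (\<lambda>y. g (s x y \<odot>\<^bsub>M\<^esub> m y)) ?A"
        unfolding free_map_def using fin c m
        by (intro mhom_finsum [OF assms(2-4)]) (auto simp: M.smult_closed)
      also have "\<dots> = finsum N (\<lambda>y. f (s x y \<odot>\<^bsub>P\<^esub> y)) ?A"
        using c m mhomD(1) [OF assms(6)]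
        by (intro N.finsum_cong')
          (auto simp: mhomD(3) [OF assms(4)] mhomD(3) [OF assms(6)] N.smult_closed)
      also have "\<dots> = f (free_map P R (carrier P) (\<lambda>x. x) (s x))"
        unfolding free_map_def using fin c
        by (intro mhom_finsum [OF P assms(3) assms(6), symmetric]) (auto simp: P.smult_closed)
      finally show "g (?h x) = f x" using id x by simp
    qed
  qed
qed

lemma mspan_iso_image:
  assumes "right_module R M" "right_module R N" "f \<in> mhom R M N" "f ` carrier M = carrier N"
    and "S \<subseteq> carrier M" "mspan R M S = carrier M"
  shows "mspan R N (f ` S) = carrier N"
proof
  interpret M: right_module R M by fact
  interpret N: right_module R N by fact
  note f = mhomD [OF assms(3)]
  have sub: "f ` S \<subseteq> carrier N" using f(1) assms(5) by auto
  then show "mspan R N (f ` S) \<subseteq> carrier N" using mspan_subset_carrier [OF assms(2)] by blast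
  show "carrier N \<subseteq> mspan R N (f ` S)" unfolding mspan_def
  proof (rule Inter_greatest)
    fix H assume "H \<in> {N'. submodule N' R N \<and> f ` S \<subseteq> N'}"
    then have H: "submodule H R N" and SH: "f ` S \<subseteq> H" by auto
    interpret H: submodule H R N by (rule H)
    have "submodule {x \<in> carrier M. f x \<in> H} R M"
      using H.m_closed H.one_closed H.smult_closed mhom_zero [OF assms(1-3)]
      by (intro M.submoduleI') (auto simp: f M.smult_closed)
    then have "carrier M \<subseteq> {x \<in> carrier M. f x \<in> H}"
      using SH assms(5,6) by (intro mspan_mem_submodule) auto
    then have "f ` carrier M \<subseteq> H" by auto
    then show "carrier N \<subseteq> H" by (simp only: assms(4))
  qed
qed

theorem cg_projective_representative:
  fixes P :: "('a, 'm) module"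
  assumes "cg_projective R P"
  shows "\<exists>Q :: 'a cmod. cg_projective R Q \<and> miso R P Q"
proof -
  have proj: "projective R P" and P: "right_module R P"
    using assms by (auto simp: cg_projective_def projective_def)
  interpret P: right_module R P by (rule P)
  obtain S where S: "S \<subseteq> carrier P" "countable S" "mspan R P S = carrier P"
    using assms by (auto simp: cg_projective_def countably_generated_def)
  define m where "m = from_nat_into (insert \<zero>\<^bsub>P\<^esub> S)"
  have rng: "range m = insert \<zero>\<^bsub>P\<^esub> S"
    unfolding m_def using S by (intro range_from_nat_into) auto
  have m: "m \<in> UNIV \<rightarrow> carrier P" 
  proof
    fix i
    have "m i \<in> insert \<zero>\<^bsub>P\<^esub> S" using rng by blast
    then show "m i \<in> carrier P" using S(1) by auto
  qed
  have "S \<subseteq> range m" using rng by auto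
  then have "mspan R P S \<subseteq> mspan R P (range m)" by (auto simp: mspan_def)
  then have span: "mspan R P (range m) = carrier P"
    using S mspan_subset_carrier [OF P, of "range m"] m by auto
  let ?C = "copower (regular_module R) (UNIV :: nat set)"
  let ?g = "free_map P R UNIV m"
  have C: "right_module R ?C"
    by (intro copower_right_module regular_right_module P.R.ring_axioms)
  have g: "?g \<in> mhom R ?C P" by (rule free_map_mhom [OF P m])
  have surj: "?g ` carrier ?C = carrier P" by (rule free_map_surj [OF P m span])
  have idm: "(\<lambda>x. x) \<in> mhom R P P" by (auto simp: mhom_def)
  obtain s where s: "s \<in> mhom R P ?C" and id: "\<And>x. x \<in> carrier P \<Longrightarrow> ?g (s x) = x"
    using projective_lifting [OF proj C P g surj idm] by blast
  define Q :: "'a cmod" where "Q = ?C\<lparr>carrier := s ` carrier P\<rparr>"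
  have Q: "right_module R Q" unfolding Q_def
    by (intro right_module.submodule_right_module [OF C] mhom_image_submodule [OF P C s])
  have sQ: "s \<in> mhom R P Q" using s by (auto simp: mhom_def Q_def)
  have gQ: "?g \<in> mhom R Q P"
    using g mhomD(1) [OF s] by (auto simp: mhom_def Q_def)
  have sg: "s (?g y) = y" if "y \<in> carrier Q" for y using that id by (auto simp: Q_def)
  have "inj_on s (carrier P)" by (metis id inj_onI)
  then have "miso R P Q" unfolding miso_def
    by (intro bexI [OF _ sQ]) (auto simp: bij_betw_def Q_def)
  moreover have "countably_generated R Q" unfolding countably_generated_def
    using S mhomD(1) [OF sQ]
    by (intro exI [of _ "s ` S"] conjI mspan_iso_image [OF P Q sQ]) (auto simp: Q_def)
  moreover have "projective R Q" unfolding projective_def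
  proof (intro conjI allI ballI impI Q, elim conjE)
    fix M :: "('a, (nat \<Rightarrow> 'a) \<Rightarrow> 'a) module" and N :: "'a cmod" and g' f
    assume *: "g' \<in> mhom R M N" "f \<in> mhom R Q N" "right_module R M" "right_module R N"
      "g' ` carrier M = carrier N"
    have "(\<lambda>x. f (s x)) \<in> mhom R P N" using mhom_comp [OF sQ *(2)] .
    then obtain h where h: "h \<in> mhom R P M" "\<And>x. x \<in> carrier P \<Longrightarrow> g' (h x) = f (s x)"
      using projective_lifting [OF proj *(3,4,1,5)] by blast
    show "\<exists>h\<in>mhom R Q M. \<forall>x\<in>carrier Q. g' (h x) = f x"
    proof
      show "(\<lambda>x. h (?g x)) \<in> mhom R Q M" by (rule mhom_comp [OF gQ h(1)])
      show "\<forall>x\<in>carrier Q. g' (h (?g x)) = f x" using h(2) mhomD(1) [OF gQ] sg by simp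
    qed
  qed
  ultimately show ?thesis by (auto simp: cg_projective_def)
qed

end

theory Submission
  imports Defs "HOL-Algebra.Ideal"
begin

text \<open>
  A relatively big projective module \<open>P\<close>, witnessed by \<open>P'\<close> with trace ideal \<open>J\<close>, is determined by
  the pair of \<open>J\<close> and the finitely generated projective \<open>R/J\<close>-module \<open>P/PJ\<close>; and every pair of a
  trace ideal \<open>J\<close> and a finitely generated projective \<open>R/J\<close>-module comes from such a \<open>P\<close>.  Over
  \<open>R/J\<close>, finitely generated projective modules are the images of idempotent matrices, and
  transposing the matrices passes from right to left modules.  So as soon as the two sides have the
  same trace ideals, they have the same classifying pairs.

  The ring \<open>R/J\<close> is never formed.  A module \<open>P\<close> \<open>represents\<close> the ideal \<open>J\<close> and the matrix \<open>E\<close> if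
  \<open>P \<oplus> T\<^sup>(\<^sup>\<omega>\<^sup>) \<cong> P\<close> for some countably generated projective \<open>T\<close> with trace ideal \<open>J\<close> (the predicate
  \<open>absorbs\<close>), and if \<open>P\<close> has finitely many elements \<open>p\<^sub>i\<close> and functionals \<open>\<phi>\<^sub>i\<close> with
  \<open>x \<equiv> \<Sum> p\<^sub>i \<phi>\<^sub>i(x)\<close> modulo \<open>PJ\<close> and \<open>\<phi>\<^sub>i(p\<^sub>j) \<equiv> E\<^sub>i\<^sub>j\<close> modulo \<open>J\<close>.  The relatively big modules are
  exactly those that represent something (\<open>relatively_big_iff_represents\<close>).

  Uniqueness (\<open>absorbs_unique\<close>).  Let \<open>P\<close> and \<open>Q\<close> absorb \<open>J\<close>, and let \<open>f : P \<rightarrow> Q\<close> be an isomorphism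
  modulo \<open>J\<close>.  Then \<open>Q = f(P) + QJ\<close>, and countably many elements of \<open>QJ\<close> are covered by a map from
  \<open>T\<^sup>(\<^sup>\<omega>\<^sup>)\<close>, because \<open>J\<close> is the trace of \<open>T\<close>.  This gives a split surjection \<open>P \<oplus> T\<^sup>(\<^sup>\<omega>\<^sup>) \<rightarrow> Q\<close>, whose
  kernel \<open>K\<close> satisfies \<open>K = KJ\<close>.  For the same reason such a \<open>K\<close> is a direct summand of \<open>T\<^sup>(\<^sup>\<omega>\<^sup>)\<close>, so it
  is absorbed by the Eilenberg swindle: \<open>P \<cong> P \<oplus> T\<^sup>(\<^sup>\<omega>\<^sup>) \<cong> K \<oplus> Q \<cong> Q\<close>.

  Existence (\<open>absorbs_exists\<close>).  Let \<open>e\<close> be an endomorphism of \<open>M\<close> that is idempotent modulo \<open>J\<close>.  The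
  endomorphism \<open>u \<mapsto> ((1 - e) u\<^sub>i + e u\<^sub>i\<^sub>+\<^sub>1)\<^sub>i\<close> of \<open>M\<^sup>(\<^sup>\<omega>\<^sup>)\<close> is surjective modulo \<open>J\<close>, and its kernel modulo
  \<open>J\<close> is the image of \<open>e\<close>, sitting in coordinate \<open>0\<close>.  Adding a map from \<open>T\<^sup>(\<^sup>\<omega>\<^sup>)\<close> makes it surjective; the
  kernel is then projective and lifts the image of \<open>e\<close>, and its sum with \<open>T\<^sup>(\<^sup>\<omega>\<^sup>)\<close> absorbs \<open>J\<close>.

  The ideal \<open>J\<close> can be read off from \<open>P\<close> (\<open>absorbed_ideal_subset\<close>), and two Gram matrices of one \<open>P\<close>
  are equivalent modulo \<open>J\<close> by matrices whose transposes show that the transposed Gram matrices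
  belong to one left module (\<open>gram_mod_transfer\<close>).  Hence transposition is a well-defined bijection
  on isomorphism classes.  It is additive since a direct sum represents the sum of the ideals and
  the block diagonal matrix (\<open>represents_dsum\<close>).
\<close>

section \<open>Homomorphisms\<close>

lemma regular_module_simps [simp]:
  "carrier (regular_module R) = carrier R" "zero (regular_module R) = zero R"
  "add (regular_module R) = add R" "a \<odot>\<^bsub>regular_module R\<^esub> x = x \<otimes>\<^bsub>R\<^esub> a"
  by (simp_all add: regular_module_def)

lemma dsum_simps [simp]:
  "carrier (dsum M N) = carrier M \<times> carrier N" "zero (dsum M N) = (\<zero>\<^bsub>M\<^esub>, \<zero>\<^bsub>N\<^esub>)"
  "x \<oplus>\<^bsub>dsum M N\<^esub> y = (fst x \<oplus>\<^bsub>M\<^esub> fst y, snd x \<oplus>\<^bsub>N\<^esub> snd y)"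
  "a \<odot>\<^bsub>dsum M N\<^esub> x = (a \<odot>\<^bsub>M\<^esub> fst x, a \<odot>\<^bsub>N\<^esub> snd x)"
  by (simp_all add: dsum_def)

lemma regular_minus [simp]:
  "\<ominus>\<^bsub>regular_module R\<^esub> x = \<ominus>\<^bsub>R\<^esub> x" "x \<ominus>\<^bsub>regular_module R\<^esub> y = x \<ominus>\<^bsub>R\<^esub> y"
  by (simp_all add: a_inv_def a_minus_def m_inv_def)

lemma opp_minus [simp]: "\<ominus>\<^bsub>opp R\<^esub> x = \<ominus>\<^bsub>R\<^esub> x" "x \<ominus>\<^bsub>opp R\<^esub> y = x \<ominus>\<^bsub>R\<^esub> y"
  by (simp_all add: a_inv_def a_minus_def m_inv_def)

lemma right_module_ring: "right_module R M \<Longrightarrow> ring R"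
  by (simp add: right_module_def)

lemma dsum_right_module:
  assumes "right_module R M" "right_module R N"
  shows "right_module R (dsum M N)"
proof -
  interpret M: right_module R M by fact
  interpret N: right_module R N by fact
  have "abelian_group (dsum M N)"
  proof (rule abelian_groupI)
    fix x assume "x \<in> carrier (dsum M N)"
    then show "\<exists>y\<in>carrier (dsum M N). y \<oplus>\<^bsub>dsum M N\<^esub> x = \<zero>\<^bsub>dsum M N\<^esub>"
      by (intro bexI [of _ "(\<ominus>\<^bsub>M\<^esub> fst x, \<ominus>\<^bsub>N\<^esub> snd x)"]) (auto simp: M.l_neg N.l_neg)
  qed (auto simp: M.a_ac N.a_ac)
  then show ?thesis
    by (auto intro!: right_module.intro right_module_axioms.intro M.R.ring_axioms
        simp: M.smult_l_distr M.smult_r_distr M.smult_assoc M.smult_one M.smult_closed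
          N.smult_l_distr N.smult_r_distr N.smult_assoc N.smult_one N.smult_closed)
qed

lemma mhomI:
  assumes "\<And>x. x \<in> carrier M \<Longrightarrow> f x \<in> carrier N"
    and "\<And>x y. \<lbrakk>x \<in> carrier M; y \<in> carrier M\<rbrakk> \<Longrightarrow> f (x \<oplus>\<^bsub>M\<^esub> y) = f x \<oplus>\<^bsub>N\<^esub> f y"
    and "\<And>a x. \<lbrakk>a \<in> carrier R; x \<in> carrier M\<rbrakk> \<Longrightarrow> f (a \<odot>\<^bsub>M\<^esub> x) = a \<odot>\<^bsub>N\<^esub> f x"
  shows "f \<in> mhom R M N"
  using assms by (auto simp: mhom_def)

lemma mhom_id: "(\<lambda>x. x) \<in> mhom R M M"
  by (rule mhomI) auto

lemma mhom_const_zero: "right_module R N \<Longrightarrow> (\<lambda>x. \<zero>\<^bsub>N\<^esub>) \<in> mhom R M N"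
proof -
  assume "right_module R N"
  then interpret N: right_module R N .
  show ?thesis by (rule mhomI) (auto simp: N.smult_zero_right)
qed

lemma mhom_add:
  assumes "right_module R N" "f \<in> mhom R M N" "g \<in> mhom R M N"
  shows "(\<lambda>x. f x \<oplus>\<^bsub>N\<^esub> g x) \<in> mhom R M N"
proof -
  interpret N: right_module R N by fact
  note f = mhomD [OF assms(2)] note g = mhomD [OF assms(3)]
  show ?thesis by (rule mhomI) (auto simp: f g N.a_ac N.smult_r_distr)
qed

lemma mhom_a_inv:
  assumes "right_module R M" "right_module R N" "f \<in> mhom R M N" "x \<in> carrier M"
  shows "f (\<ominus>\<^bsub>M\<^esub> x) = \<ominus>\<^bsub>N\<^esub> f x"
proof -
  interpret M: right_module R M by fact
  interpret N: right_module R N by fact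
  note f = mhomD [OF assms(3)]
  show ?thesis using assms(4)
    by (simp add: f flip: M.smult_minus N.smult_minus)
qed

lemma mhom_minus:
  assumes "right_module R M" "right_module R N" "f \<in> mhom R M N" "x \<in> carrier M" "y \<in> carrier M"
  shows "f (x \<ominus>\<^bsub>M\<^esub> y) = f x \<ominus>\<^bsub>N\<^esub> f y"
proof -
  interpret M: right_module R M by fact
  show ?thesis using assms by (simp add: a_minus_def mhomD mhom_a_inv)
qed

lemma mhom_cong:
  assumes "right_module R M" "f \<in> mhom R M N" "\<And>x. x \<in> carrier M \<Longrightarrow> g x = f x"
  shows "g \<in> mhom R M N"
proof -
  interpret M: right_module R M by fact
  show ?thesis
    by (rule mhomI) (auto simp: assms(3) M.smult_closed mhomD [OF assms(2)])
qed

lemma mhom_diff: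
  assumes "right_module R M" "right_module R N" "f \<in> mhom R M N" "g \<in> mhom R M N"
  shows "(\<lambda>x. f x \<ominus>\<^bsub>N\<^esub> g x) \<in> mhom R M N"
proof -
  interpret N: right_module R N by fact
  have "(\<lambda>x. (\<ominus>\<^bsub>R\<^esub> \<one>\<^bsub>R\<^esub>) \<odot>\<^bsub>N\<^esub> x) \<in> mhom R N N"
    by (rule mhomI) (auto simp: N.smult_closed N.smult_r_distr N.R.l_minus N.R.r_minus simp flip: N.smult_assoc)
  from mhom_add [OF assms(2,3) mhom_comp [OF assms(4) this]]
  show ?thesis
    by (rule mhom_cong [OF assms(1)]) (simp add: a_minus_def N.smult_minus mhomD(1) [OF assms(4)])
qed

lemma mhom_finsum_fun:
  assumes "right_module R M" "right_module R N" "finite A" "\<And>i. i \<in> A \<Longrightarrow> f i \<in> mhom R M N"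
  shows "(\<lambda>x. finsum N (\<lambda>i. f i x) A) \<in> mhom R M N"
  using assms(3,4)
proof (induction A)
  case empty
  interpret N: right_module R N by fact
  show ?case using mhom_const_zero [OF assms(2), of M] by simp
next
  case (insert i A)
  interpret N: right_module R N by fact
  have "(\<lambda>x. f i x \<oplus>\<^bsub>N\<^esub> finsum N (\<lambda>i. f i x) A) \<in> mhom R M N"
    using insert by (intro mhom_add assms(2)) auto
  moreover have "finsum N (\<lambda>i. f i x) (insert i A) = f i x \<oplus>\<^bsub>N\<^esub> finsum N (\<lambda>i. f i x) A"
    if "x \<in> carrier M" for x
    using insert.hyps that mhomD(1) [OF insert.prems] by (intro N.finsum_insert) auto
  ultimately show ?case by (rule mhom_cong [OF assms(1)])
qed

lemma mhom_smult_left: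
  assumes "ring R" "c \<in> carrier R" "f \<in> mhom R M (regular_module R)"
  shows "(\<lambda>x. c \<otimes>\<^bsub>R\<^esub> f x) \<in> mhom R M (regular_module R)"
proof -
  interpret ring R by fact
  note f = mhomD [OF assms(3), simplified]
  show ?thesis
    by (rule mhomI) (use assms(2) in \<open>auto simp: f r_distr m_assoc\<close>)
qed

lemma mhom_smult_right:
  assumes "right_module R N" "n \<in> carrier N" "f \<in> mhom R M (regular_module R)"
  shows "(\<lambda>x. f x \<odot>\<^bsub>N\<^esub> n) \<in> mhom R M N"
proof -
  interpret N: right_module R N by fact
  note f = mhomD [OF assms(3), simplified]
  show ?thesis
    by (rule mhomI) (use assms(2) in \<open>auto simp: f N.smult_l_distr N.smult_assoc N.smult_closed\<close>)
qed

lemma mhom_pair: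
  "\<lbrakk>f \<in> mhom R L M; g \<in> mhom R L N\<rbrakk> \<Longrightarrow> (\<lambda>x. (f x, g x)) \<in> mhom R L (dsum M N)"
  by (rule mhomI) (auto simp: mhomD)

lemma mhom_fst: "fst \<in> mhom R (dsum M N) M"
  and mhom_snd: "snd \<in> mhom R (dsum M N) N"
  by (auto intro!: mhomI)

lemma mhom_inl: "right_module R N \<Longrightarrow> (\<lambda>x. (x, \<zero>\<^bsub>N\<^esub>)) \<in> mhom R M (dsum M N)"
  and mhom_inr: "right_module R M \<Longrightarrow> (\<lambda>x. (\<zero>\<^bsub>M\<^esub>, x)) \<in> mhom R N (dsum M N)"
  by (auto intro!: mhom_pair mhom_id mhom_const_zero)

lemma mhom_fst_comp: "f \<in> mhom R M L \<Longrightarrow> (\<lambda>x. f (fst x)) \<in> mhom R (dsum M N) L"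
  and mhom_snd_comp: "g \<in> mhom R N L \<Longrightarrow> (\<lambda>x. g (snd x)) \<in> mhom R (dsum M N) L"
  by (erule mhom_comp [OF mhom_fst], erule mhom_comp [OF mhom_snd])

subsection \<open>Direct powers\<close>

lemma copower_carrier:
  "u \<in> carrier (copower M I) \<longleftrightarrow> u \<in> extensional I \<and> (\<forall>i\<in>I. u i \<in> carrier M) \<and> finite {i \<in> I. u i \<noteq> \<zero>\<^bsub>M\<^esub>}"
  by (auto simp: copower_def PiE_def)

lemma copower_simps [simp]:
  "\<zero>\<^bsub>copower M I\<^esub> = (\<lambda>i\<in>I. \<zero>\<^bsub>M\<^esub>)"
  "u \<oplus>\<^bsub>copower M I\<^esub> v = (\<lambda>i\<in>I. u i \<oplus>\<^bsub>M\<^esub> v i)"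
  "a \<odot>\<^bsub>copower M I\<^esub> u = (\<lambda>i\<in>I. a \<odot>\<^bsub>M\<^esub> u i)"
  by (simp_all add: copower_def)

abbreviation omega_power :: "('a, 'm, 'k) module_scheme \<Rightarrow> ('a, nat \<Rightarrow> 'm) module" where
  "omega_power M \<equiv> copower M UNIV"

lemma mhom_copower_nth: "i \<in> I \<Longrightarrow> (\<lambda>u. u i) \<in> mhom R (copower M I) M"
  by (rule mhomI) (auto simp: copower_carrier)

lemma mhom_copowerI:
  assumes "\<And>i. i \<in> I \<Longrightarrow> f i \<in> mhom R L M"
    and "\<And>x. x \<in> carrier L \<Longrightarrow> finite {i \<in> I. f i x \<noteq> \<zero>\<^bsub>M\<^esub>}"
  shows "(\<lambda>x. \<lambda>i\<in>I. f i x) \<in> mhom R L (copower M I)"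
proof (rule mhomI)
  fix x assume x: "x \<in> carrier L"
  have "{i \<in> I. (\<lambda>i\<in>I. f i x) i \<noteq> \<zero>\<^bsub>M\<^esub>} = {i \<in> I. f i x \<noteq> \<zero>\<^bsub>M\<^esub>}" by auto
  then show "(\<lambda>i\<in>I. f i x) \<in> carrier (copower M I)"
    using x assms by (auto simp: copower_carrier simp del: restrict_apply)
      (auto intro: mhomD(1))
qed (auto simp: mhomD [OF assms(1)] intro!: restrict_ext)

definition inj_at :: "('a, 'm, 'k) module_scheme \<Rightarrow> 'i set \<Rightarrow> 'i \<Rightarrow> 'm \<Rightarrow> 'i \<Rightarrow> 'm" where
  "inj_at M I i x = (\<lambda>j\<in>I. if j = i then x else \<zero>\<^bsub>M\<^esub>)"

lemma mhom_inj_at: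
  assumes "right_module R M"
  shows "inj_at M I i \<in> mhom R M (copower M I)"
proof -
  have "(\<lambda>x. \<lambda>j\<in>I. (if j = i then x else \<zero>\<^bsub>M\<^esub>)) \<in> mhom R M (copower M I)"
  proof (rule mhom_copowerI)
    show "(\<lambda>x. if j = i then x else \<zero>\<^bsub>M\<^esub>) \<in> mhom R M M" for j
      using mhom_id [of R M] mhom_const_zero [OF assms, of M] by (cases "j = i") auto
    show "finite {j \<in> I. (if j = i then x else \<zero>\<^bsub>M\<^esub>) \<noteq> \<zero>\<^bsub>M\<^esub>}" for x
      by (rule finite_subset [of _ "{i}"]) auto
  qed
  then show ?thesis by (simp add: inj_at_def [abs_def])
qed

text \<open>
  An element of a direct power is the finite sum of its coordinates, each put back in its place.
  The sets \<open>X i\<close> record what is known about the coordinates.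
\<close>

lemma copower_submodule_induct:
  assumes "right_module R M" "submodule H R (copower M I)"
    and "\<And>i x. i \<in> I \<Longrightarrow> x \<in> X i \<Longrightarrow> inj_at M I i x \<in> H"
    and "u \<in> carrier (copower M I)" "\<And>i. i \<in> I \<Longrightarrow> u i \<in> X i"
  shows "u \<in> H"
proof -
  interpret M: right_module R M by fact
  interpret C: right_module R "copower M I" by (rule copower_right_module) fact
  interpret H: submodule H R "copower M I" by fact
  have "finite A \<Longrightarrow> A \<subseteq> I \<Longrightarrow> (\<lambda>i\<in>I. if i \<in> A then u i else \<zero>\<^bsub>M\<^esub>) \<in> H" for A
  proof (induction A rule: finite_induct)
    case empty
    show ?case using H.one_closed by (simp add: restrict_def)
  next
    case (insert i A)
    have "(\<lambda>j\<in>I. if j \<in> insert i A then u j else \<zero>\<^bsub>M\<^esub>) =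
        inj_at M I i (u i) \<oplus>\<^bsub>copower M I\<^esub> (\<lambda>i\<in>I. if i \<in> A then u i else \<zero>\<^bsub>M\<^esub>)"
      using insert assms(4) by (auto simp: inj_at_def copower_carrier intro!: restrict_ext)
    moreover have "inj_at M I i (u i) \<in> H" using assms insert by auto
    ultimately show ?case using H.m_closed insert by (simp del: copower_simps restrict_apply)
  qed
  from this [of "{i \<in> I. u i \<noteq> \<zero>\<^bsub>M\<^esub>}"]
  have "(\<lambda>i\<in>I. if i \<in> {i \<in> I. u i \<noteq> \<zero>\<^bsub>M\<^esub>} then u i else \<zero>\<^bsub>M\<^esub>) \<in> H"
    using assms(4) by (auto simp: copower_carrier)
  moreover have "(\<lambda>i\<in>I. if i \<in> {i \<in> I. u i \<noteq> \<zero>\<^bsub>M\<^esub>} then u i else \<zero>\<^bsub>M\<^esub>) = u"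
    using assms(4) by (auto simp: copower_carrier extensional_def)
  ultimately show ?thesis by simp
qed

text \<open>
  The homomorphism out of a direct power that is \<open>h i\<close> on the summand \<open>i\<close>.  The sum runs over the
  support only, because a sum over an infinite index set is zero by convention.
\<close>

definition copair :: "('a, 'n, 'l) module_scheme \<Rightarrow> ('a, 'm, 'k) module_scheme \<Rightarrow> 'i set \<Rightarrow>
    ('i \<Rightarrow> 'm \<Rightarrow> 'n) \<Rightarrow> ('i \<Rightarrow> 'm) \<Rightarrow> 'n" where
  "copair N M I h u = finsum N (\<lambda>i. h i (u i)) {i \<in> I. u i \<noteq> \<zero>\<^bsub>M\<^esub>}"

text \<open>
  Passing to a larger finite set lets two elements be compared over one common index set.
\<close>

lemma copair_superset:
  assumes "right_module R M" "right_module R N" "\<And>i. i \<in> I \<Longrightarrow> h i \<in> mhom R M N"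
    and "u \<in> carrier (copower M I)" "finite A" "{i \<in> I. u i \<noteq> \<zero>\<^bsub>M\<^esub>} \<subseteq> A" "A \<subseteq> I"
  shows "copair N M I h u = finsum N (\<lambda>i. h i (u i)) A"
proof -
  interpret N: right_module R N by fact
  have "h i (u i) \<in> carrier N" if "i \<in> I" for i
    using assms(4) that by (auto simp: copower_carrier intro: mhomD(1) [OF assms(3)])
  moreover have "h i (u i) = \<zero>\<^bsub>N\<^esub>" if "i \<in> A - {i \<in> I. u i \<noteq> \<zero>\<^bsub>M\<^esub>}" for i
    using assms that mhom_zero [OF assms(1,2) assms(3)] by auto
  ultimately show ?thesis unfolding copair_def
    using assms by (intro N.add.finprod_mono_neutral_cong_left) auto
qed

lemma mhom_copair:
  assumes "right_module R M" "right_module R N" "\<And>i. i \<in> I \<Longrightarrow> h i \<in> mhom R M N"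
  shows "copair N M I h \<in> mhom R (copower M I) N"
proof -
  interpret M: right_module R M by fact
  interpret N: right_module R N by fact
  interpret C: right_module R "copower M I" by (rule copower_right_module) fact
  note sup = copair_superset [OF assms]
  have hom: "(\<lambda>u. finsum N (\<lambda>i. h i (u i)) A) \<in> mhom R (copower M I) N"
    if "finite A" "A \<subseteq> I" for A
    using that assms
    by (intro mhom_finsum_fun C.right_module_axioms mhom_comp [OF mhom_copower_nth]) auto
  let ?S = "\<lambda>u. {i \<in> I. u i \<noteq> \<zero>\<^bsub>M\<^esub>}"
  have fin: "finite (?S u)" if "u \<in> carrier (copower M I)" for u
    using that by (simp add: copower_carrier)
  show ?thesis
  proof (rule mhomI)
    fix u assume u: "u \<in> carrier (copower M I)"
    show "copair N M I h u \<in> carrier N" unfolding copair_def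
      using u by (intro N.finsum_closed) (auto simp: copower_carrier intro: mhomD(1) [OF assms(3)])
    fix v assume v: "v \<in> carrier (copower M I)"
    let ?A = "?S u \<union> ?S v"
    have A: "finite ?A" "?A \<subseteq> I" using fin u v by auto
    have uv: "u \<oplus>\<^bsub>copower M I\<^esub> v \<in> carrier (copower M I)" using u v by (rule C.a_closed)
    have "copair N M I h (u \<oplus>\<^bsub>copower M I\<^esub> v) =
        finsum N (\<lambda>i. h i ((u \<oplus>\<^bsub>copower M I\<^esub> v) i)) ?A"
      using A by (intro sup uv) auto
    also have "\<dots> = finsum N (\<lambda>i. h i (u i)) ?A \<oplus>\<^bsub>N\<^esub> finsum N (\<lambda>i. h i (v i)) ?A"
      using mhomD(2) [OF hom [OF A] u v] .
    also have "\<dots> = copair N M I h u \<oplus>\<^bsub>N\<^esub> copair N M I h v"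
      using A u v by (intro arg_cong2 [of _ _ _ _ "add N"] sup [symmetric]) auto
    finally show "copair N M I h (u \<oplus>\<^bsub>copower M I\<^esub> v) =
        copair N M I h u \<oplus>\<^bsub>N\<^esub> copair N M I h v" .
  next
    fix a u assume a: "a \<in> carrier R" and u: "u \<in> carrier (copower M I)"
    have au: "a \<odot>\<^bsub>copower M I\<^esub> u \<in> carrier (copower M I)" using a u by (rule C.smult_closed)
    have "copair N M I h (a \<odot>\<^bsub>copower M I\<^esub> u) =
        finsum N (\<lambda>i. h i ((a \<odot>\<^bsub>copower M I\<^esub> u) i)) (?S u)"
      using a u fin by (intro sup au) (auto simp: M.smult_zero_right)
    also have "\<dots> = a \<odot>\<^bsub>N\<^esub> copair N M I h u"
      using mhomD(3) [OF hom a u, of "?S u"] fin [OF u] by (auto simp: copair_def)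
    finally show "copair N M I h (a \<odot>\<^bsub>copower M I\<^esub> u) = a \<odot>\<^bsub>N\<^esub> copair N M I h u" .
  qed
qed

lemma copair_inj_at:
  assumes "right_module R M" "right_module R N" "\<And>i. i \<in> I \<Longrightarrow> h i \<in> mhom R M N"
    and "i \<in> I" "x \<in> carrier M"
  shows "copair N M I h (inj_at M I i x) = h i x"
proof -
  interpret N: right_module R N by fact
  have "copair N M I h (inj_at M I i x) = finsum N (\<lambda>j. h j (inj_at M I i x j)) {i}"
    using assms mhomD(1) [OF mhom_inj_at [OF assms(1)], of x]
    by (intro copair_superset [OF assms(1-3)]) (auto simp: inj_at_def split: if_splits)
  also have "\<dots> = h i x"
    using assms mhomD(1) [OF assms(3) [OF assms(4)] assms(5)] by (simp add: inj_at_def)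
  finally show ?thesis .
qed

section \<open>Congruence modulo an ideal\<close>

locale ideal_module = right_module R M + ideal J R
  for R :: "('a, 'r) ring_scheme" and M :: "('a, 'm, 'k) module_scheme" and J :: "'a set"

lemma ideal_moduleI: "\<lbrakk>right_module R M; ideal J R\<rbrakk> \<Longrightarrow> ideal_module R M J"
  by (simp add: ideal_module_def)

text \<open>
  Congruence modulo \<open>MJ\<close>.  Membership in the carrier is part of the relation, so that
  transitivity, additivity and the passage along homomorphisms have no side conditions.
\<close>

definition mcong :: "('a, 'm, 'k) module_scheme \<Rightarrow> 'a set \<Rightarrow> 'm \<Rightarrow> 'm \<Rightarrow> bool" where
  "mcong M J x y \<longleftrightarrow>
     x \<in> carrier M \<and> y \<in> carrier M \<and> x \<ominus>\<^bsub>M\<^esub> y \<in> module_ideal_prod M J"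

lemma (in abelian_group) minus_minus_cancel:
  assumes "x \<in> carrier G" "y \<in> carrier G" "z \<in> carrier G"
  shows "(x \<ominus> y) \<oplus> (y \<ominus> z) = x \<ominus> z"
  using assms by (simp add: minus_eq a_assoc r_neg1)

lemma (in abelian_group) minus_add_distrib:
  assumes "x \<in> carrier G" "y \<in> carrier G" "x' \<in> carrier G" "y' \<in> carrier G"
  shows "(x \<oplus> x') \<ominus> (y \<oplus> y') = (x \<ominus> y) \<oplus> (x' \<ominus> y')"
  using assms by (simp add: minus_eq minus_add a_ac)

lemma (in abelian_group) minus_swap:
  assumes "x \<in> carrier G" "y \<in> carrier G"
  shows "\<ominus> (x \<ominus> y) = y \<ominus> x"
  using assms by (simp add: minus_eq minus_add a_ac)

lemma (in abelian_group) minus_zero_right: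
  assumes "x \<in> carrier G" shows "x \<ominus> \<zero> = x"
  using assms by (simp add: minus_eq add.inv_one)

lemma (in abelian_group) minus_add_cancel:
  assumes "x \<in> carrier G" "y \<in> carrier G" shows "(x \<ominus> y) \<oplus> y = x"
  using assms by (simp add: minus_eq a_assoc l_neg)

lemma (in abelian_group) add_minus_cancel:
  assumes "x \<in> carrier G" "y \<in> carrier G" shows "(x \<oplus> y) \<ominus> y = x"
  using assms by (simp add: minus_eq a_assoc r_neg)

context right_module
begin

lemma smult_a_inv:
  assumes "a \<in> carrier R" "x \<in> carrier M"
  shows "a \<odot>\<^bsub>M\<^esub> (\<ominus>\<^bsub>M\<^esub> x) = \<ominus>\<^bsub>M\<^esub> (a \<odot>\<^bsub>M\<^esub> x)"
proof (rule M.minus_equality [symmetric])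
  show "a \<odot>\<^bsub>M\<^esub> (\<ominus>\<^bsub>M\<^esub> x) \<oplus>\<^bsub>M\<^esub> a \<odot>\<^bsub>M\<^esub> x = \<zero>\<^bsub>M\<^esub>"
    using assms by (simp add: M.l_neg smult_zero_right flip: smult_r_distr)
qed (use assms smult_closed in auto)

lemma submoduleD:
  assumes "submodule H R M"
  shows "H \<subseteq> carrier M" "\<zero>\<^bsub>M\<^esub> \<in> H" "\<And>x y. \<lbrakk>x \<in> H; y \<in> H\<rbrakk> \<Longrightarrow> x \<oplus>\<^bsub>M\<^esub> y \<in> H"
    "\<And>a x. \<lbrakk>a \<in> carrier R; x \<in> H\<rbrakk> \<Longrightarrow> a \<odot>\<^bsub>M\<^esub> x \<in> H" "\<And>x. x \<in> H \<Longrightarrow> \<ominus>\<^bsub>M\<^esub> x \<in> H"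
    "\<And>x y. \<lbrakk>x \<in> H; y \<in> H\<rbrakk> \<Longrightarrow> x \<ominus>\<^bsub>M\<^esub> y \<in> H"
proof -
  interpret H: submodule H R M by fact
  show "H \<subseteq> carrier M" "\<zero>\<^bsub>M\<^esub> \<in> H" and add: "\<And>x y. \<lbrakk>x \<in> H; y \<in> H\<rbrakk> \<Longrightarrow> x \<oplus>\<^bsub>M\<^esub> y \<in> H"
    and "\<And>a x. \<lbrakk>a \<in> carrier R; x \<in> H\<rbrakk> \<Longrightarrow> a \<odot>\<^bsub>M\<^esub> x \<in> H"
    and inv: "\<And>x. x \<in> H \<Longrightarrow> \<ominus>\<^bsub>M\<^esub> x \<in> H"
    using H.subset H.one_closed H.m_closed H.smult_closed H.m_inv_closed by (auto simp: a_inv_def)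
  then show "\<And>x y. \<lbrakk>x \<in> H; y \<in> H\<rbrakk> \<Longrightarrow> x \<ominus>\<^bsub>M\<^esub> y \<in> H" by (simp add: a_minus_def)
qed

lemma submodule_subgroup: "submodule H R M \<Longrightarrow> subgroup H (add_monoid M)"
  by (simp add: submodule_def)

end

lemma submodule_finsum:
  assumes "right_module R M" "submodule H R M" "finite A" "\<And>i. i \<in> A \<Longrightarrow> f i \<in> H"
  shows "finsum M f A \<in> H"
proof -
  interpret right_module R M by fact
  note H = submoduleD [OF assms(2)]
  show ?thesis using assms(3,4)
  proof (induction A)
    case (insert i A)
    have "finsum M f (insert i A) = f i \<oplus>\<^bsub>M\<^esub> finsum M f A"
      using insert H(1) by (intro M.finsum_insert) auto
    then show ?case using insert H(3) by simp
  qed (simp add: H)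
qed

lemma mhom_preimage_submodule:
  assumes "right_module R M" "right_module R N" "f \<in> mhom R M N" "submodule H R N"
  shows "submodule {x \<in> carrier M. f x \<in> H} R M"
proof -
  interpret M: right_module R M by fact
  interpret N: right_module R N by fact
  show ?thesis
    by (rule M.submoduleI')
      (auto simp: mhomD [OF assms(3)] M.smult_closed mhom_zero [OF assms(1-3)] N.submoduleD [OF assms(4)])
qed

context ideal_module
begin

lemma mip_generators: "{a \<odot>\<^bsub>M\<^esub> x |a x. a \<in> J \<and> x \<in> carrier M} \<subseteq> carrier (add_monoid M)"
  by (auto intro: smult_closed)

lemma mip_memI: "\<lbrakk>a \<in> J; x \<in> carrier M\<rbrakk> \<Longrightarrow> a \<odot>\<^bsub>M\<^esub> x \<in> module_ideal_prod M J"
  unfolding module_ideal_prod_def by (rule generate.incl) auto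

lemma mip_submodule: "submodule (module_ideal_prod M J) R M"
proof (intro submodule.intro submodule_axioms.intro)
  show sub: "subgroup (module_ideal_prod M J) (add_monoid M)" unfolding module_ideal_prod_def
    by (intro group.generate_is_subgroup M.a_group mip_generators)
  fix r x assume r: "r \<in> carrier R" and "x \<in> module_ideal_prod M J"
  then have "x \<in> generate (add_monoid M) {a \<odot>\<^bsub>M\<^esub> x | a x. a \<in> J \<and> x \<in> carrier M}"
    by (simp add: module_ideal_prod_def)
  then have "x \<in> carrier M \<and> r \<odot>\<^bsub>M\<^esub> x \<in> module_ideal_prod M J"
  proof induction
    case one
    then show ?case using subgroup.one_closed [OF sub] r by (simp add: smult_zero_right)
  next
    case (incl h)
    then obtain a x where h: "h = a \<odot>\<^bsub>M\<^esub> x" "a \<in> J" "x \<in> carrier M" by auto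
    then have "(a \<otimes>\<^bsub>R\<^esub> r) \<odot>\<^bsub>M\<^esub> x \<in> module_ideal_prod M J"
      using r by (intro mip_memI I_r_closed)
    then show ?case using h r by (simp add: smult_assoc smult_closed)
  next
    case (inv h)
    then obtain a x where h: "h = a \<odot>\<^bsub>M\<^esub> x" "a \<in> J" "x \<in> carrier M" by auto
    then have "(a \<otimes>\<^bsub>R\<^esub> r) \<odot>\<^bsub>M\<^esub> x \<in> module_ideal_prod M J"
      using r by (intro mip_memI I_r_closed)
    then have "r \<odot>\<^bsub>M\<^esub> h \<in> module_ideal_prod M J"
      using h r by (simp add: smult_assoc)
    then have "\<ominus>\<^bsub>M\<^esub> (r \<odot>\<^bsub>M\<^esub> h) \<in> module_ideal_prod M J"
      using subgroup.m_inv_closed [OF sub] by (simp add: a_inv_def)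
    moreover have "h \<in> carrier M" using h by (auto intro: smult_closed)
    ultimately show ?case using r by (auto simp: smult_a_inv simp flip: a_inv_def)
  next
    case (eng h1 h2)
    then show ?case using subgroup.m_closed [OF sub] r by (auto simp: smult_r_distr)
  qed
  then show "r \<odot>\<^bsub>M\<^esub> x \<in> module_ideal_prod M J" by simp
qed

lemmas mip = submoduleD [OF mip_submodule]

lemma mip_least:
  assumes "submodule H R M" "\<And>a x. \<lbrakk>a \<in> J; x \<in> carrier M\<rbrakk> \<Longrightarrow> a \<odot>\<^bsub>M\<^esub> x \<in> H"
  shows "module_ideal_prod M J \<subseteq> H"
  unfolding module_ideal_prod_def
  using assms by (intro group.generate_subgroup_incl M.a_group submodule_subgroup) auto

lemma mcong_refl: "x \<in> carrier M \<Longrightarrow> mcong M J x x"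
  using mip(2) by (simp add: mcong_def a_minus_def M.r_neg)

lemma mcong_sym: "mcong M J x y \<Longrightarrow> mcong M J y x"
  using mip(5) M.minus_swap unfolding mcong_def by metis

lemma mcong_trans [trans]: "\<lbrakk>mcong M J x y; mcong M J y z\<rbrakk> \<Longrightarrow> mcong M J x z"
  using mip(3) M.minus_minus_cancel unfolding mcong_def by metis

lemma mcong_add:
  "\<lbrakk>mcong M J x y; mcong M J x' y'\<rbrakk> \<Longrightarrow> mcong M J (x \<oplus>\<^bsub>M\<^esub> x') (y \<oplus>\<^bsub>M\<^esub> y')"
  using mip(3) by (simp add: mcong_def M.minus_add_distrib)

lemma mcong_a_inv: "mcong M J x y \<Longrightarrow> mcong M J (\<ominus>\<^bsub>M\<^esub> x) (\<ominus>\<^bsub>M\<^esub> y)"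
  using mip(5) [of "x \<ominus>\<^bsub>M\<^esub> y"] by (auto simp: mcong_def M.minus_eq M.minus_add)

lemma mcong_minus:
  "\<lbrakk>mcong M J x y; mcong M J x' y'\<rbrakk> \<Longrightarrow> mcong M J (x \<ominus>\<^bsub>M\<^esub> x') (y \<ominus>\<^bsub>M\<^esub> y')"
  by (simp add: M.minus_eq mcong_add mcong_a_inv)

lemma mcong_zero_iff: "mcong M J x \<zero>\<^bsub>M\<^esub> \<longleftrightarrow> x \<in> module_ideal_prod M J"
  using mip(1) by (auto simp: mcong_def M.minus_zero_right)

lemma mcong_smult_coeff:
  assumes "a \<in> carrier R" "b \<in> carrier R" "a \<ominus>\<^bsub>R\<^esub> b \<in> J" "x \<in> carrier M"
  shows "mcong M J (a \<odot>\<^bsub>M\<^esub> x) (b \<odot>\<^bsub>M\<^esub> x)"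
proof -
  have "(a \<ominus>\<^bsub>R\<^esub> b) \<odot>\<^bsub>M\<^esub> x \<oplus>\<^bsub>M\<^esub> b \<odot>\<^bsub>M\<^esub> x = a \<odot>\<^bsub>M\<^esub> x"
    using assms by (simp add: R.minus_add_cancel flip: smult_l_distr)
  then have "a \<odot>\<^bsub>M\<^esub> x \<ominus>\<^bsub>M\<^esub> b \<odot>\<^bsub>M\<^esub> x = (a \<ominus>\<^bsub>R\<^esub> b) \<odot>\<^bsub>M\<^esub> x"
    using assms smult_closed by (metis M.add_minus_cancel R.minus_closed)
  then show ?thesis using assms mip_memI by (simp add: mcong_def smult_closed)
qed

lemma mcong_finsum:
  assumes "finite A" "\<And>i. i \<in> A \<Longrightarrow> mcong M J (f i) (g i)"
  shows "mcong M J (finsum M f A) (finsum M g A)"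
  using assms
proof (induction A)
  case (insert i A)
  have "finsum M f (insert i A) = f i \<oplus>\<^bsub>M\<^esub> finsum M f A"
    "finsum M g (insert i A) = g i \<oplus>\<^bsub>M\<^esub> finsum M g A"
    using insert by (auto intro!: M.finsum_insert simp: mcong_def)
  then show ?case using insert by (simp add: mcong_add)
qed (simp add: mcong_refl)

end

lemma mip_hom:
  assumes "ideal J R" "right_module R M" "right_module R N" "f \<in> mhom R M N"
    and "x \<in> module_ideal_prod M J"
  shows "f x \<in> module_ideal_prod N J"
proof -
  interpret M: ideal_module R M J by (rule ideal_moduleI) fact+
  interpret N: ideal_module R N J by (rule ideal_moduleI) fact+
  have "module_ideal_prod M J \<subseteq> {x \<in> carrier M. f x \<in> module_ideal_prod N J}"
    by (intro M.mip_least mhom_preimage_submodule [OF assms(2-4) N.mip_submodule])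
      (auto simp: mhomD [OF assms(4)] M.smult_closed N.mip_memI)
  then show ?thesis using assms(5) by auto
qed

lemma mcong_hom:
  assumes "ideal J R" "right_module R M" "right_module R N" "f \<in> mhom R M N" "mcong M J x y"
  shows "mcong N J (f x) (f y)"
  using assms mip_hom [OF assms(1-4), of "x \<ominus>\<^bsub>M\<^esub> y"]
  by (auto simp: mcong_def mhomD(1) [OF assms(4)] mhom_minus [OF assms(2-4)])

lemma mip_regular:
  assumes "ideal J R" shows "module_ideal_prod (regular_module R) J = J"
proof
  interpret J: ideal J R by fact
  interpret ideal_module R "regular_module R" J
    by (intro ideal_moduleI regular_right_module assms J.ring_axioms)
  show "module_ideal_prod (regular_module R) J \<subseteq> J"
    by (rule mip_least, rule submoduleI')
      (auto simp: J.I_l_closed J.I_r_closed J.a_closed J.a_subset)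
  show "J \<subseteq> module_ideal_prod (regular_module R) J"
  proof
    fix a assume a: "a \<in> J"
    then show "a \<in> module_ideal_prod (regular_module R) J"
      using mip_memI [OF a, of "\<one>\<^bsub>R\<^esub>"] J.a_subset by auto
  qed
qed

lemma mcong_regular:
  assumes "ideal J R"
  shows "mcong (regular_module R) J x y \<longleftrightarrow> x \<in> carrier R \<and> y \<in> carrier R \<and> x \<ominus>\<^bsub>R\<^esub> y \<in> J"
  by (simp add: mcong_def mip_regular [OF assms])

lemma mip_copower:
  assumes "ideal J R" "right_module R M" "u \<in> carrier (copower M I)"
    and "\<And>i. i \<in> I \<Longrightarrow> u i \<in> module_ideal_prod M J"
  shows "u \<in> module_ideal_prod (copower M I) J"
proof -
  interpret C: ideal_module R "copower M I" J
    by (intro ideal_moduleI copower_right_module assms)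
  show ?thesis
  proof (rule copower_submodule_induct [OF assms(2) C.mip_submodule _ assms(3,4)])
    fix i x assume "i \<in> I" "x \<in> module_ideal_prod M J"
    then show "inj_at M I i x \<in> module_ideal_prod (copower M I) J"
      by (intro mip_hom [OF assms(1,2) C.right_module_axioms mhom_inj_at [OF assms(2)]])
  qed
qed

lemma mip_dsum:
  assumes "ideal J R" "right_module R M" "right_module R N"
    and "x \<in> module_ideal_prod M J" "y \<in> module_ideal_prod N J"
  shows "(x, y) \<in> module_ideal_prod (dsum M N) J"
proof -
  interpret M: ideal_module R M J by (intro ideal_moduleI assms)
  interpret N: ideal_module R N J by (intro ideal_moduleI assms)
  interpret D: ideal_module R "dsum M N" J
    by (intro ideal_moduleI dsum_right_module assms)
  have "(x, \<zero>\<^bsub>N\<^esub>) \<in> module_ideal_prod (dsum M N) J"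
    by (rule mip_hom [OF assms(1,2) D.right_module_axioms mhom_inl assms(4)]) fact
  moreover have "(\<zero>\<^bsub>M\<^esub>, y) \<in> module_ideal_prod (dsum M N) J"
    by (rule mip_hom [OF assms(1,3) D.right_module_axioms mhom_inr assms(5)]) fact
  ultimately have "(x, \<zero>\<^bsub>N\<^esub>) \<oplus>\<^bsub>dsum M N\<^esub> (\<zero>\<^bsub>M\<^esub>, y) \<in> module_ideal_prod (dsum M N) J"
    by (rule D.mip(3))
  moreover have "x \<in> carrier M" "y \<in> carrier N" using assms(4,5) M.mip(1) N.mip(1) by auto
  ultimately show ?thesis by simp
qed

lemma mcong_copowerI:
  assumes "ideal J R" "right_module R M" "u \<in> carrier (copower M I)" "v \<in> carrier (copower M I)"
    and "\<And>i. i \<in> I \<Longrightarrow> mcong M J (u i) (v i)"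
  shows "mcong (copower M I) J u v"
proof -
  note C = copower_right_module [OF assms(2), of I]
  interpret C: right_module R "copower M I" by (rule C)
  have "(u \<ominus>\<^bsub>copower M I\<^esub> v) i = u i \<ominus>\<^bsub>M\<^esub> v i" if "i \<in> I" for i
    using mhom_minus [OF C assms(2) mhom_copower_nth [OF that] assms(3,4)] .
  then show ?thesis
    using assms(3-5) mip_copower [OF assms(1,2), of "u \<ominus>\<^bsub>copower M I\<^esub> v"] by (simp add: mcong_def)
qed

lemma mcong_dsumI:
  assumes "ideal J R" "right_module R M" "right_module R N" "mcong M J x x'" "mcong N J y y'"
  shows "mcong (dsum M N) J (x, y) (x', y')"
proof -
  note D = dsum_right_module [OF assms(2,3)]
  interpret M: right_module R M by fact
  interpret N: right_module R N by fact
  interpret D: ideal_module R "dsum M N" J by (intro ideal_moduleI D assms)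
  have "mcong (dsum M N) J ((x, \<zero>\<^bsub>N\<^esub>) \<oplus>\<^bsub>dsum M N\<^esub> (\<zero>\<^bsub>M\<^esub>, y)) ((x', \<zero>\<^bsub>N\<^esub>) \<oplus>\<^bsub>dsum M N\<^esub> (\<zero>\<^bsub>M\<^esub>, y'))"
    by (intro D.mcong_add mcong_hom [OF assms(1,2) D mhom_inl] mcong_hom [OF assms(1,3) D mhom_inr] assms)
  then show ?thesis using assms(4,5) by (simp add: mcong_def)
qed

section \<open>Trace ideals\<close>

lemma trace_ideal_memI: "\<lbrakk>f \<in> mhom R M (regular_module R); x \<in> carrier M\<rbrakk> \<Longrightarrow> f x \<in> trace_ideal R M"
  unfolding trace_ideal_def by (rule generate.incl) auto

lemma trace_ideal_least:
  assumes "ring R" "subgroup H (add_monoid R)"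
    and "\<And>f x. \<lbrakk>f \<in> mhom R M (regular_module R); x \<in> carrier M\<rbrakk> \<Longrightarrow> f x \<in> H"
  shows "trace_ideal R M \<subseteq> H"
proof -
  interpret ring R by fact
  show ?thesis unfolding trace_ideal_def
    using assms(2,3) by (intro group.generate_subgroup_incl a_group) auto
qed

lemma trace_ideal_subgroup:
  assumes "ring R" shows "subgroup (trace_ideal R M) (add_monoid R)"
proof -
  interpret ring R by fact
  show ?thesis unfolding trace_ideal_def
    by (intro group.generate_is_subgroup a_group) (auto simp: mhom_def)
qed

lemma trace_ideal_ideal:
  assumes "right_module R M"
  shows "ideal (trace_ideal R M) R"
proof -
  interpret M: right_module R M by fact
  let ?T = "trace_ideal R M"
  have R: "ring R" by (rule M.R.ring_axioms)
  note sub = trace_ideal_subgroup [OF R, of M]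
  have l: "?T \<subseteq> {a \<in> carrier R. x \<otimes>\<^bsub>R\<^esub> a \<in> ?T}" if x: "x \<in> carrier R" for x
  proof (rule trace_ideal_least [OF R])
    show "subgroup {a \<in> carrier R. x \<otimes>\<^bsub>R\<^esub> a \<in> ?T} (add_monoid R)"
    proof (rule group.subgroupI [OF M.R.a_group])
      show "{a \<in> carrier R. x \<otimes>\<^bsub>R\<^esub> a \<in> ?T} \<noteq> {}"
        using subgroup.one_closed [OF sub] x by (auto intro!: exI [of _ "\<zero>\<^bsub>R\<^esub>"])
    qed (use x subgroup.m_closed [OF sub] subgroup.m_inv_closed [OF sub] in
        \<open>auto simp: M.R.r_distr M.R.r_minus simp flip: a_inv_def\<close>)
  qed (use x in \<open>auto dest: mhomD(1) intro!: trace_ideal_memI [OF mhom_smult_left [OF R x]]\<close>)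
  have r: "?T \<subseteq> {a \<in> carrier R. a \<otimes>\<^bsub>R\<^esub> x \<in> ?T}" if x: "x \<in> carrier R" for x
  proof (rule trace_ideal_least [OF R])
    show "subgroup {a \<in> carrier R. a \<otimes>\<^bsub>R\<^esub> x \<in> ?T} (add_monoid R)"
    proof (rule group.subgroupI [OF M.R.a_group])
      show "{a \<in> carrier R. a \<otimes>\<^bsub>R\<^esub> x \<in> ?T} \<noteq> {}"
        using subgroup.one_closed [OF sub] x by (auto intro!: exI [of _ "\<zero>\<^bsub>R\<^esub>"])
    qed (use x subgroup.m_closed [OF sub] subgroup.m_inv_closed [OF sub] in
        \<open>auto simp: M.R.l_distr M.R.l_minus simp flip: a_inv_def\<close>)
    fix f m assume f: "f \<in> mhom R M (regular_module R)" and m: "m \<in> carrier M"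
    have "f m \<otimes>\<^bsub>R\<^esub> x = f (x \<odot>\<^bsub>M\<^esub> m)" using mhomD(3) [OF f x m] by simp
    then show "f m \<in> {a \<in> carrier R. a \<otimes>\<^bsub>R\<^esub> x \<in> ?T}"
      using f m x mhomD(1) [OF f m] by (auto intro!: trace_ideal_memI M.smult_closed)
  qed
  show ?thesis using l r by (intro idealI R sub) auto
qed

lemma trace_ideal_subset:
  assumes "ideal J R" "right_module R M" "carrier M \<subseteq> module_ideal_prod M J"
  shows "trace_ideal R M \<subseteq> J"
proof -
  interpret ideal J R by fact
  note reg = regular_right_module [OF ring_axioms]
  show ?thesis
    using assms(3) mip_hom [OF assms(1,2) reg] mip_regular [OF assms(1)]
    by (intro trace_ideal_least ring_axioms a_subgroup) auto
qed

section \<open>Isomorphisms and retracts\<close>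

lemma misoI:
  assumes "f \<in> mhom R M N" "\<And>y. y \<in> carrier N \<Longrightarrow> g y \<in> carrier M"
    and "\<And>x. x \<in> carrier M \<Longrightarrow> g (f x) = x" "\<And>y. y \<in> carrier N \<Longrightarrow> f (g y) = y"
  shows "miso R M N"
  unfolding miso_def using assms mhomD(1) [OF assms(1)]
  by (intro bexI [OF _ assms(1)] bij_betwI [where g = g]) auto

text \<open>
  The inverse of a bijective homomorphism is a homomorphism.
\<close>

lemma misoE:
  assumes "miso R M N" "right_module R M"
  obtains f g where "f \<in> mhom R M N" "g \<in> mhom R N M"
    "\<And>x. x \<in> carrier M \<Longrightarrow> g (f x) = x" "\<And>y. y \<in> carrier N \<Longrightarrow> f (g y) = y"
proof -
  interpret M: right_module R M by fact
  obtain f where f: "f \<in> mhom R M N" and bij: "bij_betw f (carrier M) (carrier N)"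
    using assms(1) by (auto simp: miso_def)
  let ?g = "inv_into (carrier M) f"
  have gf: "?g (f x) = x" if "x \<in> carrier M" for x
    using bij that by (simp add: bij_betw_def)
  have fg: "f (?g y) = y" and g: "?g y \<in> carrier M" if "y \<in> carrier N" for y
    using bij that by (auto simp: bij_betw_def f_inv_into_f inv_into_into)
  have "?g \<in> mhom R N M"
  proof (rule mhomI)
    fix x y assume xy: "x \<in> carrier N" "y \<in> carrier N"
    have "?g (f (?g x \<oplus>\<^bsub>M\<^esub> ?g y)) = ?g x \<oplus>\<^bsub>M\<^esub> ?g y" by (rule gf) (simp add: g xy)
    then show "?g (x \<oplus>\<^bsub>N\<^esub> y) = ?g x \<oplus>\<^bsub>M\<^esub> ?g y" using xy by (simp add: mhomD(2) [OF f] fg g)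
  next
    fix a x assume ax: "a \<in> carrier R" "x \<in> carrier N"
    have "?g (f (a \<odot>\<^bsub>M\<^esub> ?g x)) = a \<odot>\<^bsub>M\<^esub> ?g x" by (rule gf) (simp add: g ax M.smult_closed)
    then show "?g (a \<odot>\<^bsub>N\<^esub> x) = a \<odot>\<^bsub>M\<^esub> ?g x" using ax by (simp add: mhomD(3) [OF f] fg g)
  qed (rule g)
  then show thesis using f gf fg by (intro that)
qed

lemma miso_refl: "miso R M M"
  by (rule misoI [OF mhom_id]) auto

lemma miso_sym:
  assumes "miso R M N" "right_module R M" shows "miso R N M"
proof -
  obtain f g where "f \<in> mhom R M N" "g \<in> mhom R N M"
    "\<And>x. x \<in> carrier M \<Longrightarrow> g (f x) = x" "\<And>y. y \<in> carrier N \<Longrightarrow> f (g y) = y"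
    using misoE [OF assms] by metis
  then show ?thesis using misoI [of g R N M f] mhomD(1) [of f R M N] by simp
qed

lemma miso_trans [trans]:
  assumes "miso R L M" "miso R M N" shows "miso R L N"
proof -
  obtain f g where f: "f \<in> mhom R L M" "bij_betw f (carrier L) (carrier M)"
    and g: "g \<in> mhom R M N" "bij_betw g (carrier M) (carrier N)"
    using assms by (auto simp: miso_def)
  then show ?thesis unfolding miso_def
    using mhom_comp [OF f(1) g(1)] bij_betw_trans [OF f(2) g(2)] by (auto simp: o_def)
qed

lemma dsum_cong:
  assumes "right_module R M" "right_module R N" "miso R M M'" "miso R N N'"
  shows "miso R (dsum M N) (dsum M' N')"
proof -
  obtain f f' where f: "f \<in> mhom R M M'" "f' \<in> mhom R M' M"
    "\<And>x. x \<in> carrier M \<Longrightarrow> f' (f x) = x" "\<And>y. y \<in> carrier M' \<Longrightarrow> f (f' y) = y"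
    using misoE [OF assms(3,1)] by metis
  obtain g g' where g: "g \<in> mhom R N N'" "g' \<in> mhom R N' N"
    "\<And>x. x \<in> carrier N \<Longrightarrow> g' (g x) = x" "\<And>y. y \<in> carrier N' \<Longrightarrow> g (g' y) = y"
    using misoE [OF assms(4,2)] by metis
  show ?thesis
    by (rule misoI [where f = "\<lambda>x. (f (fst x), g (snd x))" and g = "\<lambda>x. (f' (fst x), g' (snd x))"])
      (auto intro!: mhom_pair mhom_fst_comp mhom_snd_comp f g simp: mhomD(1) [OF f(2)] mhomD(1) [OF g(2)])
qed

lemma dsum_comm: "miso R (dsum M N) (dsum N M)"
  by (rule misoI [where f = "\<lambda>x. (snd x, fst x)" and g = "\<lambda>x. (snd x, fst x)"])
    (auto intro!: mhom_pair mhom_fst mhom_snd)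

lemma dsum_assoc: "miso R (dsum (dsum L M) N) (dsum L (dsum M N))"
  by (rule misoI [where f = "\<lambda>x. (fst (fst x), (snd (fst x), snd x))"
        and g = "\<lambda>x. ((fst x, fst (snd x)), snd (snd x))"])
    (auto intro!: mhomI)

lemma dsum_interchange: "miso R (dsum (dsum K L) (dsum M N)) (dsum (dsum K M) (dsum L N))"
  by (rule misoI [where f = "\<lambda>x. ((fst (fst x), fst (snd x)), (snd (fst x), snd (snd x)))"
        and g = "\<lambda>x. ((fst (fst x), fst (snd x)), (snd (fst x), snd (snd x)))"])
    (auto intro!: mhomI)

lemma dsum_zero: "right_module R M \<Longrightarrow> carrier Z = {\<zero>\<^bsub>Z\<^esub>} \<Longrightarrow> miso R (dsum M Z) M"
  by (rule misoI [OF mhom_fst, where g = "\<lambda>x. (x, \<zero>\<^bsub>Z\<^esub>)"]) auto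

lemma mhom_copower_map:
  assumes "right_module R M" "right_module R N" "f \<in> mhom R M N"
  shows "(\<lambda>u. \<lambda>i\<in>I. f (u i)) \<in> mhom R (copower M I) (copower N I)"
proof (rule mhom_copowerI)
  show "(\<lambda>u. f (u i)) \<in> mhom R (copower M I) N" if "i \<in> I" for i
    by (rule mhom_comp [OF mhom_copower_nth [OF that] assms(3)])
  show "finite {i \<in> I. f (u i) \<noteq> \<zero>\<^bsub>N\<^esub>}" if "u \<in> carrier (copower M I)" for u
    by (rule finite_subset [of _ "{i \<in> I. u i \<noteq> \<zero>\<^bsub>M\<^esub>}"])
      (use that mhom_zero [OF assms] in \<open>auto simp: copower_carrier\<close>)
qed

lemma copower_cong:
  assumes "right_module R M" "right_module R N" "miso R M N"
  shows "miso R (copower M I) (copower N I)"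
proof -
  obtain f g where f: "f \<in> mhom R M N" and g: "g \<in> mhom R N M"
    and gf: "\<And>x. x \<in> carrier M \<Longrightarrow> g (f x) = x" and fg: "\<And>y. y \<in> carrier N \<Longrightarrow> f (g y) = y"
    using misoE [OF assms(3,1)] by metis
  note F = mhom_copower_map [OF assms(1,2) f, of I] and G = mhom_copower_map [OF assms(2,1) g, of I]
  show ?thesis
  proof (rule misoI [OF F mhomD(1) [OF G]])
    show "(\<lambda>i\<in>I. g ((\<lambda>i\<in>I. f (u i)) i)) = u" if "u \<in> carrier (copower M I)" for u
      using that by (auto simp: copower_carrier gf extensional_def)
    show "(\<lambda>i\<in>I. f ((\<lambda>i\<in>I. g (u i)) i)) = u" if "u \<in> carrier (copower N I)" for u
      using that by (auto simp: copower_carrier fg extensional_def)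
  qed
qed

lemma dsum_copower:
  assumes "right_module R M" "right_module R N"
  shows "miso R (dsum (copower M I) (copower N I)) (copower (dsum M N) I)"
proof (rule misoI)
  show "(\<lambda>z. \<lambda>i\<in>I. (fst z i, snd z i)) \<in> mhom R (dsum (copower M I) (copower N I)) (copower (dsum M N) I)"
  proof (rule mhom_copowerI)
    show "(\<lambda>z. (fst z i, snd z i)) \<in> mhom R (dsum (copower M I) (copower N I)) (dsum M N)"
      if "i \<in> I" for i
      using that by (intro mhom_pair mhom_fst_comp [OF mhom_copower_nth] mhom_snd_comp [OF mhom_copower_nth])
    show "finite {i \<in> I. (fst z i, snd z i) \<noteq> \<zero>\<^bsub>dsum M N\<^esub>}"
      if "z \<in> carrier (dsum (copower M I) (copower N I))" for z
      by (rule finite_subset [of _ "{i \<in> I. fst z i \<noteq> \<zero>\<^bsub>M\<^esub>} \<union> {i \<in> I. snd z i \<noteq> \<zero>\<^bsub>N\<^esub>}"])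
        (use that in \<open>auto simp: copower_carrier\<close>)
  qed
  have hom: "(\<lambda>u. (\<lambda>i\<in>I. fst (u i), \<lambda>i\<in>I. snd (u i)))
      \<in> mhom R (copower (dsum M N) I) (dsum (copower M I) (copower N I))"
    by (intro mhom_pair mhom_copower_map mhom_fst mhom_snd dsum_right_module assms)
  show "(\<lambda>i\<in>I. fst (u i), \<lambda>i\<in>I. snd (u i)) \<in> carrier (dsum (copower M I) (copower N I))"
    if "u \<in> carrier (copower (dsum M N) I)" for u using mhomD(1) [OF hom that] .
qed (auto simp: copower_carrier extensional_def fun_eq_iff prod_eq_iff)

text \<open>
  Pairs of natural numbers are encoded by natural numbers.
\<close>

lemma copower_copower:
  assumes "right_module R M"
  shows "miso R (omega_power (omega_power M)) (omega_power M)"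
proof (rule misoI)
  let ?C = "omega_power M"
  let ?D = "omega_power ?C"
  show "(\<lambda>u. \<lambda>k\<in>UNIV. u (fst (prod_decode k)) (snd (prod_decode k))) \<in> mhom R ?D ?C"
  proof (rule mhom_copowerI)
    fix k :: nat
    show "(\<lambda>u. u (fst (prod_decode k)) (snd (prod_decode k))) \<in> mhom R ?D M"
      by (intro mhom_comp [OF mhom_copower_nth mhom_copower_nth]) auto
  next
    fix u assume u: "u \<in> carrier ?D"
    have "{k. u (fst (prod_decode k)) (snd (prod_decode k)) \<noteq> \<zero>\<^bsub>M\<^esub>} \<subseteq>
        prod_encode ` (SIGMA i : {i. u i \<noteq> \<zero>\<^bsub>?C\<^esub>}. {j. u i j \<noteq> \<zero>\<^bsub>M\<^esub>})"
      by (force simp: image_iff intro: exI [of _ "prod_decode _"])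
    moreover have "finite \<dots>"
      using u by (intro finite_imageI finite_SigmaI) (auto simp: copower_carrier)
    ultimately show "finite {k \<in> UNIV. u (fst (prod_decode k)) (snd (prod_decode k)) \<noteq> \<zero>\<^bsub>M\<^esub>}"
      by (auto intro: finite_subset)
  qed
  fix v assume v: "v \<in> carrier ?C"
  let ?u = "\<lambda>i\<in>UNIV. \<lambda>j\<in>UNIV. v (prod_encode (i, j))"
  have fin: "finite (prod_decode ` {k. v k \<noteq> \<zero>\<^bsub>M\<^esub>})" using v by (auto simp: copower_carrier)
  have row: "i = fst (prod_decode (prod_encode (i, j)))" and col: "j = snd (prod_decode (prod_encode (i, j)))"
    for i j by simp_all
  have "finite {j. v (prod_encode (i, j)) \<noteq> \<zero>\<^bsub>M\<^esub>}" for i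
    using col by (intro finite_subset [OF _ finite_imageI [OF fin, of snd]]) blast
  moreover have "finite {i. (\<lambda>j. v (prod_encode (i, j))) \<noteq> (\<lambda>j. \<zero>\<^bsub>M\<^esub>)}"
  proof (rule finite_subset [OF _ finite_imageI [OF fin, of fst]], rule subsetI)
    fix i assume "i \<in> {i. (\<lambda>j. v (prod_encode (i, j))) \<noteq> (\<lambda>j. \<zero>\<^bsub>M\<^esub>)}"
    then obtain j where "v (prod_encode (i, j)) \<noteq> \<zero>\<^bsub>M\<^esub>" by auto
    then show "i \<in> fst ` prod_decode ` {k. v k \<noteq> \<zero>\<^bsub>M\<^esub>}" using row [of i j] by blast
  qed
  ultimately show "?u \<in> carrier ?D"
    using v by (auto simp: copower_carrier restrict_UNIV)
qed (auto simp: fun_eq_iff)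

definition retract :: "('a, 'r) ring_scheme \<Rightarrow> ('a, 'm, 'k) module_scheme \<Rightarrow>
    ('a, 'n, 'l) module_scheme \<Rightarrow> bool" where
  "retract R P M \<longleftrightarrow> (\<exists>s\<in>mhom R P M. \<exists>g\<in>mhom R M P. \<forall>x\<in>carrier P. g (s x) = x)"

lemma retractI:
  "\<lbrakk>s \<in> mhom R P M; g \<in> mhom R M P; \<And>x. x \<in> carrier P \<Longrightarrow> g (s x) = x\<rbrakk> \<Longrightarrow> retract R P M"
  by (auto simp: retract_def)

lemma retract_trans:
  assumes "retract R L M" "retract R M N" shows "retract R L N"
proof -
  obtain s g where 1: "s \<in> mhom R L M" "g \<in> mhom R M L" "\<And>x. x \<in> carrier L \<Longrightarrow> g (s x) = x"
    using assms(1) by (auto simp: retract_def)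
  obtain s' g' where 2: "s' \<in> mhom R M N" "g' \<in> mhom R N M" "\<And>x. x \<in> carrier M \<Longrightarrow> g' (s' x) = x"
    using assms(2) by (auto simp: retract_def)
  show ?thesis
    by (rule retractI [OF mhom_comp [OF 1(1) 2(1)] mhom_comp [OF 2(2) 1(2)]])
      (simp add: 1(3) 2(3) mhomD(1) [OF 1(1)])
qed

lemma miso_imp_retract:
  assumes "miso R M N" "right_module R M" shows "retract R M N"
  using misoE [OF assms] retractI by metis

lemma retract_dsum:
  assumes "retract R M M'" "retract R N N'" shows "retract R (dsum M N) (dsum M' N')"
proof -
  obtain s g where 1: "s \<in> mhom R M M'" "g \<in> mhom R M' M" "\<And>x. x \<in> carrier M \<Longrightarrow> g (s x) = x"
    using assms(1) by (auto simp: retract_def)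
  obtain s' g' where 2: "s' \<in> mhom R N N'" "g' \<in> mhom R N' N" "\<And>x. x \<in> carrier N \<Longrightarrow> g' (s' x) = x"
    using assms(2) by (auto simp: retract_def)
  show ?thesis
    by (rule retractI [where s = "\<lambda>x. (s (fst x), s' (snd x))" and g = "\<lambda>x. (g (fst x), g' (snd x))"])
      (auto intro!: mhom_pair mhom_fst_comp mhom_snd_comp 1 2)
qed

lemma retract_copower:
  assumes "right_module R M" "right_module R N" "retract R M N"
  shows "retract R (copower M I) (copower N I)"
proof -
  obtain s g where s: "s \<in> mhom R M N" and g: "g \<in> mhom R N M"
    and id: "\<And>x. x \<in> carrier M \<Longrightarrow> g (s x) = x"
    using assms(3) by (auto simp: retract_def)
  show ?thesis
    by (rule retractI [OF mhom_copower_map [OF assms(1,2) s] mhom_copower_map [OF assms(2,1) g]])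
      (auto simp: id copower_carrier extensional_def)
qed

lemma retract_dsum_copower:
  assumes "right_module R M"
  shows "retract R (dsum M M) (omega_power M)"
proof (rule retractI)
  show "(\<lambda>z. \<lambda>i\<in>UNIV. if i = (0::nat) then fst z else if i = 1 then snd z else \<zero>\<^bsub>M\<^esub>)
      \<in> mhom R (dsum M M) (omega_power M)"
  proof (rule mhom_copowerI)
    show "(\<lambda>z. if i = (0::nat) then fst z else if i = 1 then snd z else \<zero>\<^bsub>M\<^esub>) \<in> mhom R (dsum M M) M" for i
      using mhom_fst [of R M M] mhom_snd [of R M M] mhom_const_zero [OF assms, of "dsum M M"]
      by (cases "i = 0"; cases "i = 1") simp_all
    show "finite {i \<in> UNIV. (if i = (0::nat) then fst z else if i = 1 then snd z else \<zero>\<^bsub>M\<^esub>) \<noteq> \<zero>\<^bsub>M\<^esub>}" for z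
      by (rule finite_subset [of _ "{0, 1}"]) auto
  qed
  show "(\<lambda>u. (u 0, u 1)) \<in> mhom R (omega_power M) (dsum M M)"
    by (intro mhom_pair mhom_copower_nth) auto
qed auto

section \<open>Countably generated projective modules\<close>

abbreviation free :: "('a, 'r) ring_scheme \<Rightarrow> 'a cmod" where
  "free R \<equiv> copower (regular_module R) UNIV"

abbreviation unit_vec :: "('a, 'r) ring_scheme \<Rightarrow> nat \<Rightarrow> nat \<Rightarrow> 'a" where
  "unit_vec R i \<equiv> inj_at (regular_module R) UNIV i \<one>\<^bsub>R\<^esub>"

text \<open>
  The dual basis form of being countably generated and projective.  Unlike the lifting property it
  mentions no test modules, so it applies to every carrier type, and it is visibly inherited by
  retracts, direct sums and countable direct powers.
\<close>

definition cgp :: "('a, 'r) ring_scheme \<Rightarrow> ('a, 'm, 'k) module_scheme \<Rightarrow> bool" where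
  "cgp R P \<longleftrightarrow> right_module R P \<and> retract R P (free R)"

lemma cgp_right_module: "cgp R P \<Longrightarrow> right_module R P"
  by (simp add: cgp_def)

lemma free_right_module: "ring R \<Longrightarrow> right_module R (free R)"
  by (intro copower_right_module regular_right_module)

lemma cgp_retract: "\<lbrakk>right_module R P; retract R P Q; cgp R Q\<rbrakk> \<Longrightarrow> cgp R P"
  using retract_trans by (auto simp: cgp_def)

lemma cgp_miso: "\<lbrakk>miso R P Q; cgp R P; right_module R Q\<rbrakk> \<Longrightarrow> cgp R Q"
  by (rule cgp_retract [OF _ miso_imp_retract [OF miso_sym]]) (auto simp: cgp_right_module)

lemma cgp_free: "ring R \<Longrightarrow> cgp R (free R)"
  by (auto simp: cgp_def free_right_module intro!: retractI mhom_id)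

lemma cgp_copower: "cgp R P \<Longrightarrow> cgp R (omega_power P)"
proof -
  assume P: "cgp R P"
  then have R: "ring R" by (auto simp: cgp_def right_module_ring)
  note F = regular_right_module [OF R]
  have "retract R (omega_power P) (omega_power (free R))"
    using P R by (intro retract_copower free_right_module) (auto simp: cgp_def)
  moreover have "retract R (omega_power (free R)) (free R)"
    by (intro miso_imp_retract copower_copower copower_right_module F)
  ultimately show ?thesis
    using P by (auto simp: cgp_def copower_right_module intro: retract_trans)
qed

lemma cgp_dsum:
  assumes "cgp R P" "cgp R Q" shows "cgp R (dsum P Q)"
proof -
  have R: "ring R" using assms by (auto simp: cgp_def right_module_ring)
  have "retract R (dsum P Q) (dsum (free R) (free R))"
    using assms by (intro retract_dsum) (auto simp: cgp_def)
  moreover have "retract R (dsum (free R) (free R)) (omega_power (free R))"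
    by (intro retract_dsum_copower free_right_module R)
  ultimately have "retract R (dsum P Q) (omega_power (free R))"
    by (rule retract_trans)
  from cgp_retract [OF dsum_right_module this] show ?thesis
    using assms R by (auto intro: cgp_right_module cgp_copower cgp_free)
qed

lemma unit_vec_closed: "ring R \<Longrightarrow> unit_vec R i \<in> carrier (free R)"
  by (rule mhomD(1) [OF mhom_inj_at [OF regular_right_module]]) (auto simp: ring.ring_simprules)

text \<open>
  The unit vectors generate the free module.
\<close>

lemma free_submodule_induct:
  assumes "ring R" "submodule H R (free R)" "\<And>i. unit_vec R i \<in> H"
  shows "carrier (free R) \<subseteq> H"
proof
  interpret ring R by fact
  interpret F: right_module R "free R" by (rule free_right_module) fact
  note reg = regular_right_module [OF assms(1)]
  fix u assume u: "u \<in> carrier (free R)"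
  show "u \<in> H"
  proof (rule copower_submodule_induct [OF reg assms(2) _ u])
    show "u i \<in> carrier R" for i using u by (auto simp: copower_carrier)
    fix i :: nat and x assume x: "x \<in> carrier R"
    have "inj_at (regular_module R) UNIV i x = x \<odot>\<^bsub>free R\<^esub> unit_vec R i"
      using x by (auto simp: inj_at_def)
    also have "\<dots> \<in> H" by (rule F.submoduleD(4) [OF assms(2) x assms(3)])
    finally show "inj_at (regular_module R) UNIV i x \<in> H" .
  qed
qed

lemma equalizer_submodule:
  assumes "right_module R M" "right_module R N" "f \<in> mhom R M N" "g \<in> mhom R M N"
  shows "submodule {x \<in> carrier M. f x = g x} R M"
proof -
  interpret M: right_module R M by fact
  show ?thesis
    by (rule M.submoduleI')
      (auto simp: mhomD [OF assms(3)] mhomD [OF assms(4)] M.smult_closed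
        mhom_zero [OF assms(1-3)] mhom_zero [OF assms(1,2,4)])
qed

text \<open>
  The generators are the images of the unit vectors.  Generation is stated as a property of
  submodules, which is the form in which it is applied.
\<close>

lemma cgp_generators:
  fixes P :: "('a, 'm, 'k) module_scheme"
  assumes "cgp R P"
  shows "\<exists>b :: nat \<Rightarrow> 'm. range b \<subseteq> carrier P \<and>
    (\<forall>H. submodule H R P \<longrightarrow> range b \<subseteq> H \<longrightarrow> carrier P \<subseteq> H)"
proof -
  interpret P: right_module R P by (rule cgp_right_module) fact
  note F = free_right_module [OF P.R.ring_axioms]
  obtain s g where s: "s \<in> mhom R P (free R)" and g: "g \<in> mhom R (free R) P"
    and id: "\<And>x. x \<in> carrier P \<Longrightarrow> g (s x) = x"
    using assms by (auto simp: cgp_def retract_def)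
  show ?thesis
  proof (intro exI [of _ "\<lambda>i. g (unit_vec R i)"] conjI allI impI)
    show "range (\<lambda>i. g (unit_vec R i)) \<subseteq> carrier P"
      using mhomD(1) [OF g unit_vec_closed [OF P.R.ring_axioms]] by auto
    fix H assume H: "submodule H R P" and sub: "range (\<lambda>i. g (unit_vec R i)) \<subseteq> H"
    have "carrier (free R) \<subseteq> {x \<in> carrier (free R). g x \<in> H}"
      using sub
      by (intro free_submodule_induct P.R.ring_axioms mhom_preimage_submodule [OF F P.right_module_axioms g H])
        (auto intro: unit_vec_closed P.R.ring_axioms)
    then show "carrier P \<subseteq> H" using id mhomD(1) [OF s] by force
  qed
qed

lemma free_mhom_ext:
  assumes "right_module R N" "f \<in> mhom R (free R) N" "g \<in> mhom R (free R) N"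
    and "\<And>i. f (unit_vec R i) = g (unit_vec R i)" "u \<in> carrier (free R)"
  shows "f u = g u"
proof -
  have R: "ring R" using assms(1) by (rule right_module_ring)
  have "carrier (free R) \<subseteq> {u \<in> carrier (free R). f u = g u}"
    using assms(4) unit_vec_closed [OF R]
    by (intro free_submodule_induct R equalizer_submodule [OF free_right_module [OF R] assms(1-3)]) auto
  then show ?thesis using assms(5) by auto
qed

lemma cgp_lifting:
  assumes "cgp R P" "right_module R M" "right_module R N"
    and "g \<in> mhom R M N" "g ` carrier M = carrier N" "f \<in> mhom R P N"
  shows "\<exists>h\<in>mhom R P M. \<forall>x\<in>carrier P. g (h x) = f x"
proof -
  interpret M: right_module R M by fact
  have R: "ring R" by (rule M.R.ring_axioms)
  note reg = regular_right_module [OF R]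
  obtain s t where s: "s \<in> mhom R P (free R)" and t: "t \<in> mhom R (free R) P"
    and id: "\<And>x. x \<in> carrier P \<Longrightarrow> t (s x) = x"
    using assms(1) by (auto simp: cgp_def retract_def)
  have "f (t (unit_vec R i)) \<in> g ` carrier M" for i
    using assms(5) mhomD(1) [OF assms(6) mhomD(1) [OF t unit_vec_closed [OF R]]] by simp
  then have "\<exists>m. m \<in> carrier M \<and> g m = f (t (unit_vec R i))" for i by (metis imageE)
  then obtain m where m: "\<And>i. m i \<in> carrier M" "\<And>i. g (m i) = f (t (unit_vec R i))" by metis
  let ?h = "copair M (regular_module R) UNIV (\<lambda>i a. a \<odot>\<^bsub>M\<^esub> m i)"
  have hi: "(\<lambda>a. a \<odot>\<^bsub>M\<^esub> m i) \<in> mhom R (regular_module R) M" for i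
    by (rule mhom_smult_right [OF assms(2) m(1) mhom_id])
  have h: "?h \<in> mhom R (free R) M" by (rule mhom_copair [OF reg assms(2) hi])
  have "g (?h u) = f (t u)" if "u \<in> carrier (free R)" for u
  proof (rule free_mhom_ext [OF assms(3) mhom_comp [OF h assms(4)] mhom_comp [OF t assms(6)] _ that])
    show "g (?h (unit_vec R i)) = f (t (unit_vec R i))" for i
      using m by (simp add: copair_inj_at [OF reg assms(2) hi] M.smult_one)
  qed
  then show ?thesis using id mhomD(1) [OF s] by (intro bexI [OF _ mhom_comp [OF s h]]) simp
qed

text \<open>
  A countable generating set gives a surjection from the free module of countable rank, which splits
  by projectivity.
\<close>

theorem cg_projective_iff_cgp:
  fixes P :: "('a, 'm) module"
  shows "cg_projective R P \<longleftrightarrow> cgp R P"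
proof
  assume P: "cgp R P"
  have "projective R P"
    using cgp_lifting [OF P] by (auto simp: projective_def cgp_right_module [OF P])
  moreover obtain b :: "nat \<Rightarrow> 'm" where b: "range b \<subseteq> carrier P"
    "\<And>H. submodule H R P \<Longrightarrow> range b \<subseteq> H \<Longrightarrow> carrier P \<subseteq> H"
    using cgp_generators [OF P] by auto
  have "mspan R P (range b) = carrier P"
    using b mspan_subset_carrier [OF cgp_right_module [OF P] b(1)] by (auto simp: mspan_def)
  ultimately show "cg_projective R P"
    using b(1) by (auto simp: cg_projective_def countably_generated_def)
next
  assume "cg_projective R P"
  then have proj: "projective R P" and P: "right_module R P" and "countably_generated R P"
    by (auto simp: cg_projective_def projective_def)
  then obtain S where S: "S \<subseteq> carrier P" "countable S" "mspan R P S = carrier P"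
    by (auto simp: countably_generated_def)
  interpret P: right_module R P by (rule P)
  define m where "m = from_nat_into (insert \<zero>\<^bsub>P\<^esub> S)"
  have rng: "range m = insert \<zero>\<^bsub>P\<^esub> S"
    unfolding m_def using S by (intro range_from_nat_into) auto
  have m: "m \<in> UNIV \<rightarrow> carrier P" 
    using rng S(1) by (metis P.zero_closed UNIV_I image_subset_iff_funcset insert_subset)
  have "mspan R P S \<subseteq> mspan R P (range m)" using rng by (auto simp: mspan_def)
  then have span: "mspan R P (range m) = carrier P"
    using S mspan_subset_carrier [OF P, of "range m"] m by auto
  have "retract R P (free R)"
    using projective_lifting [OF proj free_right_module [OF P.R.ring_axioms] P
      free_map_mhom [OF P m] free_map_surj [OF P m span] mhom_id] free_map_mhom [OF P m]
    by (auto simp: retract_def)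
  then show "cgp R P" using P by (simp add: cgp_def)
qed

section \<open>Splitting surjections\<close>

definition kernel_module :: "('a, 'm, 'k) module_scheme \<Rightarrow> ('a, 'n, 'l) module_scheme \<Rightarrow> ('m \<Rightarrow> 'n) \<Rightarrow>
    ('a, 'm, 'k) module_scheme" where
  "kernel_module M N h = M\<lparr>carrier := {x \<in> carrier M. h x = \<zero>\<^bsub>N\<^esub>}\<rparr>"

lemma kernel_module_simps [simp]:
  "carrier (kernel_module M N h) = {x \<in> carrier M. h x = \<zero>\<^bsub>N\<^esub>}"
  "zero (kernel_module M N h) = zero M" "add (kernel_module M N h) = add M"
  "smult (kernel_module M N h) = smult M"
  by (simp_all add: kernel_module_def)

lemma kernel_module_right_module:
  assumes "right_module R M" "right_module R N" "h \<in> mhom R M N"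
  shows "right_module R (kernel_module M N h)"
proof -
  interpret N: right_module R N by fact
  have "submodule {x \<in> carrier M. h x \<in> {\<zero>\<^bsub>N\<^esub>}} R M"
    by (intro mhom_preimage_submodule [OF assms] N.submoduleI') (auto simp: N.smult_zero_right)
  then show ?thesis unfolding kernel_module_def
    by (intro right_module.submodule_right_module assms(1)) simp
qed

lemma mhom_kernel_incl: "(\<lambda>x. x) \<in> mhom R (kernel_module M N h) M"
  by (rule mhomI) auto

text \<open>
  A homomorphism \<open>h\<close> with a section \<open>s\<close> splits its source into the kernel and a copy of its target;
  \<open>x - s(h x)\<close> is the component of \<open>x\<close> in the kernel.
\<close>

context
  fixes R :: "('a, 'r) ring_scheme" and M :: "('a, 'm, 'k) module_scheme"
    and N :: "('a, 'n, 'l) module_scheme" and h s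
  assumes M: "right_module R M" and N: "right_module R N"
    and h: "h \<in> mhom R M N" and s: "s \<in> mhom R N M" and hs: "\<And>y. y \<in> carrier N \<Longrightarrow> h (s y) = y"
begin

interpretation M: right_module R M by (rule M)
interpretation N: right_module R N by (rule N)

lemma split_projection: "(\<lambda>x. x \<ominus>\<^bsub>M\<^esub> s (h x)) \<in> mhom R M (kernel_module M N h)"
proof -
  have hom: "(\<lambda>x. x \<ominus>\<^bsub>M\<^esub> s (h x)) \<in> mhom R M M"
    by (intro mhom_diff M mhom_id mhom_comp [OF h s])
  have "h (x \<ominus>\<^bsub>M\<^esub> s (h x)) = \<zero>\<^bsub>N\<^esub>" if "x \<in> carrier M" for x
    using that mhomD(1) [OF h that] mhomD(1) [OF s]
    by (simp add: mhom_minus [OF M N h] hs) (simp add: a_minus_def N.r_neg)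
  then show ?thesis using hom by (auto simp: mhom_def)
qed

lemma split_projection_id: "x \<in> carrier (kernel_module M N h) \<Longrightarrow> x \<ominus>\<^bsub>M\<^esub> s (h x) = x"
  using mhom_zero [OF N M s] by (auto simp: M.minus_zero_right)

lemma split_retract: "retract R (kernel_module M N h) M"
  by (rule retractI [OF mhom_kernel_incl split_projection split_projection_id])

lemma split_miso: "miso R (dsum (kernel_module M N h) N) M"
proof (rule misoI [where g = "\<lambda>x. (x \<ominus>\<^bsub>M\<^esub> s (h x), h x)"])
  show "(\<lambda>z. fst z \<oplus>\<^bsub>M\<^esub> s (snd z)) \<in> mhom R (dsum (kernel_module M N h) N) M"
    by (intro mhom_add M mhom_fst_comp mhom_kernel_incl mhom_snd_comp s)
  fix y assume y: "y \<in> carrier M"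
  then have sy: "s (h y) \<in> carrier M" using mhomD(1) [OF s] mhomD(1) [OF h] by simp
  show "(y \<ominus>\<^bsub>M\<^esub> s (h y), h y) \<in> carrier (dsum (kernel_module M N h) N)"
    using mhomD(1) [OF split_projection y] mhomD(1) [OF h y] by simp
  show "fst (y \<ominus>\<^bsub>M\<^esub> s (h y), h y) \<oplus>\<^bsub>M\<^esub> s (snd (y \<ominus>\<^bsub>M\<^esub> s (h y), h y)) = y"
    using y sy by (simp add: M.minus_add_cancel)
next
  fix z assume z: "z \<in> carrier (dsum (kernel_module M N h) N)"
  then have sz: "s (snd z) \<in> carrier M" using mhomD(1) [OF s] by auto
  have "h (fst z \<oplus>\<^bsub>M\<^esub> s (snd z)) = snd z" using z sz by (auto simp: mhomD(2) [OF h] hs)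
  then show "(fst z \<oplus>\<^bsub>M\<^esub> s (snd z) \<ominus>\<^bsub>M\<^esub> s (h (fst z \<oplus>\<^bsub>M\<^esub> s (snd z))), h (fst z \<oplus>\<^bsub>M\<^esub> s (snd z))) = z"
    using z sz by (auto simp: M.add_minus_cancel)
qed

end

section \<open>The Eilenberg swindle\<close>

text \<open>
  For complementary idempotents \<open>c\<close> and \<open>e\<close>, this map moves the \<open>e\<close>-part of every coordinate one place
  down.  It serves twice: with exact idempotents in the swindle, and with idempotents modulo an ideal
  in the construction of modules.
\<close>

lemma mhom_shift_down:
  assumes "right_module R M" "c \<in> mhom R M M" "e \<in> mhom R M M"
  shows "(\<lambda>u. \<lambda>i\<in>UNIV. c (u i) \<oplus>\<^bsub>M\<^esub> e (u (Suc i)))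
    \<in> mhom R (omega_power M) (omega_power M)"
proof -
  interpret M: right_module R M by fact
  note zero = mhom_zero [OF assms(1,1,2)] mhom_zero [OF assms(1,1,3)]
  show ?thesis
  proof (rule mhom_copowerI)
    show "(\<lambda>u. c (u i) \<oplus>\<^bsub>M\<^esub> e (u (Suc i))) \<in> mhom R (omega_power M) M" for i
      by (intro mhom_add assms(1) mhom_comp [OF mhom_copower_nth assms(2)]
          mhom_comp [OF mhom_copower_nth assms(3)]) auto
    fix u assume "u \<in> carrier (omega_power M)"
    then have fin: "finite {i. u i \<noteq> \<zero>\<^bsub>M\<^esub>}" by (simp add: copower_carrier)
    have "{i \<in> UNIV. c (u i) \<oplus>\<^bsub>M\<^esub> e (u (Suc i)) \<noteq> \<zero>\<^bsub>M\<^esub>} \<subseteq>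
        {i. u i \<noteq> \<zero>\<^bsub>M\<^esub>} \<union> Suc -` {i. u i \<noteq> \<zero>\<^bsub>M\<^esub>}"
      by (auto simp: zero)
    then show "finite {i \<in> UNIV. c (u i) \<oplus>\<^bsub>M\<^esub> e (u (Suc i)) \<noteq> \<zero>\<^bsub>M\<^esub>}"
      using fin finite_vimageI [OF fin, of Suc] by (auto intro: finite_subset)
  qed
qed

text \<open>
  In the opposite direction the \<open>e\<close>-parts move one place up, and \<open>X\<close> fills the place that becomes
  free in coordinate \<open>0\<close>.
\<close>

lemma mhom_shift_up:
  assumes "right_module R M" "right_module R X" "c \<in> mhom R M M" "e \<in> mhom R M M" "s \<in> mhom R X M"
  shows "(\<lambda>z. \<lambda>i\<in>UNIV. c (snd z i) \<oplus>\<^bsub>M\<^esub> (case i of 0 \<Rightarrow> s (fst z) | Suc k \<Rightarrow> e (snd z k)))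
    \<in> mhom R (dsum X (omega_power M)) (omega_power M)"
proof -
  interpret M: right_module R M by fact
  note zero = mhom_zero [OF assms(1,1,3)] mhom_zero [OF assms(1,1,4)]
  let ?D = "dsum X (omega_power M)"
  show ?thesis
  proof (rule mhom_copowerI)
    have nth: "(\<lambda>z. f (snd z i)) \<in> mhom R ?D M" if "f \<in> mhom R M M" for f and i :: nat
      by (intro mhom_snd_comp [OF mhom_comp [OF mhom_copower_nth that]]) auto
    have "(\<lambda>z. case i of 0 \<Rightarrow> s (fst z) | Suc k \<Rightarrow> e (snd z k)) \<in> mhom R ?D M" for i
      using mhom_fst_comp [OF assms(5)] nth [OF assms(4)] by (cases i) auto
    then show "(\<lambda>z. c (snd z i) \<oplus>\<^bsub>M\<^esub> (case i of 0 \<Rightarrow> s (fst z) | Suc k \<Rightarrow> e (snd z k))) \<in> mhom R ?D M" for i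
      by (intro mhom_add assms(1) nth [OF assms(3)])
    fix z assume "z \<in> carrier ?D"
    then have fin: "finite {i. snd z i \<noteq> \<zero>\<^bsub>M\<^esub>}" by (auto simp: copower_carrier)
    have "{i \<in> UNIV. c (snd z i) \<oplus>\<^bsub>M\<^esub> (case i of 0 \<Rightarrow> s (fst z) | Suc k \<Rightarrow> e (snd z k)) \<noteq> \<zero>\<^bsub>M\<^esub>} \<subseteq>
        {i. snd z i \<noteq> \<zero>\<^bsub>M\<^esub>} \<union> Suc ` {i. snd z i \<noteq> \<zero>\<^bsub>M\<^esub>} \<union> {0}"
    proof
      fix i
      assume "i \<in> {i \<in> UNIV. c (snd z i) \<oplus>\<^bsub>M\<^esub> (case i of 0 \<Rightarrow> s (fst z) | Suc k \<Rightarrow> e (snd z k)) \<noteq> \<zero>\<^bsub>M\<^esub>}"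
      then show "i \<in> {i. snd z i \<noteq> \<zero>\<^bsub>M\<^esub>} \<union> Suc ` {i. snd z i \<noteq> \<zero>\<^bsub>M\<^esub>} \<union> {0}"
        by (cases i) (auto simp: zero)
    qed
    then show "finite {i \<in> UNIV. c (snd z i) \<oplus>\<^bsub>M\<^esub> (case i of 0 \<Rightarrow> s (fst z) | Suc k \<Rightarrow> e (snd z k)) \<noteq> \<zero>\<^bsub>M\<^esub>}"
      using fin by (auto intro: finite_subset)
  qed
qed

text \<open>
  Let \<open>e\<close> be the idempotent of \<open>M\<close> with image \<open>X\<close>, and \<open>c = 1 - e\<close>.  In
  \<open>M\<^sup>(\<^sup>\<omega>\<^sup>) = eM \<oplus> cM \<oplus> eM \<oplus> cM \<oplus> \<dots>\<close> one more copy of \<open>eM\<close> is absorbed by shifting the copies of \<open>eM\<close>.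
\<close>

lemma swindle:
  assumes "right_module R M" "right_module R X" "retract R X M"
  shows "miso R (dsum X (omega_power M)) (omega_power M)"
proof -
  interpret M: right_module R M by fact
  interpret X: right_module R X by fact
  let ?C = "omega_power M"
  obtain s g where s: "s \<in> mhom R X M" and g: "g \<in> mhom R M X" and gs: "\<And>x. x \<in> carrier X \<Longrightarrow> g (s x) = x"
    using assms(3) by (auto simp: retract_def)
  define e where "e x = s (g x)" for x
  define c where "c x = x \<ominus>\<^bsub>M\<^esub> e x" for x
  have e: "e \<in> mhom R M M" unfolding e_def [abs_def] by (rule mhom_comp [OF g s])
  have c: "c \<in> mhom R M M" unfolding c_def [abs_def] by (intro mhom_diff assms(1) mhom_id e)
  note cl = mhomD(1) [OF s] mhomD(1) [OF g] mhomD(1) [OF e] mhomD(1) [OF c]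
  note zero = mhom_zero [OF X.right_module_axioms M.right_module_axioms s]
    mhom_zero [OF M.right_module_axioms X.right_module_axioms g]
  have self: "x \<ominus>\<^bsub>M\<^esub> x = \<zero>\<^bsub>M\<^esub>" if "x \<in> carrier M" for x using that by (simp add: a_minus_def M.r_neg)
  have self': "x \<ominus>\<^bsub>X\<^esub> x = \<zero>\<^bsub>X\<^esub>" if "x \<in> carrier X" for x using that by (simp add: a_minus_def X.r_neg)
  have gc: "g (c x) = \<zero>\<^bsub>X\<^esub>" if "x \<in> carrier M" for x
    using that by (simp add: c_def e_def cl mhom_minus [OF assms(1,2) g] gs self')
  have cs: "c (s x) = \<zero>\<^bsub>M\<^esub>" if "x \<in> carrier X" for x
    using that by (simp add: c_def e_def cl gs self)
  have ec: "e (c x) = \<zero>\<^bsub>M\<^esub>" if "x \<in> carrier M" for x using gc that by (simp add: e_def zero)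
  have ce: "c (e x) = \<zero>\<^bsub>M\<^esub>" if "x \<in> carrier M" for x using cs that by (simp add: e_def cl)
  have cc: "c (c x) = c x" if "x \<in> carrier M" for x
    using ec that cl by (simp add: c_def [of "c x"] M.minus_zero_right)
  have ee: "e (e x) = e x" if "x \<in> carrier M" for x using that by (simp add: e_def cl gs)
  have es: "e (s x) = s x" if "x \<in> carrier X" for x using that by (simp add: e_def gs)
  have ge: "g (e x) = g x" if "x \<in> carrier M" for x using that by (simp add: e_def gs cl)
  have dec: "c x \<oplus>\<^bsub>M\<^esub> e x = x" if "x \<in> carrier M" for x
    using that cl by (simp add: c_def M.minus_add_cancel)
  have nth: "u i \<in> carrier M" if "u \<in> carrier ?C" for u i using that by (simp add: copower_carrier)
  show ?thesis
  proof (rule misoI [OF mhom_shift_up [OF assms(1,2) c e s],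
        where g = "\<lambda>n. (g (n 0), \<lambda>i\<in>UNIV. c (n i) \<oplus>\<^bsub>M\<^esub> e (n (Suc i)))"])
    fix n assume n: "n \<in> carrier ?C"
    show "(g (n 0), \<lambda>i\<in>UNIV. c (n i) \<oplus>\<^bsub>M\<^esub> e (n (Suc i))) \<in> carrier (dsum X ?C)"
      using mhomD(1) [OF mhom_shift_down [OF assms(1) c e] n] nth [OF n] cl by simp
    have *: "c (c (n i) \<oplus>\<^bsub>M\<^esub> e (n (Suc i))) = c (n i)" "e (c (n i) \<oplus>\<^bsub>M\<^esub> e (n (Suc i))) = e (n (Suc i))" for i
      using nth [OF n] cl by (simp_all add: mhomD(2) [OF c] mhomD(2) [OF e] cc ce ec ee)
    show "(\<lambda>i\<in>UNIV. c (snd (g (n 0), \<lambda>i\<in>UNIV. c (n i) \<oplus>\<^bsub>M\<^esub> e (n (Suc i))) i) \<oplus>\<^bsub>M\<^esub>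
        (case i of 0 \<Rightarrow> s (fst (g (n 0), \<lambda>i\<in>UNIV. c (n i) \<oplus>\<^bsub>M\<^esub> e (n (Suc i))))
         | Suc k \<Rightarrow> e (snd (g (n 0), \<lambda>i\<in>UNIV. c (n i) \<oplus>\<^bsub>M\<^esub> e (n (Suc i))) k))) = n"
      using dec nth [OF n] by (auto simp: fun_eq_iff * simp flip: e_def split: nat.splits)
  next
    fix z assume z: "z \<in> carrier (dsum X ?C)"
    then have sz: "snd z i \<in> carrier M" and fz: "fst z \<in> carrier X" for i using nth by auto
    let ?w = "\<lambda>i. case i of 0 \<Rightarrow> s (fst z) | Suc k \<Rightarrow> e (snd z k)"
    have w: "?w i \<in> carrier M" "c (?w i) = \<zero>\<^bsub>M\<^esub>" "e (?w i) = ?w i" for i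
      using sz fz cl cs ce ee es by (auto split: nat.splits)
    have "g (c (snd z 0) \<oplus>\<^bsub>M\<^esub> s (fst z)) = fst z"
      using sz fz cl by (simp add: mhomD(2) [OF g] gc gs)
    moreover have "c (c (snd z i) \<oplus>\<^bsub>M\<^esub> ?w i) \<oplus>\<^bsub>M\<^esub> e (c (snd z (Suc i)) \<oplus>\<^bsub>M\<^esub> e (snd z i)) = snd z i" for i
      using sz w cl by (simp add: mhomD(2) [OF c] mhomD(2) [OF e] cc ec ee dec)
    ultimately show "(g ((\<lambda>i\<in>UNIV. c (snd z i) \<oplus>\<^bsub>M\<^esub> ?w i) 0),
        \<lambda>i\<in>UNIV. c ((\<lambda>i\<in>UNIV. c (snd z i) \<oplus>\<^bsub>M\<^esub> ?w i) i) \<oplus>\<^bsub>M\<^esub>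
          e ((\<lambda>i\<in>UNIV. c (snd z i) \<oplus>\<^bsub>M\<^esub> ?w i) (Suc i))) = z"
      by (auto simp: prod_eq_iff fun_eq_iff)
  qed
qed

section \<open>Covering by powers of a module with given trace\<close>

text \<open>
  A product \<open>b \<cdot> f(t)\<close> with \<open>f : T \<rightarrow> R\<close> is the value at \<open>t\<close> of the homomorphism \<open>b \<cdot> f(-) : T \<rightarrow> B\<close>, and
  \<open>BJ\<close> is generated by such products when \<open>J\<close> is the trace of \<open>T\<close>.  The set of homomorphisms is kept
  finite for each element, so that countably many elements need only countably many of them.
\<close>

lemma mip_trace_finite_cover:
  assumes "right_module R T" "right_module R B" "y \<in> module_ideal_prod B (trace_ideal R T)"
  shows "\<exists>F. finite F \<and> F \<subseteq> mhom R T B \<and>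
    (\<forall>H. submodule H R B \<longrightarrow> (\<forall>h\<in>F. h ` carrier T \<subseteq> H) \<longrightarrow> y \<in> H)"
proof -
  interpret T: right_module R T by fact
  interpret B: right_module R B by fact
  note R = T.R.ring_axioms
  interpret BJ: ideal_module R B "trace_ideal R T" by (intro ideal_moduleI assms trace_ideal_ideal)
  define cov where "cov F z \<longleftrightarrow> (\<forall>H. submodule H R B \<longrightarrow> (\<forall>h\<in>F. h ` carrier T \<subseteq> H) \<longrightarrow> z \<in> H)" for F z
  define Z where "Z = {z \<in> carrier B. \<exists>F. finite F \<and> F \<subseteq> mhom R T B \<and> cov F z}"
  have Z0: "\<zero>\<^bsub>B\<^esub> \<in> Z"
    using B.submoduleD(2) by (auto simp: Z_def cov_def intro!: exI [of _ "{}"])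
  have Z: "submodule Z R B"
  proof (rule B.submoduleI')
    fix x z assume "x \<in> Z" "z \<in> Z"
    then obtain F G where *: "finite F" "F \<subseteq> mhom R T B" "cov F x" "finite G" "G \<subseteq> mhom R T B" "cov G z"
      and xz: "x \<in> carrier B" "z \<in> carrier B"
      by (auto simp: Z_def)
    then have "cov (F \<union> G) (x \<oplus>\<^bsub>B\<^esub> z)" using B.submoduleD(3) by (auto simp: cov_def)
    then show "x \<oplus>\<^bsub>B\<^esub> z \<in> Z" using * xz by (auto simp: Z_def intro!: exI [of _ "F \<union> G"])
  next
    fix a x assume a: "a \<in> carrier R" and "x \<in> Z"
    then obtain F where "finite F" "F \<subseteq> mhom R T B" "cov F x" "x \<in> carrier B" by (auto simp: Z_def)
    moreover have "cov F (a \<odot>\<^bsub>B\<^esub> x)"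
      using \<open>cov F x\<close> B.submoduleD(4) [OF _ a] by (auto simp: cov_def)
    ultimately show "a \<odot>\<^bsub>B\<^esub> x \<in> Z" using a by (auto simp: Z_def B.smult_closed)
  qed (use Z0 in \<open>auto simp: Z_def\<close>)
  have "module_ideal_prod B (trace_ideal R T) \<subseteq> Z"
  proof (rule BJ.mip_least [OF Z])
    fix a b assume a: "a \<in> trace_ideal R T" and b: "b \<in> carrier B"
    have "trace_ideal R T \<subseteq> {a \<in> carrier R. a \<odot>\<^bsub>B\<^esub> b \<in> Z}"
    proof (rule trace_ideal_least [OF R])
      show "subgroup {a \<in> carrier R. a \<odot>\<^bsub>B\<^esub> b \<in> Z} (add_monoid R)"
      proof (rule group.subgroupI [OF T.R.a_group])
        show "{a \<in> carrier R. a \<odot>\<^bsub>B\<^esub> b \<in> Z} \<noteq> {}"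
          using Z0 b by (auto intro!: exI [of _ "\<zero>\<^bsub>R\<^esub>"] simp: B.smult_zero_left)
        fix a assume a: "a \<in> {a \<in> carrier R. a \<odot>\<^bsub>B\<^esub> b \<in> Z}"
        have "(\<ominus>\<^bsub>R\<^esub> \<one>\<^bsub>R\<^esub>) \<odot>\<^bsub>B\<^esub> (a \<odot>\<^bsub>B\<^esub> b) \<in> Z" using a by (auto intro!: B.submoduleD(4) [OF Z, of "\<ominus>\<^bsub>R\<^esub> \<one>\<^bsub>R\<^esub>"])
        then have "(\<ominus>\<^bsub>R\<^esub> a) \<odot>\<^bsub>B\<^esub> b \<in> Z" using a b by (simp add: T.R.r_minus flip: B.smult_assoc)
        then show "inv\<^bsub>add_monoid R\<^esub> a \<in> {a \<in> carrier R. a \<odot>\<^bsub>B\<^esub> b \<in> Z}"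
          using a by (simp flip: a_inv_def)
      qed (use b B.submoduleD(3) [OF Z] in \<open>auto simp: B.smult_l_distr\<close>)
      fix f t assume f: "f \<in> mhom R T (regular_module R)" and t: "t \<in> carrier T"
      have hom: "(\<lambda>t. f t \<odot>\<^bsub>B\<^esub> b) \<in> mhom R T B" by (rule mhom_smult_right [OF assms(2) b f])
      have "cov {\<lambda>t. f t \<odot>\<^bsub>B\<^esub> b} (f t \<odot>\<^bsub>B\<^esub> b)" using t by (auto simp: cov_def)
      then have "f t \<odot>\<^bsub>B\<^esub> b \<in> Z" using hom mhomD(1) [OF hom t]
        unfolding Z_def by (intro CollectI conjI exI [of _ "{\<lambda>t. f t \<odot>\<^bsub>B\<^esub> b}"]) auto
      then show "f t \<in> {a \<in> carrier R. a \<odot>\<^bsub>B\<^esub> b \<in> Z}" using mhomD(1) [OF f t] by simp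
    qed
    then show "a \<odot>\<^bsub>B\<^esub> b \<in> Z" using a by auto
  qed
  then show ?thesis using assms(3) by (auto simp: Z_def cov_def)
qed

lemma mip_trace_cover:
  fixes y :: "nat \<Rightarrow> 'n" and B :: "('a, 'n, 'l) module_scheme"
  assumes "right_module R T" "right_module R B" "\<And>k. y k \<in> module_ideal_prod B (trace_ideal R T)"
  shows "\<exists>\<tau>\<in>mhom R (omega_power T) B. range y \<subseteq> \<tau> ` carrier (omega_power T)"
proof -
  let ?C = "omega_power T"
  have C: "right_module R ?C" by (rule copower_right_module) fact
  obtain F where F: "\<And>k. finite (F k)" "\<And>k. F k \<subseteq> mhom R T B"
    "\<And>k H. \<lbrakk>submodule H R B; \<forall>h\<in>F k. h ` carrier T \<subseteq> H\<rbrakk> \<Longrightarrow> y k \<in> H"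
    using mip_trace_finite_cover [OF assms] by metis
  let ?G = "insert (\<lambda>t. \<zero>\<^bsub>B\<^esub>) (\<Union>k. F k)"
  define h where "h = from_nat_into ?G"
  have rng: "range h = ?G" unfolding h_def
    by (rule range_from_nat_into) (auto intro: countable_finite F(1))
  have "?G \<subseteq> mhom R T B" using F(2) mhom_const_zero [OF assms(2)] by auto
  then have h: "h i \<in> mhom R T B" for i using rng by (metis UNIV_I image_subset_iff)
  let ?\<tau> = "copair B T UNIV h"
  have \<tau>: "?\<tau> \<in> mhom R ?C B" by (rule mhom_copair [OF assms(1,2) h])
  have "h i t \<in> ?\<tau> ` carrier ?C" if "t \<in> carrier T" for i t
  proof
    show "h i t = ?\<tau> (inj_at T UNIV i t)"
      using copair_inj_at [OF assms(1,2) h, of i UNIV t] that by simp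
    show "inj_at T UNIV i t \<in> carrier ?C" by (rule mhomD(1) [OF mhom_inj_at [OF assms(1)] that])
  qed
  then have "\<forall>g\<in>F k. g ` carrier T \<subseteq> ?\<tau> ` carrier ?C" for k
    using rng by (metis (no_types, lifting) UN_I UNIV_I image_iff image_subsetI insertI2)
  then have "y k \<in> ?\<tau> ` carrier ?C" for k
    by (intro F(3) mhom_image_submodule [OF C assms(2) \<tau>])
  then show ?thesis using \<tau> by auto
qed

text \<open>
  In the expansion of an element of \<open>T\<close> by a dual basis, the coefficients are values of functionals,
  hence lie in the trace ideal.
\<close>

lemma cgp_subset_mip_trace:
  assumes "cgp R T"
  shows "carrier T \<subseteq> module_ideal_prod T (trace_ideal R T)"
proof
  fix x assume x: "x \<in> carrier T"
  note T = cgp_right_module [OF assms]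
  note R = right_module_ring [OF T]
  note reg = regular_right_module [OF R] and F = free_right_module [OF R]
  note J = trace_ideal_ideal [OF T]
  obtain s g where s: "s \<in> mhom R T (free R)" and g: "g \<in> mhom R (free R) T" and "g (s x) = x"
    using assms x by (auto simp: cgp_def retract_def)
  have "s x i \<in> trace_ideal R T" for i
    by (intro trace_ideal_memI [OF mhom_comp [OF s mhom_copower_nth] x]) simp
  then have "s x \<in> module_ideal_prod (free R) (trace_ideal R T)"
    by (intro mip_copower [OF J reg] mhomD(1) [OF s x]) (simp add: mip_regular [OF J])
  from mip_hom [OF J F T g this] show "x \<in> module_ideal_prod T (trace_ideal R T)"
    by (simp add: \<open>g (s x) = x\<close>)
qed

lemma cgp_power_subset_mip_trace:
  assumes "cgp R T"
  shows "carrier (copower T I) \<subseteq> module_ideal_prod (copower T I) (trace_ideal R T)"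
proof
  fix u assume u: "u \<in> carrier (copower T I)"
  note T = cgp_right_module [OF assms]
  show "u \<in> module_ideal_prod (copower T I) (trace_ideal R T)"
    using u cgp_subset_mip_trace [OF assms]
    by (intro mip_copower [OF trace_ideal_ideal [OF T] T u]) (auto simp: copower_carrier)
qed

lemma cgp_section:
  assumes "cgp R B" "right_module R M" "h \<in> mhom R M B" "carrier B \<subseteq> h ` carrier M"
  shows "\<exists>s\<in>mhom R B M. \<forall>y\<in>carrier B. h (s y) = y"
proof -
  have "h ` carrier M = carrier B" using assms(4) mhomD(1) [OF assms(3)] by auto
  from cgp_lifting [OF assms(1,2) cgp_right_module [OF assms(1)] assms(3) this mhom_id]
  show ?thesis .
qed

text \<open>
  If \<open>B = f(A) + BJ\<close>, each of countably many generators of \<open>B\<close> differs from an element of \<open>f(A)\<close> by an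
  element of \<open>BJ\<close>.  A single map \<open>\<tau>\<close> from \<open>T\<^sup>(\<^sup>\<omega>\<^sup>)\<close> reaches all these differences, so \<open>f\<close> and \<open>\<tau>\<close> together
  are surjective, and projectivity of \<open>B\<close> gives a section.
\<close>

lemma surjective_mod_trace_section:
  fixes T :: "('a, 't, 'k) module_scheme" and A :: "('a, 'm, 'l) module_scheme"
    and B :: "('a, 'n, 'o) module_scheme"
  assumes "cgp R B" "right_module R A" "right_module R T" "f \<in> mhom R A B"
    and "\<And>y. y \<in> carrier B \<Longrightarrow> \<exists>x\<in>carrier A. mcong B (trace_ideal R T) (f x) y"
  obtains \<tau> s where "\<tau> \<in> mhom R (omega_power T) B"
    "s \<in> mhom R B (dsum A (omega_power T))"
    "\<And>y. y \<in> carrier B \<Longrightarrow> f (fst (s y)) \<oplus>\<^bsub>B\<^esub> \<tau> (snd (s y)) = y"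
proof -
  let ?J = "trace_ideal R T"
  let ?C = "omega_power T"
  note B = cgp_right_module [OF assms(1)]
  note C = copower_right_module [OF assms(3), of "UNIV :: nat set"]
  interpret B: ideal_module R B ?J by (intro ideal_moduleI B trace_ideal_ideal assms)
  obtain b :: "nat \<Rightarrow> 'n" where b: "range b \<subseteq> carrier B"
    "\<And>H. submodule H R B \<Longrightarrow> range b \<subseteq> H \<Longrightarrow> carrier B \<subseteq> H"
    using cgp_generators [OF assms(1)] by auto
  have bk: "b k \<in> carrier B" for k using b(1) by auto
  have "\<exists>x\<in>carrier A. mcong B ?J (f x) (b k)" for k by (rule assms(5) [OF bk])
  then obtain x where x: "\<And>k. x k \<in> carrier A" "\<And>k. mcong B ?J (b k) (f (x k))"
    using B.mcong_sym by metis
  then have "b k \<ominus>\<^bsub>B\<^esub> f (x k) \<in> module_ideal_prod B ?J" for k by (simp add: mcong_def)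
  from mip_trace_cover [OF assms(3) B, where y = "\<lambda>k. b k \<ominus>\<^bsub>B\<^esub> f (x k)", OF this]
  obtain \<tau> where \<tau>: "\<tau> \<in> mhom R ?C B" and sub: "range (\<lambda>k. b k \<ominus>\<^bsub>B\<^esub> f (x k)) \<subseteq> \<tau> ` carrier ?C"
    by (elim bexE)
  let ?h = "\<lambda>z. f (fst z) \<oplus>\<^bsub>B\<^esub> \<tau> (snd z)"
  have D: "right_module R (dsum A ?C)" by (intro dsum_right_module assms C)
  have h: "?h \<in> mhom R (dsum A ?C) B"
    by (intro mhom_add B mhom_fst_comp [OF assms(4)] mhom_snd_comp [OF \<tau>])
  have "b k \<in> ?h ` carrier (dsum A ?C)" for k
  proof -
    obtain t where t: "t \<in> carrier ?C" "b k \<ominus>\<^bsub>B\<^esub> f (x k) = \<tau> t" using sub by auto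
    have "b k = (b k \<ominus>\<^bsub>B\<^esub> f (x k)) \<oplus>\<^bsub>B\<^esub> f (x k)"
      using bk x mhomD(1) [OF assms(4)] by (simp add: B.M.minus_add_cancel)
    also have "\<dots> = ?h (x k, t)"
      using t x mhomD(1) [OF assms(4)] mhomD(1) [OF \<tau>] by (simp add: B.M.a_comm)
    finally show ?thesis using t x by (intro image_eqI [of _ _ "(x k, t)"]) auto
  qed
  then have "carrier B \<subseteq> ?h ` carrier (dsum A ?C)"
    by (intro b(2) [OF mhom_image_submodule [OF D B h]] image_subsetI)
  from cgp_section [OF assms(1) D h this] obtain s
    where s: "s \<in> mhom R B (dsum A ?C)" and id: "\<forall>y\<in>carrier B. ?h (s y) = y"
    by (elim bexE)
  show thesis by (rule that [OF \<tau> s bspec [OF id]])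
qed

text \<open>
  From \<open>X = XJ\<close> it follows that \<open>T\<^sup>(\<^sup>\<omega>\<^sup>)\<close> maps onto \<open>X\<close>.  So \<open>X\<close> is a retract of \<open>T\<^sup>(\<^sup>\<omega>\<^sup>)\<close>, and the swindle
  applies to \<open>(T\<^sup>(\<^sup>\<omega>\<^sup>))\<^sup>(\<^sup>\<omega>\<^sup>) \<cong> T\<^sup>(\<^sup>\<omega>\<^sup>)\<close>.
\<close>

lemma trace_power_absorbs:
  fixes T :: "('a, 't, 'k) module_scheme"
  assumes "cgp R X" "right_module R T" "carrier X \<subseteq> module_ideal_prod X (trace_ideal R T)"
  shows "miso R (dsum X (omega_power T)) (omega_power T)"
proof -
  let ?C = "omega_power T" and ?CC = "omega_power (omega_power T)"
  note X = cgp_right_module [OF assms(1)]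
  note C = copower_right_module [OF assms(2), of "UNIV :: nat set"]
  note CC = copower_right_module [OF C, of "UNIV :: nat set"]
  interpret X: ideal_module R X "trace_ideal R T" by (intro ideal_moduleI X trace_ideal_ideal assms)
  have "\<exists>x\<in>carrier X. mcong X (trace_ideal R T) \<zero>\<^bsub>X\<^esub> y" if "y \<in> carrier X" for y
  proof (rule bexI [OF _ that])
    have "mcong X (trace_ideal R T) y \<zero>\<^bsub>X\<^esub>" using that assms(3) by (auto simp: X.mcong_zero_iff)
    then show "mcong X (trace_ideal R T) \<zero>\<^bsub>X\<^esub> y" by (rule X.mcong_sym)
  qed
  then obtain \<tau> s where \<tau>: "\<tau> \<in> mhom R ?C X" and s: "s \<in> mhom R X (dsum X ?C)"
    and id: "\<And>y. y \<in> carrier X \<Longrightarrow> \<zero>\<^bsub>X\<^esub> \<oplus>\<^bsub>X\<^esub> \<tau> (snd (s y)) = y"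
    using surjective_mod_trace_section [OF assms(1) X assms(2) mhom_const_zero [OF X]] by blast
  have "retract R X ?C"
  proof (rule retractI [OF mhom_comp [OF s mhom_snd] \<tau>])
    fix y assume y: "y \<in> carrier X"
    then have "snd (s y) \<in> carrier ?C" using mhomD(1) [OF s] by (simp add: mem_Times_iff)
    then show "\<tau> (snd (s y)) = y" using id [OF y] mhomD(1) [OF \<tau>] by simp
  qed
  then have "miso R (dsum X ?CC) ?CC" by (rule swindle [OF C X])
  have iso: "miso R ?CC ?C" by (rule copower_copower [OF assms(2)])
  have "miso R (dsum X ?C) (dsum X ?CC)"
    by (intro dsum_cong X C miso_refl miso_sym [OF iso CC])
  also note \<open>miso R (dsum X ?CC) ?CC\<close>
  also note iso
  finally show ?thesis .
qed

section \<open>Modules absorbing a trace ideal\<close>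

text \<open>
  The first half of being relatively big, with the trace ideal of the witness made explicit.
\<close>

definition absorbs :: "('a, 'r) ring_scheme \<Rightarrow> 'a set \<Rightarrow> ('a, 'm, 'k) module_scheme \<Rightarrow> bool" where
  "absorbs R J P \<longleftrightarrow> cgp R P \<and>
     (\<exists>T :: 'a cmod. cgp R T \<and> trace_ideal R T = J \<and> miso R (dsum P (omega_power T)) P)"

lemma absorbs_cgp: "absorbs R J P \<Longrightarrow> cgp R P" and absorbs_ideal: "absorbs R J P \<Longrightarrow> ideal J R"
  using cgp_right_module trace_ideal_ideal by (auto simp: absorbs_def)

lemma absorbs_miso:
  assumes "absorbs R J P" "miso R P Q" "right_module R Q"
  shows "absorbs R J Q"
proof -
  obtain T :: "'a cmod" where T: "cgp R T" "trace_ideal R T = J"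
    and iso: "miso R (dsum P (omega_power T)) P"
    using assms(1) by (auto simp: absorbs_def)
  note C = copower_right_module [OF cgp_right_module [OF T(1)], of "UNIV :: nat set"]
  note P = cgp_right_module [OF absorbs_cgp [OF assms(1)]]
  have "miso R (dsum Q (omega_power T)) (dsum P (omega_power T))"
    by (intro dsum_cong assms C miso_refl miso_sym [OF assms(2) P])
  then have "miso R (dsum Q (omega_power T)) Q"
    using iso assms(2) by (blast intro: miso_trans)
  then show ?thesis
    using T cgp_miso [OF assms(2) absorbs_cgp [OF assms(1)] assms(3)] by (auto simp: absorbs_def)
qed

text \<open>
  Any \<open>X\<close> with \<open>X = XJ\<close> disappears in the summand \<open>T\<^sup>(\<^sup>\<omega>\<^sup>)\<close> that \<open>P\<close> has to spare.  In particular the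
  choice of \<open>T\<close> among the modules with trace ideal \<open>J\<close> does not matter.
\<close>

lemma absorbs_dsum_miso:
  assumes "absorbs R J P" "cgp R X" "carrier X \<subseteq> module_ideal_prod X J"
  shows "miso R (dsum P X) P"
proof -
  obtain T :: "'a cmod" where T: "cgp R T" "trace_ideal R T = J"
    and iso: "miso R (dsum P (omega_power T)) P"
    using assms(1) by (auto simp: absorbs_def)
  let ?C = "omega_power T"
  note TM = cgp_right_module [OF T(1)]
  note C = copower_right_module [OF TM, of "UNIV :: nat set"]
  note P = cgp_right_module [OF absorbs_cgp [OF assms(1)]] and X = cgp_right_module [OF assms(2)]
  note D = dsum_right_module [OF P C] and DX = dsum_right_module [OF C X]
  have "miso R (dsum X ?C) ?C"
    using trace_power_absorbs [OF assms(2) TM] assms(3) T(2) by simp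
  from miso_trans [OF dsum_comm this] have CX: "miso R (dsum ?C X) ?C" .
  have "miso R (dsum P X) (dsum (dsum P ?C) X)"
    by (intro dsum_cong P X miso_refl miso_sym [OF iso D])
  also have "miso R (dsum (dsum P ?C) X) (dsum P (dsum ?C X))" by (rule dsum_assoc)
  also have "miso R (dsum P (dsum ?C X)) (dsum P ?C)"
    by (intro dsum_cong P DX miso_refl CX)
  also note iso
  finally show ?thesis .
qed

text \<open>
  The surjection \<open>P \<oplus> T\<^sup>(\<^sup>\<omega>\<^sup>) \<rightarrow> Q\<close> extending \<open>f\<close> is injective modulo \<open>J\<close>: \<open>T\<^sup>(\<^sup>\<omega>\<^sup>)\<close> vanishes modulo \<open>J\<close>, and
  \<open>f\<close> has the left inverse \<open>g\<close>.  So its kernel \<open>K\<close> satisfies \<open>K = KJ\<close> and is absorbed by \<open>Q\<close>.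
\<close>

theorem absorbs_unique:
  assumes "absorbs R J P" "absorbs R J Q" "f \<in> mhom R P Q" "g \<in> mhom R Q P"
    and gf: "\<And>x. x \<in> carrier P \<Longrightarrow> mcong P J (g (f x)) x"
    and fg: "\<And>y. y \<in> carrier Q \<Longrightarrow> mcong Q J (f (g y)) y"
  shows "miso R P Q"
proof -
  obtain T :: "'a cmod" where T: "cgp R T" and tr: "trace_ideal R T = J"
    and iso: "miso R (dsum P (omega_power T)) P"
    using assms(1) by (auto simp: absorbs_def)
  let ?C = "omega_power T"
  note J = absorbs_ideal [OF assms(1)] and cQ = absorbs_cgp [OF assms(2)]
  note TM = cgp_right_module [OF T]
  note C = copower_right_module [OF TM, of "UNIV :: nat set"]
  note P = cgp_right_module [OF absorbs_cgp [OF assms(1)]] and Q = cgp_right_module [OF cQ]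
  interpret P: ideal_module R P J by (intro ideal_moduleI P J)
  interpret Q: ideal_module R Q J by (intro ideal_moduleI Q J)
  interpret C: ideal_module R ?C J by (intro ideal_moduleI C J)
  let ?M = "dsum P ?C"
  have M: "right_module R ?M" by (intro dsum_right_module P C)
  have "\<exists>x\<in>carrier P. mcong Q (trace_ideal R T) (f x) y" if "y \<in> carrier Q" for y
    using fg [OF that] mhomD(1) [OF assms(4) that] tr by auto
  then obtain \<tau> s where \<tau>: "\<tau> \<in> mhom R ?C Q" and s: "s \<in> mhom R Q ?M"
    and id: "\<And>y. y \<in> carrier Q \<Longrightarrow> f (fst (s y)) \<oplus>\<^bsub>Q\<^esub> \<tau> (snd (s y)) = y"
    using surjective_mod_trace_section [OF cQ P TM assms(3)] by blast
  let ?h = "\<lambda>z. f (fst z) \<oplus>\<^bsub>Q\<^esub> \<tau> (snd z)"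
  have h: "?h \<in> mhom R ?M Q"
    by (intro mhom_add Q mhom_fst_comp [OF assms(3)] mhom_snd_comp [OF \<tau>])
  let ?K = "kernel_module ?M Q ?h"
  have K: "right_module R ?K" by (rule kernel_module_right_module [OF M Q h])
  have cM: "cgp R ?M" by (intro cgp_dsum cgp_copower T absorbs_cgp [OF assms(1)])
  have cK: "cgp R ?K" by (rule cgp_retract [OF K split_retract [OF M Q h s id] cM])
  have "carrier ?K \<subseteq> module_ideal_prod ?K J"
  proof
    fix z assume z: "z \<in> carrier ?K"
    then have x: "fst z \<in> carrier P" and t: "snd z \<in> carrier ?C"
      and eq: "f (fst z) \<oplus>\<^bsub>Q\<^esub> \<tau> (snd z) = \<zero>\<^bsub>Q\<^esub>" by auto
    have t0: "mcong ?C J (snd z) \<zero>\<^bsub>?C\<^esub>"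
      unfolding C.mcong_zero_iff using t cgp_power_subset_mip_trace [OF T, of UNIV] tr by auto
    have "mcong Q J (\<tau> (snd z)) \<zero>\<^bsub>Q\<^esub>"
      using mcong_hom [OF J C Q \<tau> t0] mhom_zero [OF C Q \<tau>] by simp
    then have "mcong Q J (f (fst z) \<oplus>\<^bsub>Q\<^esub> \<tau> (snd z)) (f (fst z) \<oplus>\<^bsub>Q\<^esub> \<zero>\<^bsub>Q\<^esub>)"
      by (intro Q.mcong_add Q.mcong_refl mhomD(1) [OF assms(3) x])
    then have "mcong Q J (f (fst z)) \<zero>\<^bsub>Q\<^esub>"
      using eq mhomD(1) [OF assms(3) x] by (simp add: Q.mcong_sym)
    then have "mcong P J (g (f (fst z))) \<zero>\<^bsub>P\<^esub>"
      using mcong_hom [OF J Q P assms(4)] mhom_zero [OF Q P assms(4)] by metis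
    then have "mcong P J (fst z) \<zero>\<^bsub>P\<^esub>" using gf [OF x] P.mcong_sym P.mcong_trans by blast
    then have "(fst z, snd z) \<in> module_ideal_prod ?M J"
      using t0 by (intro mip_dsum [OF J P C]) (simp_all only: P.mcong_zero_iff C.mcong_zero_iff)
    \<comment> \<open>The projection onto the kernel fixes \<open>z\<close> and preserves products with \<open>J\<close>.\<close>
    then have "z \<ominus>\<^bsub>?M\<^esub> s (?h z) \<in> module_ideal_prod ?K J"
      by (intro mip_hom [OF J M K split_projection [OF M Q h s id]]) auto
    then show "z \<in> module_ideal_prod ?K J" using split_projection_id [OF M Q h s id z] by simp
  qed
  then have QK: "miso R (dsum Q ?K) Q" by (rule absorbs_dsum_miso [OF assms(2) cK])
  have "miso R P ?M" by (rule miso_sym [OF iso M])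
  also have "miso R ?M (dsum ?K Q)"
    by (rule miso_sym [OF split_miso [OF M Q h s id] dsum_right_module [OF K Q]])
  also have "miso R (dsum ?K Q) (dsum Q ?K)" by (rule dsum_comm)
  also note QK
  finally show ?thesis .
qed

text \<open>
  Modulo \<open>J\<close> the sequence \<open>0 \<rightarrow> e M \<rightarrow> M\<^sup>(\<^sup>\<omega>\<^sup>) \<rightarrow> M\<^sup>(\<^sup>\<omega>\<^sup>) \<rightarrow> 0\<close>, with the shift \<open>d\<close> on the right, is exact and
  split.  All its terms except the first lift to projective modules over \<open>R\<close>, hence so does the first,
  as the kernel \<open>K\<close> of a surjective lift of \<open>d\<close>.  The maps \<open>a\<close> and \<open>b\<close> identify \<open>P\<close> modulo \<open>J\<close> with
  the image of \<open>e\<close>.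
\<close>

theorem absorbs_exists:
  fixes M :: "('a, 'm) module" and T :: "'a cmod"
  assumes "cgp R M" "cgp R T" and e: "e \<in> mhom R M M"
    and idem: "\<forall>x\<in>carrier M. mcong M (trace_ideal R T) (e (e x)) (e x)"
  shows "\<exists>(P :: ('a, ((nat \<Rightarrow> 'm) \<times> (nat \<Rightarrow> nat \<Rightarrow> 'a)) \<times> (nat \<Rightarrow> nat \<Rightarrow> 'a)) module) a b.
    absorbs R (trace_ideal R T) P \<and> a \<in> mhom R M P \<and> b \<in> mhom R P M \<and>
    (\<forall>x\<in>carrier M. mcong M (trace_ideal R T) (b (a x)) (e x)) \<and>
    (\<forall>z\<in>carrier P. mcong P (trace_ideal R T) (a (b z)) z)"
proof -
  let ?J = "trace_ideal R T"
  note ee = bspec [OF idem]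
  let ?A = "omega_power M" and ?C = "omega_power T"
  let ?D = "dsum ?A ?C"
  note M = cgp_right_module [OF assms(1)] and TM = cgp_right_module [OF assms(2)]
  note J = trace_ideal_ideal [OF TM]
  note A = copower_right_module [OF M, of "UNIV :: nat set"]
  note C = copower_right_module [OF TM, of "UNIV :: nat set"]
  note D = dsum_right_module [OF A C]
  interpret M: ideal_module R M ?J by (intro ideal_moduleI M J)
  interpret A: ideal_module R ?A ?J by (intro ideal_moduleI A J)
  interpret C: ideal_module R ?C ?J by (intro ideal_moduleI C J)
  interpret D: ideal_module R ?D ?J by (intro ideal_moduleI D J)
  define c where "c x = x \<ominus>\<^bsub>M\<^esub> e x" for x
  have c: "c \<in> mhom R M M" unfolding c_def [abs_def] by (intro mhom_diff M mhom_id e)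
  note cl = mhomD(1) [OF e] mhomD(1) [OF c]
  note e0 = mhom_zero [OF M M e] and c0 = mhom_zero [OF M M c]
  note e_cong = mcong_hom [OF J M M e] and c_cong = mcong_hom [OF J M M c]
  have dec: "c x \<oplus>\<^bsub>M\<^esub> e x = x" if "x \<in> carrier M" for x
    using that cl by (simp add: c_def M.M.minus_add_cancel)
  have self: "mcong M ?J (x \<ominus>\<^bsub>M\<^esub> y) \<zero>\<^bsub>M\<^esub>" if "mcong M ?J x y" for x y
    unfolding M.mcong_zero_iff using that by (simp add: mcong_def)
  have ec: "mcong M ?J (e (c x)) \<zero>\<^bsub>M\<^esub>" and ce: "mcong M ?J (c (e x)) \<zero>\<^bsub>M\<^esub>"
    if x: "x \<in> carrier M" for x
    using self [OF M.mcong_sym [OF ee [OF x]]] x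
    by (simp_all add: c_def cl mhom_minus [OF M M e])
  have cc: "mcong M ?J (c (c x)) (c x)" if "x \<in> carrier M" for x
  proof -
    have "mcong M ?J (c x \<ominus>\<^bsub>M\<^esub> e (c x)) (c x \<ominus>\<^bsub>M\<^esub> \<zero>\<^bsub>M\<^esub>)"
      by (intro M.mcong_minus M.mcong_refl ec cl that)
    then show ?thesis using that by (simp add: c_def [of "c x"] cl M.M.minus_zero_right)
  qed
  have nth: "u i \<in> carrier M" if "u \<in> carrier ?A" for u i using that by (simp add: copower_carrier)
  let ?d = "\<lambda>u. \<lambda>i\<in>UNIV. c (u i) \<oplus>\<^bsub>M\<^esub> e (u (Suc i))"
  have d: "?d \<in> mhom R ?A ?A" by (rule mhom_shift_down [OF M c e])
  have surj: "\<exists>x\<in>carrier ?A. mcong ?A ?J (?d x) y" if y: "y \<in> carrier ?A" for y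
  proof
    \<comment> \<open>The preimage of \<open>y\<close> modulo \<open>J\<close> is the shift in the other direction.\<close>
    let ?w = "\<lambda>i. case i of 0 \<Rightarrow> \<zero>\<^bsub>M\<^esub> | Suc k \<Rightarrow> e (y k)"
    let ?u = "\<lambda>i\<in>UNIV. c (y i) \<oplus>\<^bsub>M\<^esub> ?w i"
    have "(\<zero>\<^bsub>M\<^esub>, y) \<in> carrier (dsum M ?A)" using y by simp
    from mhomD(1) [OF mhom_shift_up [OF M M c e mhom_id] this]
    show u: "?u \<in> carrier ?A" by (simp cong: nat.case_cong)
    show "mcong ?A ?J (?d ?u) y"
    proof (rule mcong_copowerI [OF J M mhomD(1) [OF d u] y])
      fix i :: nat
      have w: "?w i \<in> carrier M" "mcong M ?J (c (?w i)) \<zero>\<^bsub>M\<^esub>" for i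
        using ce nth [OF y] cl by (auto simp: c0 intro: M.mcong_refl split: nat.splits)
      have yi: "y i \<in> carrier M" for i by (rule nth [OF y])
      have "mcong M ?J (c (c (y i)) \<oplus>\<^bsub>M\<^esub> c (?w i)) (c (y i) \<oplus>\<^bsub>M\<^esub> \<zero>\<^bsub>M\<^esub>)"
        by (intro M.mcong_add cc w yi)
      moreover have "mcong M ?J (e (c (y (Suc i))) \<oplus>\<^bsub>M\<^esub> e (e (y i))) (\<zero>\<^bsub>M\<^esub> \<oplus>\<^bsub>M\<^esub> e (y i))"
        by (intro M.mcong_add ec ee yi)
      ultimately have "mcong M ?J ((c (c (y i)) \<oplus>\<^bsub>M\<^esub> c (?w i)) \<oplus>\<^bsub>M\<^esub> (e (c (y (Suc i))) \<oplus>\<^bsub>M\<^esub> e (e (y i))))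
          ((c (y i) \<oplus>\<^bsub>M\<^esub> \<zero>\<^bsub>M\<^esub>) \<oplus>\<^bsub>M\<^esub> (\<zero>\<^bsub>M\<^esub> \<oplus>\<^bsub>M\<^esub> e (y i)))"
        by (rule M.mcong_add)
      then show "mcong M ?J (?d ?u i) (y i)"
        using yi cl w(1) [of i] dec by (simp add: mhomD(2) [OF c] mhomD(2) [OF e])
    qed
  qed
  have cA: "cgp R ?A" by (rule cgp_copower [OF assms(1)])
  obtain \<tau> s where \<tau>: "\<tau> \<in> mhom R ?C ?A" and s: "s \<in> mhom R ?A ?D"
    and id: "\<And>y. y \<in> carrier ?A \<Longrightarrow> ?d (fst (s y)) \<oplus>\<^bsub>?A\<^esub> \<tau> (snd (s y)) = y"
    using surjective_mod_trace_section [OF cA A TM d surj] by blast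
  let ?h = "\<lambda>z. ?d (fst z) \<oplus>\<^bsub>?A\<^esub> \<tau> (snd z)"
  have h: "?h \<in> mhom R ?D ?A"
    by (intro mhom_add A mhom_fst_comp [OF d] mhom_snd_comp [OF \<tau>])
  let ?K = "kernel_module ?D ?A ?h"
  let ?\<rho> = "\<lambda>z. z \<ominus>\<^bsub>?D\<^esub> s (?h z)"
  have K: "right_module R ?K" by (rule kernel_module_right_module [OF D A h])
  note \<rho> = split_projection [OF D A h s id]
  have cD: "cgp R ?D" by (intro cgp_dsum cA cgp_copower assms)
  have cK: "cgp R ?K" by (rule cgp_retract [OF K split_retract [OF D A h s id] cD])
  let ?P = "dsum ?K ?C"
  have P: "right_module R ?P" by (rule dsum_right_module [OF K C])
  interpret K: ideal_module R ?K ?J by (intro ideal_moduleI K J)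
  have cP: "cgp R ?P" by (intro cgp_dsum cK cgp_copower assms)
  have t0: "mcong ?C ?J t \<zero>\<^bsub>?C\<^esub>" if "t \<in> carrier ?C" for t
    unfolding C.mcong_zero_iff using that cgp_power_subset_mip_trace [OF assms(2), of UNIV] by auto
  have \<tau>0: "mcong ?A ?J (\<tau> t) \<zero>\<^bsub>?A\<^esub>" if "t \<in> carrier ?C" for t
    using mcong_hom [OF J C A \<tau> t0 [OF that]] mhom_zero [OF C A \<tau>] by simp
  have absorbs: "absorbs R ?J ?P"
  proof -
    have "miso R (dsum ?P ?C) (dsum ?K (dsum ?C ?C))" by (rule dsum_assoc)
    also have "miso R (dsum ?C ?C) ?C"
      by (intro trace_power_absorbs cgp_copower assms TM cgp_power_subset_mip_trace)
    then have "miso R (dsum ?K (dsum ?C ?C)) ?P"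
      by (intro dsum_cong K dsum_right_module C miso_refl)
    finally show ?thesis using cP assms(2) by (auto simp: absorbs_def)
  qed
  let ?\<iota> = "inj_at M (UNIV :: nat set) 0"
  let ?a = "\<lambda>x. (?\<rho> (?\<iota> (e x), \<zero>\<^bsub>?C\<^esub>), \<zero>\<^bsub>?C\<^esub>)"
  let ?b = "\<lambda>z. fst (fst z) (0 :: nat)"
  note \<iota> = mhom_inj_at [OF M, of "UNIV :: nat set" 0]
  have \<iota>z: "(\<lambda>x. (?\<iota> (e x), \<zero>\<^bsub>?C\<^esub>)) \<in> mhom R M ?D"
    by (intro mhom_pair mhom_comp [OF e \<iota>] mhom_const_zero C)
  have a: "?a \<in> mhom R M ?P"
    by (intro mhom_pair mhom_comp [OF \<iota>z \<rho>] mhom_const_zero C)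
  have ev0: "(\<lambda>z. fst z (0 :: nat)) \<in> mhom R ?D M"
    by (rule mhom_fst_comp [OF mhom_copower_nth]) simp
  have b: "?b \<in> mhom R ?P M"
    by (rule mhom_comp [OF mhom_comp [OF mhom_fst mhom_kernel_incl] ev0])
  have ba: "mcong M ?J (?b (?a x)) (e x)" if x: "x \<in> carrier M" for x
  proof -
    let ?z = "(?\<iota> (e x), \<zero>\<^bsub>?C\<^esub>)"
    have z: "?z \<in> carrier ?D" by (rule mhomD(1) [OF \<iota>z x])
    then have \<iota>x: "?\<iota> (e x) \<in> carrier ?A" by simp
    have "mcong ?A ?J (?d (?\<iota> (e x))) \<zero>\<^bsub>?A\<^esub>"
    proof (rule mcong_copowerI [OF J M mhomD(1) [OF d \<iota>x] A.M.zero_closed])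
      fix i :: nat
      show "mcong M ?J (?d (?\<iota> (e x)) i) (\<zero>\<^bsub>?A\<^esub> i)"
        using ce [OF x] x cl by (cases i) (auto simp: inj_at_def e0 c0 M.mcong_refl)
    qed
    from A.mcong_add [OF this \<tau>0 [OF C.M.zero_closed]]
    have "mcong ?A ?J (?h ?z) \<zero>\<^bsub>?A\<^esub>"
      using A.M.l_zero [OF A.M.zero_closed] by (simp only: fst_conv snd_conv)
    from mcong_hom [OF J A D s this] have "mcong ?D ?J (s (?h ?z)) \<zero>\<^bsub>?D\<^esub>"
      by (simp only: mhom_zero [OF A D s])
    from D.mcong_minus [OF D.mcong_refl [OF z] this] have "mcong ?D ?J (?\<rho> ?z) ?z"
      by (simp only: D.M.minus_zero_right [OF z])
    from mcong_hom [OF J D M ev0 this] show ?thesis by (simp add: inj_at_def)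
  qed
  have ab: "mcong ?P ?J (?a (?b z)) z" if z: "z \<in> carrier ?P" for z
  proof -
    obtain u t t' where zeq: "z = ((u, t), t')" by (metis prod.collapse)
    have ut: "(u, t) \<in> carrier ?K" and t': "t' \<in> carrier ?C" using z zeq by auto
    then have u: "u \<in> carrier ?A" and t: "t \<in> carrier ?C" and hz: "?d u \<oplus>\<^bsub>?A\<^esub> \<tau> t = \<zero>\<^bsub>?A\<^esub>"
      by simp_all
    have du: "?d u \<in> carrier ?A" by (rule mhomD(1) [OF d u])
    from A.mcong_add [OF A.mcong_refl [OF du] A.mcong_sym [OF \<tau>0 [OF t]]]
    have "mcong ?A ?J (?d u) \<zero>\<^bsub>?A\<^esub>"
      by (simp only: hz A.M.r_zero [OF du])
    from mcong_hom [OF J A M mhom_copower_nth this]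
    have di: "mcong M ?J (c (u i) \<oplus>\<^bsub>M\<^esub> e (u (Suc i))) \<zero>\<^bsub>M\<^esub>" for i by fastforce
    \<comment> \<open>The congruence \<open>c(u\<^sub>i) + e(u\<^sub>i\<^sub>+\<^sub>1) \<equiv> 0\<close> falls apart into its \<open>e\<close>-part and its \<open>c\<close>-part.\<close>
    note ui = nth [OF u]
    have eu: "mcong M ?J (e (u (Suc i))) \<zero>\<^bsub>M\<^esub>" for i
    proof -
      have "mcong M ?J (e (c (u i)) \<oplus>\<^bsub>M\<^esub> e (e (u (Suc i)))) \<zero>\<^bsub>M\<^esub>"
        using e_cong [OF di [of i]] ui cl by (simp add: mhomD(2) [OF e] e0)
      moreover have "mcong M ?J (e (c (u i)) \<oplus>\<^bsub>M\<^esub> e (e (u (Suc i)))) (\<zero>\<^bsub>M\<^esub> \<oplus>\<^bsub>M\<^esub> e (u (Suc i)))"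
        by (intro M.mcong_add ec ee ui)
      ultimately show ?thesis
        using ui cl M.mcong_trans M.mcong_sym by (metis M.M.l_zero)
    qed
    have cu: "mcong M ?J (c (u i)) \<zero>\<^bsub>M\<^esub>" for i
    proof -
      have "mcong M ?J (c (u i) \<oplus>\<^bsub>M\<^esub> e (u (Suc i))) (c (u i) \<oplus>\<^bsub>M\<^esub> \<zero>\<^bsub>M\<^esub>)"
        by (intro M.mcong_add M.mcong_refl eu cl ui)
      then show ?thesis using di [of i] ui cl M.mcong_trans M.mcong_sym by (metis M.M.r_zero)
    qed
    have ue: "mcong M ?J (e (u i)) (u i)" for i
    proof -
      have "mcong M ?J (c (u i) \<oplus>\<^bsub>M\<^esub> e (u i)) (\<zero>\<^bsub>M\<^esub> \<oplus>\<^bsub>M\<^esub> e (u i))"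
        by (intro M.mcong_add M.mcong_refl cu cl ui)
      then show ?thesis using dec ui cl by (simp add: M.mcong_sym)
    qed
    have "mcong ?A ?J (?\<iota> (e (u 0))) u"
    proof (rule mcong_copowerI [OF J M mhomD(1) [OF mhom_comp [OF e \<iota>] ui] u])
      fix i :: nat
      have "mcong M ?J \<zero>\<^bsub>M\<^esub> (u (Suc k))" for k
        using eu [of k] ue [of "Suc k"] M.mcong_sym M.mcong_trans by blast
      then show "mcong M ?J (?\<iota> (e (u 0)) i) (u i)"
        using ue by (cases i) (auto simp: inj_at_def)
    qed
    from mcong_dsumI [OF J A C this C.mcong_sym [OF t0 [OF t]]]
    have "mcong ?D ?J (?\<iota> (e (u 0)), \<zero>\<^bsub>?C\<^esub>) (u, t)" .
    from mcong_hom [OF J D K \<rho> this]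
    have "mcong ?K ?J (?\<rho> (?\<iota> (e (u 0)), \<zero>\<^bsub>?C\<^esub>)) (u, t)"
      by (simp only: split_projection_id [OF D A h s id ut])
    from mcong_dsumI [OF J K C this C.mcong_sym [OF t0 [OF t']]]
    show ?thesis by (simp only: zeq fst_conv)
  qed
  show ?thesis
    by (intro exI [of _ ?P] exI [of _ ?a] exI [of _ ?b] conjI absorbs a b ballI ba ab)
qed

section \<open>Matrices modulo an ideal\<close>

definition cong_mod :: "('a, 'r) ring_scheme \<Rightarrow> 'a set \<Rightarrow> 'a \<Rightarrow> 'a \<Rightarrow> bool" where
  "cong_mod R J a b \<longleftrightarrow> a \<in> carrier R \<and> b \<in> carrier R \<and> a \<ominus>\<^bsub>R\<^esub> b \<in> J"

definition mat_mul :: "('a, 'r) ring_scheme \<Rightarrow> 'k set \<Rightarrow> ('i \<Rightarrow> 'k \<Rightarrow> 'a) \<Rightarrow> ('k \<Rightarrow> 'j \<Rightarrow> 'a) \<Rightarrow> 'i \<Rightarrow> 'j \<Rightarrow> 'a" where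
  "mat_mul R K A B i j = finsum R (\<lambda>k. A i k \<otimes>\<^bsub>R\<^esub> B k j) K"

lemma cong_mod_opp [simp]: "cong_mod (opp R) J = cong_mod R J"
  by (simp add: cong_mod_def fun_eq_iff)

lemma finsum_opp: "finsum (opp R) f A = finsum R f A"
  by (simp add: finsum_def finprod_def)

lemma finsum_regular: "finsum (regular_module R) f A = finsum R f A"
  by (simp add: finsum_def finprod_def)

lemma mat_mul_opp: "mat_mul (opp R) K A B i j = mat_mul R K (\<lambda>j k. B k j) (\<lambda>k i. A i k) j i"
  by (simp add: mat_mul_def finsum_opp)

lemma mcong_regular_iff: "ideal J R \<Longrightarrow> mcong (regular_module R) J x y \<longleftrightarrow> cong_mod R J x y"
  by (simp add: mcong_regular cong_mod_def)

lemma cong_modD: "cong_mod R J a b \<Longrightarrow> a \<in> carrier R" "cong_mod R J a b \<Longrightarrow> b \<in> carrier R"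
  by (simp_all add: cong_mod_def)

context
  fixes R :: "('a, 'r) ring_scheme" and J :: "'a set"
  assumes J: "ideal J R"
begin

interpretation J: ideal J R by (rule J)
interpretation L: ideal_module R "regular_module R" J
  by (intro ideal_moduleI regular_right_module J.ring_axioms J)

lemmas cong_mod_iff = mcong_regular_iff [OF J, symmetric]

lemma cong_mod_refl: "a \<in> carrier R \<Longrightarrow> cong_mod R J a a"
  using L.mcong_refl by (simp add: cong_mod_iff)

lemma cong_mod_sym: "cong_mod R J a b \<Longrightarrow> cong_mod R J b a"
  unfolding cong_mod_iff by (rule L.mcong_sym)

lemma cong_mod_trans: "\<lbrakk>cong_mod R J a b; cong_mod R J b c\<rbrakk> \<Longrightarrow> cong_mod R J a c"
  unfolding cong_mod_iff by (rule L.mcong_trans)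

lemma cong_mod_mult:
  assumes "cong_mod R J a b" "cong_mod R J c d"
  shows "cong_mod R J (a \<otimes>\<^bsub>R\<^esub> c) (b \<otimes>\<^bsub>R\<^esub> d)"
proof -
  note * = cong_modD [OF assms(1)] cong_modD [OF assms(2)]
  have "cong_mod R J (a \<otimes>\<^bsub>R\<^esub> c) (a \<otimes>\<^bsub>R\<^esub> d)"
    using L.mcong_smult_coeff [of c d a] assms * by (simp add: cong_mod_iff) (simp add: mcong_regular [OF J])
  moreover have "a \<otimes>\<^bsub>R\<^esub> d \<ominus>\<^bsub>R\<^esub> b \<otimes>\<^bsub>R\<^esub> d = (a \<ominus>\<^bsub>R\<^esub> b) \<otimes>\<^bsub>R\<^esub> d"
    using * by (simp add: J.minus_eq J.l_distr J.l_minus)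
  then have "cong_mod R J (a \<otimes>\<^bsub>R\<^esub> d) (b \<otimes>\<^bsub>R\<^esub> d)"
    using * assms(1) by (simp add: cong_mod_def J.I_r_closed)
  ultimately show ?thesis by (rule cong_mod_trans)
qed

lemma cong_mod_finsum:
  assumes "finite A" "\<And>i. i \<in> A \<Longrightarrow> cong_mod R J (f i) (g i)"
  shows "cong_mod R J (finsum R f A) (finsum R g A)"
  using L.mcong_finsum [of A f g] assms by (simp add: cong_mod_iff finsum_regular)

lemma cong_mod_mat_mul:
  assumes "finite K" "\<And>k. k \<in> K \<Longrightarrow> cong_mod R J (A i k) (A' i k)" "\<And>k. k \<in> K \<Longrightarrow> cong_mod R J (B k j) (B' k j)"
  shows "cong_mod R J (mat_mul R K A B i j) (mat_mul R K A' B' i j)"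
  unfolding mat_mul_def using assms by (intro cong_mod_finsum cong_mod_mult)

end

lemma (in abelian_monoid) finsum_swap:
  assumes "finite A" "finite B" "\<And>i j. \<lbrakk>i \<in> A; j \<in> B\<rbrakk> \<Longrightarrow> f i j \<in> carrier G"
  shows "(\<Oplus>i\<in>A. \<Oplus>j\<in>B. f i j) = (\<Oplus>j\<in>B. \<Oplus>i\<in>A. f i j)"
  using assms(1,3)
proof (induction A)
  case (insert a A)
  have "(\<Oplus>i\<in>insert a A. \<Oplus>j\<in>B. f i j) = (\<Oplus>j\<in>B. f a j) \<oplus> (\<Oplus>i\<in>A. \<Oplus>j\<in>B. f i j)"
    using insert by (intro finsum_insert) (auto intro!: finsum_closed)
  also have "\<dots> = (\<Oplus>j\<in>B. f a j) \<oplus> (\<Oplus>j\<in>B. \<Oplus>i\<in>A. f i j)" using insert by simp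
  also have "\<dots> = (\<Oplus>j\<in>B. f a j \<oplus> (\<Oplus>i\<in>A. f i j))"
    using insert by (intro finsum_addf [symmetric]) (auto intro!: finsum_closed)
  also have "\<dots> = (\<Oplus>j\<in>B. \<Oplus>i\<in>insert a A. f i j)"
    using insert by (intro finsum_cong') (auto intro!: finsum_closed finsum_insert [symmetric])
  finally show ?case .
qed simp

context right_module
begin

lemma smult_finsum:
  assumes "finite A" "a \<in> carrier R" "\<And>i. i \<in> A \<Longrightarrow> f i \<in> carrier M"
  shows "a \<odot>\<^bsub>M\<^esub> finsum M f A = finsum M (\<lambda>i. a \<odot>\<^bsub>M\<^esub> f i) A"
  using assms(1,3)
proof (induction A)
  case (insert i A)
  have "finsum M f (insert i A) = f i \<oplus>\<^bsub>M\<^esub> finsum M f A"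
    "finsum M (\<lambda>i. a \<odot>\<^bsub>M\<^esub> f i) (insert i A) = a \<odot>\<^bsub>M\<^esub> f i \<oplus>\<^bsub>M\<^esub> finsum M (\<lambda>i. a \<odot>\<^bsub>M\<^esub> f i) A"
    using insert assms(2) by (auto intro!: M.finsum_insert smult_closed)
  moreover have "finsum M f A \<in> carrier M" using insert by (intro M.finsum_closed) auto
  ultimately show ?case using insert assms(2) by (simp add: smult_r_distr)
qed (simp add: smult_zero_right assms(2))

lemma finsum_smult:
  assumes "finite A" "x \<in> carrier M" "\<And>i. i \<in> A \<Longrightarrow> a i \<in> carrier R"
  shows "finsum R a A \<odot>\<^bsub>M\<^esub> x = finsum M (\<lambda>i. a i \<odot>\<^bsub>M\<^esub> x) A"
  using assms(1,3)
proof (induction A)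
  case (insert i A)
  have "finsum R a (insert i A) = a i \<oplus>\<^bsub>R\<^esub> finsum R a A"
    "finsum M (\<lambda>i. a i \<odot>\<^bsub>M\<^esub> x) (insert i A) = a i \<odot>\<^bsub>M\<^esub> x \<oplus>\<^bsub>M\<^esub> finsum M (\<lambda>i. a i \<odot>\<^bsub>M\<^esub> x) A"
    using insert assms(2) by (auto intro!: M.finsum_insert R.finsum_insert smult_closed)
  moreover have "finsum R a A \<in> carrier R" using insert by (intro R.finsum_closed) auto
  ultimately show ?case using insert assms(2) by (simp add: smult_l_distr)
qed (simp add: smult_zero_left assms(2))

text \<open>
  A change of basis \<open>Y\<close> acts on coordinate columns \<open>w\<close> by matrix multiplication.  The column index
  \<open>j\<close> may have any type, so that families of functionals count as matrices.
\<close>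

lemma finsum_mat_mul:
  assumes "finite I" "finite K" "\<And>i. i \<in> I \<Longrightarrow> q i \<in> carrier M"
    and "\<And>i k. \<lbrakk>i \<in> I; k \<in> K\<rbrakk> \<Longrightarrow> Y i k \<in> carrier R" "\<And>k. k \<in> K \<Longrightarrow> w k j \<in> carrier R"
  shows "finsum M (\<lambda>k. w k j \<odot>\<^bsub>M\<^esub> finsum M (\<lambda>i. Y i k \<odot>\<^bsub>M\<^esub> q i) I) K =
    finsum M (\<lambda>i. mat_mul R K Y w i j \<odot>\<^bsub>M\<^esub> q i) I"
proof -
  have "finsum M (\<lambda>k. w k j \<odot>\<^bsub>M\<^esub> finsum M (\<lambda>i. Y i k \<odot>\<^bsub>M\<^esub> q i) I) K =
      finsum M (\<lambda>k. finsum M (\<lambda>i. (Y i k \<otimes>\<^bsub>R\<^esub> w k j) \<odot>\<^bsub>M\<^esub> q i) I) K"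
    using assms by (intro M.finsum_cong')
      (auto simp: smult_finsum smult_closed smult_assoc intro!: M.finsum_closed M.finsum_cong')
  also have "\<dots> = finsum M (\<lambda>i. finsum M (\<lambda>k. (Y i k \<otimes>\<^bsub>R\<^esub> w k j) \<odot>\<^bsub>M\<^esub> q i) K) I"
    using assms by (intro M.finsum_swap) (auto intro!: smult_closed)
  also have "\<dots> = finsum M (\<lambda>i. mat_mul R K Y w i j \<odot>\<^bsub>M\<^esub> q i) I"
    using assms by (intro M.finsum_cong')
      (auto simp: mat_mul_def finsum_smult intro!: smult_closed R.finsum_closed)
  finally show ?thesis .
qed

end

lemma mat_mul_assoc:
  assumes "ring R" "finite K" "finite L" "\<And>k. k \<in> K \<Longrightarrow> A i k \<in> carrier R"
    and "\<And>k l. \<lbrakk>k \<in> K; l \<in> L\<rbrakk> \<Longrightarrow> B k l \<in> carrier R" "\<And>l. l \<in> L \<Longrightarrow> C l j \<in> carrier R"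
  shows "mat_mul R L (mat_mul R K A B) C i j = mat_mul R K A (mat_mul R L B C) i j"
proof -
  interpret right_module R "regular_module R" by (rule regular_right_module) fact
  show ?thesis
    using finsum_mat_mul [of K L "A i" B C j] assms
    by (simp add: mat_mul_def [of R L _ C i j] mat_mul_def [of R K A _ i] finsum_regular)
qed

section \<open>Dual bases modulo an ideal\<close>

text \<open>
  Lifts to \<open>P\<close> of a finite dual basis of the \<open>R/J\<close>-module \<open>P/PJ\<close>.
\<close>

definition dual_basis_mod :: "('a, 'r) ring_scheme \<Rightarrow> 'a set \<Rightarrow> ('a, 'm, 'k) module_scheme \<Rightarrow>
    nat set \<Rightarrow> (nat \<Rightarrow> 'm) \<Rightarrow> (nat \<Rightarrow> 'm \<Rightarrow> 'a) \<Rightarrow> bool" where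
  "dual_basis_mod R J P I p \<phi> \<longleftrightarrow> finite I \<and>
     (\<forall>i\<in>I. p i \<in> carrier P \<and> \<phi> i \<in> mhom R P (regular_module R)) \<and>
     (\<forall>x\<in>carrier P. mcong P J (finsum P (\<lambda>i. \<phi> i x \<odot>\<^bsub>P\<^esub> p i) I) x)"

text \<open>
  Modulo \<open>J\<close> the matrix \<open>E\<close> is idempotent, and its image is isomorphic to \<open>P/PJ\<close>.
\<close>

definition gram_mod :: "('a, 'r) ring_scheme \<Rightarrow> 'a set \<Rightarrow> ('a, 'm, 'k) module_scheme \<Rightarrow>
    nat set \<Rightarrow> (nat \<Rightarrow> nat \<Rightarrow> 'a) \<Rightarrow> bool" where
  "gram_mod R J P I E \<longleftrightarrow> (\<exists>p \<phi>. dual_basis_mod R J P I p \<phi> \<and>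
     (\<forall>i\<in>I. \<forall>j\<in>I. cong_mod R J (\<phi> i (p j)) (E i j)))"

lemma dual_basis_modD:
  assumes "dual_basis_mod R J P I p \<phi>"
  shows "finite I" "\<And>i. i \<in> I \<Longrightarrow> p i \<in> carrier P" "\<And>i. i \<in> I \<Longrightarrow> \<phi> i \<in> mhom R P (regular_module R)"
    "\<And>i x. \<lbrakk>i \<in> I; x \<in> carrier P\<rbrakk> \<Longrightarrow> \<phi> i x \<in> carrier R"
    "\<And>x. x \<in> carrier P \<Longrightarrow> mcong P J (finsum P (\<lambda>i. \<phi> i x \<odot>\<^bsub>P\<^esub> p i) I) x"
  using assms mhomD(1) [of "\<phi> _" R P "regular_module R"] by (auto simp: dual_basis_mod_def)

lemma mhom_dual_expansion:
  assumes "right_module R P" "right_module R Q" "f \<in> mhom R P Q" "finite I"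
    and "\<And>i. i \<in> I \<Longrightarrow> p i \<in> carrier P" "\<And>i. i \<in> I \<Longrightarrow> a i \<in> carrier R"
  shows "f (finsum P (\<lambda>i. a i \<odot>\<^bsub>P\<^esub> p i) I) = finsum Q (\<lambda>i. a i \<odot>\<^bsub>Q\<^esub> f (p i)) I"
proof -
  interpret P: right_module R P by fact
  interpret Q: right_module R Q by fact
  have "f (finsum P (\<lambda>i. a i \<odot>\<^bsub>P\<^esub> p i) I) = finsum Q (\<lambda>i. f (a i \<odot>\<^bsub>P\<^esub> p i)) I"
    using assms by (intro mhom_finsum [OF assms(1-3)]) (auto intro: P.smult_closed)
  also have "\<dots> = finsum Q (\<lambda>i. a i \<odot>\<^bsub>Q\<^esub> f (p i)) I"
    using assms(5,6) by (intro Q.finsum_cong')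
      (auto simp: mhomD(3) [OF assms(3)] intro!: Q.smult_closed mhomD(1) [OF assms(3)])
  finally show ?thesis .
qed

lemma gram_mod_miso:
  assumes "ideal J R" "right_module R P" "right_module R Q" "miso R P Q" "gram_mod R J P I E"
  shows "gram_mod R J Q I E"
proof -
  interpret P: right_module R P by fact
  obtain f g where f: "f \<in> mhom R P Q" and g: "g \<in> mhom R Q P"
    and gf: "\<And>x. x \<in> carrier P \<Longrightarrow> g (f x) = x" and fg: "\<And>y. y \<in> carrier Q \<Longrightarrow> f (g y) = y"
    using misoE [OF assms(4,2)] by metis
  obtain p \<phi> where b: "dual_basis_mod R J P I p \<phi>"
    and E: "\<forall>i\<in>I. \<forall>j\<in>I. cong_mod R J (\<phi> i (p j)) (E i j)"
    using assms(5) by (auto simp: gram_mod_def)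
  note D = dual_basis_modD [OF b]
  have "mcong Q J (finsum Q (\<lambda>i. \<phi> i (g y) \<odot>\<^bsub>Q\<^esub> f (p i)) I) y" if y: "y \<in> carrier Q" for y
  proof -
    have gy: "g y \<in> carrier P" by (rule mhomD(1) [OF g y])
    have "f (finsum P (\<lambda>i. \<phi> i (g y) \<odot>\<^bsub>P\<^esub> p i) I) = finsum Q (\<lambda>i. \<phi> i (g y) \<odot>\<^bsub>Q\<^esub> f (p i)) I"
      using D gy by (intro mhom_dual_expansion [OF assms(2,3) f]) auto
    then show ?thesis
      using mcong_hom [OF assms(1,2,3) f D(5) [OF gy]] fg [OF y] by simp
  qed
  then have "dual_basis_mod R J Q I (\<lambda>i. f (p i)) (\<lambda>i y. \<phi> i (g y))"
    using D by (auto simp: dual_basis_mod_def mhomD(1) [OF f] intro: mhom_comp [OF g])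
  moreover have "\<forall>i\<in>I. \<forall>j\<in>I. cong_mod R J (\<phi> i (g (f (p j)))) (E i j)" using E D gf by simp
  ultimately show ?thesis unfolding gram_mod_def by blast
qed

lemma dual_basis_eval:
  assumes "ideal J R" "right_module R P" "dual_basis_mod R J P I p \<phi>"
    and "\<alpha> \<in> mhom R P (regular_module R)" "x \<in> carrier P"
  shows "cong_mod R J (finsum R (\<lambda>k. \<alpha> (p k) \<otimes>\<^bsub>R\<^esub> \<phi> k x) I) (\<alpha> x)"
proof -
  note reg = regular_right_module [OF right_module_ring [OF assms(2)]]
  note D = dual_basis_modD [OF assms(3)]
  have "\<alpha> (finsum P (\<lambda>k. \<phi> k x \<odot>\<^bsub>P\<^esub> p k) I) = finsum R (\<lambda>k. \<alpha> (p k) \<otimes>\<^bsub>R\<^esub> \<phi> k x) I"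
    using mhom_dual_expansion [OF assms(2) reg assms(4) D(1), of p "\<lambda>k. \<phi> k x"] D(2,4) assms(5)
    by (simp add: finsum_regular)
  then show ?thesis
    using mcong_hom [OF assms(1,2) reg assms(4) D(5) [OF assms(5)]]
    by (simp add: mcong_regular_iff [OF assms(1)])
qed

lemma gram_mod_idempotent:
  assumes "ideal J R" "right_module R P" "gram_mod R J P I E" "i \<in> I" "j \<in> I"
  shows "cong_mod R J (mat_mul R I E E i j) (E i j)"
proof -
  obtain p \<phi> where b: "dual_basis_mod R J P I p \<phi>"
    and E: "\<And>i j. i \<in> I \<Longrightarrow> j \<in> I \<Longrightarrow> cong_mod R J (\<phi> i (p j)) (E i j)"
    using assms(3) by (auto simp: gram_mod_def)
  note D = dual_basis_modD [OF b] and tr = cong_mod_trans [OF assms(1)] and sym = cong_mod_sym [OF assms(1)]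
  have "cong_mod R J (mat_mul R I E E i j) (mat_mul R I (\<lambda>i j. \<phi> i (p j)) (\<lambda>i j. \<phi> i (p j)) i j)"
    using assms(4,5) D(1) by (intro cong_mod_mat_mul [OF assms(1)] sym [OF E]) auto
  moreover have "cong_mod R J (mat_mul R I (\<lambda>i j. \<phi> i (p j)) (\<lambda>i j. \<phi> i (p j)) i j) (\<phi> i (p j))"
    unfolding mat_mul_def
    by (rule dual_basis_eval [OF assms(1,2) b D(3) [OF assms(4)] D(2) [OF assms(5)]])
  ultimately show ?thesis by (rule tr [OF _ tr [OF _ E [OF assms(4,5)]]])
qed

text \<open>
  Sending each \<open>p\<^sub>i\<close> to \<open>q\<^sub>i\<close> and back is the identity modulo \<open>J\<close>, since only the Gram matrix enters
  when the functionals of one dual basis are evaluated on the other.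
\<close>

lemma same_gram_mod_maps:
  assumes "ideal J R" "right_module R P" "right_module R Q"
    and "dual_basis_mod R J P I p \<phi>" "dual_basis_mod R J Q I q \<psi>"
    and "\<And>i j. i \<in> I \<Longrightarrow> j \<in> I \<Longrightarrow> cong_mod R J (\<psi> i (q j)) (\<phi> i (p j))"
  shows "(\<lambda>x. finsum Q (\<lambda>i. \<phi> i x \<odot>\<^bsub>Q\<^esub> q i) I) \<in> mhom R P Q"
    and "x \<in> carrier P \<Longrightarrow> mcong P J
      (finsum P (\<lambda>j. \<psi> j (finsum Q (\<lambda>i. \<phi> i x \<odot>\<^bsub>Q\<^esub> q i) I) \<odot>\<^bsub>P\<^esub> p j) I) x"
proof -
  interpret P: ideal_module R P J by (intro ideal_moduleI assms)
  interpret Q: ideal_module R Q J by (intro ideal_moduleI assms)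
  note reg = regular_right_module [OF P.R.ring_axioms]
  note D = dual_basis_modD [OF assms(4)] and D' = dual_basis_modD [OF assms(5)]
  show "(\<lambda>x. finsum Q (\<lambda>i. \<phi> i x \<odot>\<^bsub>Q\<^esub> q i) I) \<in> mhom R P Q"
    by (intro mhom_finsum_fun assms D(1) mhom_smult_right D(3) D'(2))
  assume x: "x \<in> carrier P"
  let ?fx = "finsum Q (\<lambda>i. \<phi> i x \<odot>\<^bsub>Q\<^esub> q i) I" and ?ax = "finsum P (\<lambda>i. \<phi> i x \<odot>\<^bsub>P\<^esub> p i) I"
  have ax: "?ax \<in> carrier P" using D x by (intro P.M.finsum_closed) (auto intro: P.smult_closed)
  have "mcong P J (\<psi> j ?fx \<odot>\<^bsub>P\<^esub> p j) (\<phi> j ?ax \<odot>\<^bsub>P\<^esub> p j)" if j: "j \<in> I" for j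
  proof -
    have "\<psi> j ?fx = finsum R (\<lambda>i. \<psi> j (q i) \<otimes>\<^bsub>R\<^esub> \<phi> i x) I"
      using mhom_dual_expansion [OF assms(3) reg D'(3) [OF j] D(1), of q "\<lambda>i. \<phi> i x"] D'(2) D(4) x
      by (simp add: finsum_regular)
    moreover have "\<phi> j ?ax = finsum R (\<lambda>i. \<phi> j (p i) \<otimes>\<^bsub>R\<^esub> \<phi> i x) I"
      using mhom_dual_expansion [OF assms(2) reg D(3) [OF j] D(1), of p "\<lambda>i. \<phi> i x"] D(2,4) x
      by (simp add: finsum_regular)
    moreover have "cong_mod R J (finsum R (\<lambda>i. \<psi> j (q i) \<otimes>\<^bsub>R\<^esub> \<phi> i x) I) (finsum R (\<lambda>i. \<phi> j (p i) \<otimes>\<^bsub>R\<^esub> \<phi> i x) I)"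
      using j x D by (intro cong_mod_finsum [OF assms(1)] cong_mod_mult [OF assms(1)] assms(6)
          cong_mod_refl [OF assms(1)]) auto
    ultimately have "cong_mod R J (\<psi> j ?fx) (\<phi> j ?ax)" by simp
    then show ?thesis using D(2) [OF j] by (intro P.mcong_smult_coeff) (auto simp: cong_mod_def)
  qed
  then have "mcong P J (finsum P (\<lambda>j. \<psi> j ?fx \<odot>\<^bsub>P\<^esub> p j) I) (finsum P (\<lambda>j. \<phi> j ?ax \<odot>\<^bsub>P\<^esub> p j) I)"
    by (rule P.mcong_finsum [OF D(1)])
  also have "mcong P J (finsum P (\<lambda>j. \<phi> j ?ax \<odot>\<^bsub>P\<^esub> p j) I) ?ax" by (rule D(5) [OF ax])
  also have "mcong P J ?ax x" by (rule D(5) [OF x])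
  finally show "mcong P J (finsum P (\<lambda>j. \<psi> j ?fx \<odot>\<^bsub>P\<^esub> p j) I) x" .
qed

definition represents :: "('a, 'r) ring_scheme \<Rightarrow> 'a set \<Rightarrow> nat set \<Rightarrow> (nat \<Rightarrow> nat \<Rightarrow> 'a) \<Rightarrow>
    ('a, 'm, 'k) module_scheme \<Rightarrow> bool" where
  "represents R J I E P \<longleftrightarrow> absorbs R J P \<and> gram_mod R J P I E"

theorem represents_unique:
  assumes "represents R J I E P" "represents R J I E Q"
  shows "miso R P Q"
proof -
  have P: "absorbs R J P" and Q: "absorbs R J Q" using assms by (auto simp: represents_def)
  note J = absorbs_ideal [OF P]
  note PM = cgp_right_module [OF absorbs_cgp [OF P]] and QM = cgp_right_module [OF absorbs_cgp [OF Q]]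
  obtain p \<phi> where b: "dual_basis_mod R J P I p \<phi>"
    and E: "\<And>i j. i \<in> I \<Longrightarrow> j \<in> I \<Longrightarrow> cong_mod R J (\<phi> i (p j)) (E i j)"
    using assms(1) by (auto simp: gram_mod_def represents_def)
  obtain q \<psi> where b': "dual_basis_mod R J Q I q \<psi>"
    and E': "\<And>i j. i \<in> I \<Longrightarrow> j \<in> I \<Longrightarrow> cong_mod R J (\<psi> i (q j)) (E i j)"
    using assms(2) by (auto simp: gram_mod_def represents_def)
  have c: "cong_mod R J (\<psi> i (q j)) (\<phi> i (p j))" if "i \<in> I" "j \<in> I" for i j
    using E [OF that] E' [OF that] cong_mod_trans [OF J] cong_mod_sym [OF J] by blast
  then have c': "cong_mod R J (\<phi> i (p j)) (\<psi> i (q j))" if "i \<in> I" "j \<in> I" for i j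
    using that cong_mod_sym [OF J] by blast
  show ?thesis
    by (rule absorbs_unique [OF P Q same_gram_mod_maps(1) [OF J PM QM b b' c]
          same_gram_mod_maps(1) [OF J QM PM b' b c'] same_gram_mod_maps(2) [OF J PM QM b b' c]
          same_gram_mod_maps(2) [OF J QM PM b' b c']])
qed

text \<open>
  If \<open>T\<^sup>(\<^sup>\<omega>\<^sup>)\<close> is a direct summand of \<open>P\<close>, the finitely many \<open>p\<^sub>i\<close> have finite support in \<open>T\<^sup>(\<^sup>\<omega>\<^sup>)\<close>.  A
  coordinate outside of these supports gives a surjection \<open>P \<rightarrow> T\<close> that kills all \<open>p\<^sub>i\<close>, and \<open>P\<close> is
  generated by the \<open>p\<^sub>i\<close> and \<open>PJ\<close>.  Hence \<open>T = TJ\<close>, and the trace of \<open>T\<close> lies in \<open>J\<close>.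
\<close>

lemma absorbed_ideal_subset:
  assumes "absorbs R J P" "absorbs R K P" "dual_basis_mod R J P I p \<phi>"
  shows "K \<subseteq> J"
proof -
  obtain T :: "'a cmod" where T: "cgp R T" and tr: "trace_ideal R T = K"
    and iso: "miso R (dsum P (omega_power T)) P"
    using assms(2) by (auto simp: absorbs_def)
  let ?C = "omega_power T"
  note TM = cgp_right_module [OF T] and J = absorbs_ideal [OF assms(1)]
  note C = copower_right_module [OF TM, of "UNIV :: nat set"]
  note P = cgp_right_module [OF absorbs_cgp [OF assms(1)]]
  note D = dual_basis_modD [OF assms(3)]
  interpret T: ideal_module R T J by (intro ideal_moduleI TM J)
  interpret P: ideal_module R P J by (intro ideal_moduleI P J)
  obtain f g where f: "f \<in> mhom R (dsum P ?C) P" and g: "g \<in> mhom R P (dsum P ?C)"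
    and gf: "\<And>z. z \<in> carrier (dsum P ?C) \<Longrightarrow> g (f z) = z"
    using misoE [OF iso dsum_right_module [OF P C]] by metis
  let ?g = "\<lambda>x. snd (g x)"
  have snd_g: "?g \<in> mhom R P ?C" by (rule mhom_comp [OF g mhom_snd])
  have "finite (\<Union>i\<in>I. {n. ?g (p i) n \<noteq> \<zero>\<^bsub>T\<^esub>})"
    using D(1) mhomD(1) [OF snd_g D(2)] by (auto simp: copower_carrier)
  then obtain n where n: "n \<notin> (\<Union>i\<in>I. {n. ?g (p i) n \<noteq> \<zero>\<^bsub>T\<^esub>})"
    using ex_new_if_finite infinite_UNIV_nat by blast
  have gn: "(\<lambda>x. ?g x n) \<in> mhom R P T"
    by (rule mhom_comp [OF snd_g mhom_copower_nth]) simp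
  have "t \<in> module_ideal_prod T J" if t: "t \<in> carrier T" for t
  proof -
    let ?x = "f (\<zero>\<^bsub>P\<^esub>, inj_at T UNIV n t)"
    have z: "(\<zero>\<^bsub>P\<^esub>, inj_at T UNIV n t) \<in> carrier (dsum P ?C)"
      using mhomD(1) [OF mhom_inj_at [OF TM] t] by simp
    have x: "?x \<in> carrier P" by (rule mhomD(1) [OF f z])
    have gx: "?g ?x n = t" using gf [OF z] by (simp add: inj_at_def)
    have "?g (finsum P (\<lambda>i. \<phi> i ?x \<odot>\<^bsub>P\<^esub> p i) I) n = finsum T (\<lambda>i. \<phi> i ?x \<odot>\<^bsub>T\<^esub> ?g (p i) n) I"
      using D x by (intro mhom_dual_expansion [OF P TM gn]) auto
    also have "\<dots> = finsum T (\<lambda>i. \<zero>\<^bsub>T\<^esub>) I"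
      using n D(4) [OF _ x] by (intro T.M.finsum_cong') (auto simp: T.smult_zero_right)
    also have "\<dots> = \<zero>\<^bsub>T\<^esub>" by simp
    finally have "mcong T J \<zero>\<^bsub>T\<^esub> t" using mcong_hom [OF J P TM gn D(5) [OF x]] gx by simp
    then show ?thesis using T.mcong_sym T.mcong_zero_iff by blast
  qed
  then show ?thesis using trace_ideal_subset [OF J TM] tr by auto
qed

section \<open>Change of basis\<close>

lemma ideal_opp:
  assumes "ideal J R" shows "ideal J (opp R)"
proof -
  interpret ideal J R by fact
  show ?thesis
    using a_subgroup by (intro idealI ring_opp ring_axioms) (auto simp: I_l_closed I_r_closed)
qed

text \<open>
  Idempotents \<open>G\<close> and \<open>H\<close> with \<open>G \<equiv> YX\<close> and \<open>H \<equiv> XY\<close> have isomorphic images.  The new dual basis is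
  obtained by applying \<open>Y\<close> to the elements and \<open>X\<close> to the functionals; its Gram matrix is
  \<open>XGY \<equiv> XYXY \<equiv> HH \<equiv> H\<close>.
\<close>

lemma gram_mod_change:
  assumes J: "ideal J R" and Q: "right_module R Q" and "gram_mod R J Q I G" and K: "finite K"
    and X: "\<And>k i. k \<in> K \<Longrightarrow> i \<in> I \<Longrightarrow> X k i \<in> carrier R" and Y: "\<And>k i. k \<in> K \<Longrightarrow> i \<in> I \<Longrightarrow> Y i k \<in> carrier R"
    and XY: "\<And>k l. k \<in> K \<Longrightarrow> l \<in> K \<Longrightarrow> cong_mod R J (mat_mul R I X Y k l) (H k l)"
    and YX: "\<And>i j. i \<in> I \<Longrightarrow> j \<in> I \<Longrightarrow> cong_mod R J (mat_mul R K Y X i j) (G i j)"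
    and HH: "\<And>k l. k \<in> K \<Longrightarrow> l \<in> K \<Longrightarrow> cong_mod R J (mat_mul R K H H k l) (H k l)"
  shows "gram_mod R J Q K H"
proof -
  interpret Q: ideal_module R Q J by (intro ideal_moduleI assms)
  note R = Q.R.ring_axioms
  note reg = regular_right_module [OF R]
  note refl = cong_mod_refl [OF J] and sym = cong_mod_sym [OF J] and trans = cong_mod_trans [OF J]
  note mul = cong_mod_mat_mul [OF J]
  obtain q \<psi> where b: "dual_basis_mod R J Q I q \<psi>"
    and G: "\<And>i j. i \<in> I \<Longrightarrow> j \<in> I \<Longrightarrow> cong_mod R J (\<psi> i (q j)) (G i j)"
    using assms(3) by (auto simp: gram_mod_def)
  note D = dual_basis_modD [OF b]
  let ?G = "\<lambda>i j. \<psi> i (q j)" and ?\<Psi> = "\<lambda>i y. \<psi> i y"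
  define c where "c k = finsum Q (\<lambda>i. Y i k \<odot>\<^bsub>Q\<^esub> q i) I" for k
  define d where "d k y = mat_mul R I X ?\<Psi> k y" for k y
  have Gc: "?G i j \<in> carrier R" if "i \<in> I" "j \<in> I" for i j using D(2,4) that by simp
  have c: "c k \<in> carrier Q" if "k \<in> K" for k
    unfolding c_def using that D Y by (intro Q.M.finsum_closed) (auto intro: Q.smult_closed)
  have "(\<lambda>y. finsum (regular_module R) (\<lambda>i. X k i \<otimes>\<^bsub>R\<^esub> \<psi> i y) I) \<in> mhom R Q (regular_module R)"
    if "k \<in> K" for k
    using D(3) X that by (intro mhom_finsum_fun Q reg D(1) mhom_smult_left R) auto
  then have d: "d k \<in> mhom R Q (regular_module R)" if "k \<in> K" for k
    using that unfolding d_def [abs_def] mat_mul_def by (simp add: finsum_regular)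
  have XYc: "mat_mul R I X Y k l \<in> carrier R" if "k \<in> K" "l \<in> K" for k l
    using XY [OF that] by (rule cong_modD)
  have "cong_mod R J (d k (c l)) (H k l)" if k: "k \<in> K" and l: "l \<in> K" for k l
  proof -
    have "\<psi> i (c l) = mat_mul R I ?G Y i l" if "i \<in> I" for i
      using mhom_dual_expansion [OF Q reg D(3) [OF that] D(1), of q "\<lambda>i. Y i l"] D(2) Y l
      by (simp add: c_def mat_mul_def finsum_regular)
    moreover have "cong_mod R J (mat_mul R I ?G Y i l) (mat_mul R I (mat_mul R K Y X) Y i l)" if "i \<in> I" for i
      using that l by (intro mul [OF D(1)] refl Y trans [OF G sym [OF YX]])
    ultimately have "cong_mod R J (mat_mul R I X (\<lambda>i l. \<psi> i (c l)) k l) (mat_mul R I X (mat_mul R I (mat_mul R K Y X) Y) k l)"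
      using k by (intro mul [OF D(1)] refl X) simp_all
    moreover have "d k (c l) = mat_mul R I X (\<lambda>i l. \<psi> i (c l)) k l"
      by (simp add: d_def mat_mul_def)
    ultimately have "cong_mod R J (d k (c l)) (mat_mul R I X (mat_mul R I (mat_mul R K Y X) Y) k l)"
      by simp
    also have "mat_mul R I X (mat_mul R I (mat_mul R K Y X) Y) k l =
        mat_mul R I X (mat_mul R K Y (mat_mul R I X Y)) k l"
      using k l X Y unfolding mat_mul_def [of R I X _ k]
      by (intro Q.R.finsum_cong') (auto simp: mat_mul_assoc [OF R K D(1)]
          intro!: Q.R.m_closed cong_modD(2) [OF mul [OF K]] refl XYc)
    also have "\<dots> = mat_mul R K (mat_mul R I X Y) (mat_mul R I X Y) k l"
      using k l X Y XYc by (intro mat_mul_assoc [symmetric] R D(1) K) auto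
    finally have "cong_mod R J (d k (c l)) \<dots>" .
    moreover have "cong_mod R J (mat_mul R K (mat_mul R I X Y) (mat_mul R I X Y) k l) (mat_mul R K H H k l)"
      using k l by (intro mul K XY)
    ultimately show ?thesis using HH [OF k l] trans by blast
  qed
  moreover have "mcong Q J (finsum Q (\<lambda>k. d k y \<odot>\<^bsub>Q\<^esub> c k) K) y" if y: "y \<in> carrier Q" for y
  proof -
    have "finsum Q (\<lambda>k. d k y \<odot>\<^bsub>Q\<^esub> c k) K = finsum Q (\<lambda>i. mat_mul R K Y d i y \<odot>\<^bsub>Q\<^esub> q i) I"
      unfolding c_def using D(2) Y mhomD(1) [OF d y]
      by (intro Q.finsum_mat_mul D(1) K) auto
    moreover have "mcong Q J (finsum Q (\<lambda>i. mat_mul R K Y d i y \<odot>\<^bsub>Q\<^esub> q i) I) (finsum Q (\<lambda>i. \<psi> i y \<odot>\<^bsub>Q\<^esub> q i) I)"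
    proof (rule Q.mcong_finsum [OF D(1)])
      fix i assume i: "i \<in> I"
      have "mat_mul R K Y d i y = mat_mul R I (mat_mul R K Y X) ?\<Psi> i y"
        unfolding d_def [abs_def] using i Y X D(4) y
        by (intro mat_mul_assoc [symmetric] R K D(1)) auto
      moreover have "cong_mod R J \<dots> (mat_mul R I ?G ?\<Psi> i y)"
        using i D(4) y by (intro mul D(1) refl trans [OF YX sym [OF G]])
      moreover have "cong_mod R J (mat_mul R I ?G ?\<Psi> i y) (\<psi> i y)"
        unfolding mat_mul_def by (rule dual_basis_eval [OF J Q b D(3) [OF i] y])
      ultimately have "cong_mod R J (mat_mul R K Y d i y) (\<psi> i y)" using trans by metis
      then show "mcong Q J (mat_mul R K Y d i y \<odot>\<^bsub>Q\<^esub> q i) (\<psi> i y \<odot>\<^bsub>Q\<^esub> q i)"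
        using D(2) [OF i] by (intro Q.mcong_smult_coeff) (auto simp: cong_mod_def)
    qed
    ultimately show ?thesis using Q.mcong_trans D(5) [OF y] by simp
  qed
  ultimately show ?thesis
    unfolding gram_mod_def dual_basis_mod_def using K c d by blast
qed

text \<open>
  The matrices of mixed values of two dual bases of \<open>P\<close> exhibit the equivalence of \<open>E\<close> and \<open>F\<close>.
  Multiplication of transposed matrices in the opposite ring is multiplication in \<open>R\<close> in the other
  order, so the transposed matrices exhibit the equivalence of the transposes of \<open>E\<close> and \<open>F\<close>.
\<close>

theorem gram_mod_transfer:
  assumes J: "ideal J R" and P: "right_module R P" and Q: "right_module (opp R) Q"
    and E: "gram_mod R J P I E" and F: "gram_mod R J P K F"
    and Et: "gram_mod (opp R) J Q I (\<lambda>i j. E j i)"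
  shows "gram_mod (opp R) J Q K (\<lambda>k l. F l k)"
proof -
  note refl = cong_mod_refl [OF J] and sym = cong_mod_sym [OF J] and trans = cong_mod_trans [OF J]
  obtain p \<phi> where b: "dual_basis_mod R J P I p \<phi>"
    and Eq: "\<And>i j. i \<in> I \<Longrightarrow> j \<in> I \<Longrightarrow> cong_mod R J (\<phi> i (p j)) (E i j)"
    using E by (auto simp: gram_mod_def)
  obtain r \<chi> where b': "dual_basis_mod R J P K r \<chi>"
    and Fq: "\<And>i j. i \<in> K \<Longrightarrow> j \<in> K \<Longrightarrow> cong_mod R J (\<chi> i (r j)) (F i j)"
    using F by (auto simp: gram_mod_def)
  note D = dual_basis_modD [OF b] and D' = dual_basis_modD [OF b']
  show ?thesis
  proof (rule gram_mod_change [OF ideal_opp [OF J] Q Et D'(1),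
        where X = "\<lambda>k i. \<phi> i (r k)" and Y = "\<lambda>i k. \<chi> k (p i)"])
    fix k l assume k: "k \<in> K" and l: "l \<in> K"
    have "cong_mod R J (mat_mul R I (\<lambda>l i. \<chi> l (p i)) (\<lambda>i k. \<phi> i (r k)) l k) (\<chi> l (r k))"
      unfolding mat_mul_def by (rule dual_basis_eval [OF J P b D'(3) [OF l] D'(2) [OF k]])
    from trans [OF this Fq [OF l k]]
    show "cong_mod (opp R) J (mat_mul (opp R) I (\<lambda>k i. \<phi> i (r k)) (\<lambda>i k. \<chi> k (p i)) k l) (F l k)"
      by (simp add: mat_mul_opp)
    show "cong_mod (opp R) J (mat_mul (opp R) K (\<lambda>k l. F l k) (\<lambda>k l. F l k) k l) (F l k)"
      using gram_mod_idempotent [OF J P F l k] by (simp add: mat_mul_opp)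
  next
    fix i j assume i: "i \<in> I" and j: "j \<in> I"
    have "cong_mod R J (mat_mul R K (\<lambda>j k. \<phi> j (r k)) (\<lambda>k i. \<chi> k (p i)) j i) (\<phi> j (p i))"
      unfolding mat_mul_def by (rule dual_basis_eval [OF J P b' D(3) [OF j] D(2) [OF i]])
    from trans [OF this Eq [OF j i]]
    show "cong_mod (opp R) J (mat_mul (opp R) K (\<lambda>i k. \<chi> k (p i)) (\<lambda>k i. \<phi> i (r k)) i j) (E j i)"
      by (simp add: mat_mul_opp)
  qed (use D D' in auto)
qed

section \<open>Direct sums\<close>

lemma mip_mono:
  assumes "J \<subseteq> L" "ideal J R" "ideal L R" "right_module R M"
  shows "module_ideal_prod M J \<subseteq> module_ideal_prod M L"
proof -
  interpret J: ideal_module R M J by (intro ideal_moduleI assms)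
  interpret L: ideal_module R M L by (intro ideal_moduleI assms)
  show ?thesis using assms(1) by (intro J.mip_least L.mip_submodule L.mip_memI) auto
qed

lemma gram_mod_mono:
  assumes "J \<subseteq> L" "ideal J R" "ideal L R" "right_module R M" "gram_mod R J M I E"
  shows "gram_mod R L M I E"
proof -
  have "mcong M J x y \<Longrightarrow> mcong M L x y" and "cong_mod R J a b \<Longrightarrow> cong_mod R L a b" for x y a b
    using assms(1) mip_mono [OF assms(1-4)] by (auto simp: mcong_def cong_mod_def)
  then show ?thesis using assms(5) unfolding gram_mod_def dual_basis_mod_def by blast
qed

lemma gram_mod_reindex:
  assumes "right_module R M" "gram_mod R J M I E" "\<And>i. \<tau> (\<sigma> i) = i"
  shows "gram_mod R J M (\<sigma> ` I) (\<lambda>i j. E (\<tau> i) (\<tau> j))"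
proof -
  interpret M: right_module R M by fact
  obtain p \<phi> where b: "dual_basis_mod R J M I p \<phi>"
    and E: "\<forall>i\<in>I. \<forall>j\<in>I. cong_mod R J (\<phi> i (p j)) (E i j)"
    using assms(2) by (auto simp: gram_mod_def)
  note D = dual_basis_modD [OF b]
  note inv = assms(3)
  have inj: "inj_on \<sigma> I" by (metis inv inj_onI)
  have "finsum M (\<lambda>i. \<phi> (\<tau> i) x \<odot>\<^bsub>M\<^esub> p (\<tau> i)) (\<sigma> ` I) = finsum M (\<lambda>i. \<phi> i x \<odot>\<^bsub>M\<^esub> p i) I"
    if "x \<in> carrier M" for x
    using that D by (subst M.finsum_reindex [OF _ inj]) (auto simp: inv intro: M.smult_closed)
  then have "dual_basis_mod R J M (\<sigma> ` I) (\<lambda>i. p (\<tau> i)) (\<lambda>i. \<phi> (\<tau> i))"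
    using D by (auto simp: dual_basis_mod_def inv)
  then show ?thesis unfolding gram_mod_def using E by (intro exI conjI) (auto simp: inv)
qed

definition block :: "('a, 'r) ring_scheme \<Rightarrow> nat set \<Rightarrow> nat set \<Rightarrow> (nat \<Rightarrow> nat \<Rightarrow> 'a) \<Rightarrow> (nat \<Rightarrow> nat \<Rightarrow> 'a) \<Rightarrow> nat \<Rightarrow> nat \<Rightarrow> 'a" where
  "block R I K E F i j = (if i \<in> I \<and> j \<in> I then E i j else if i \<in> K \<and> j \<in> K then F i j else \<zero>\<^bsub>R\<^esub>)"

lemma gram_mod_dsum:
  assumes J: "ideal J R" and P: "right_module R P" and Q: "right_module R Q"
    and "gram_mod R J P I E" "gram_mod R J Q K F" and IK: "I \<inter> K = {}"
  shows "gram_mod R J (dsum P Q) (I \<union> K) (block R I K E F)"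
proof -
  interpret P: right_module R P by fact
  interpret Q: right_module R Q by fact
  note reg = regular_right_module [OF P.R.ring_axioms]
  note PQ = dsum_right_module [OF P Q]
  interpret PQ: right_module R "dsum P Q" by (rule PQ)
  obtain p \<phi> where b: "dual_basis_mod R J P I p \<phi>"
    and E: "\<And>i j. i \<in> I \<Longrightarrow> j \<in> I \<Longrightarrow> cong_mod R J (\<phi> i (p j)) (E i j)"
    using assms(4) by (auto simp: gram_mod_def)
  obtain q \<psi> where b': "dual_basis_mod R J Q K q \<psi>"
    and F: "\<And>i j. i \<in> K \<Longrightarrow> j \<in> K \<Longrightarrow> cong_mod R J (\<psi> i (q j)) (F i j)"
    using assms(5) by (auto simp: gram_mod_def)
  note D = dual_basis_modD [OF b] and D' = dual_basis_modD [OF b']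
  let ?r = "\<lambda>i. if i \<in> I then (p i, \<zero>\<^bsub>Q\<^esub>) else (\<zero>\<^bsub>P\<^esub>, q i)"
  let ?\<chi> = "\<lambda>i z. if i \<in> I then \<phi> i (fst z) else \<psi> i (snd z)"
  have r: "?r i \<in> carrier (dsum P Q)" if "i \<in> I \<union> K" for i using that D(2) D'(2) by auto
  have \<chi>: "?\<chi> i \<in> mhom R (dsum P Q) (regular_module R)" if "i \<in> I \<union> K" for i
    using that by (cases "i \<in> I") (auto intro: mhom_fst_comp [OF D(3)] mhom_snd_comp [OF D'(3)])
  have "mcong (dsum P Q) J (finsum (dsum P Q) (\<lambda>i. ?\<chi> i z \<odot>\<^bsub>dsum P Q\<^esub> ?r i) (I \<union> K)) z"
    if z: "z \<in> carrier (dsum P Q)" for z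
  proof -
    have x: "fst z \<in> carrier P" and y: "snd z \<in> carrier Q" using z by auto
    have t: "?\<chi> i z \<odot>\<^bsub>dsum P Q\<^esub> ?r i \<in> carrier (dsum P Q)" if "i \<in> I \<union> K" for i
      using r [OF that] mhomD(1) [OF \<chi> [OF that] z] by (intro PQ.smult_closed) auto
    have "finsum (dsum P Q) (\<lambda>i. ?\<chi> i z \<odot>\<^bsub>dsum P Q\<^esub> ?r i) (I \<union> K) =
        finsum (dsum P Q) (\<lambda>i. ?\<chi> i z \<odot>\<^bsub>dsum P Q\<^esub> ?r i) I \<oplus>\<^bsub>dsum P Q\<^esub>
        finsum (dsum P Q) (\<lambda>i. ?\<chi> i z \<odot>\<^bsub>dsum P Q\<^esub> ?r i) K"
      using t by (intro PQ.M.finsum_Un_disjoint D(1) D'(1) IK) auto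
    also have "finsum (dsum P Q) (\<lambda>i. ?\<chi> i z \<odot>\<^bsub>dsum P Q\<^esub> ?r i) I =
        finsum (dsum P Q) (\<lambda>i. \<phi> i (fst z) \<odot>\<^bsub>dsum P Q\<^esub> (p i, \<zero>\<^bsub>Q\<^esub>)) I"
      using D(2,4) x by (intro PQ.M.finsum_cong') (auto simp: Q.smult_zero_right P.smult_closed)
    also have "\<dots> = (finsum P (\<lambda>i. \<phi> i (fst z) \<odot>\<^bsub>P\<^esub> p i) I, \<zero>\<^bsub>Q\<^esub>)"
      using D(2,4) x by (intro mhom_dual_expansion [OF P PQ mhom_inl [OF Q] D(1), symmetric]) auto
    also have "finsum (dsum P Q) (\<lambda>i. ?\<chi> i z \<odot>\<^bsub>dsum P Q\<^esub> ?r i) K =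
        finsum (dsum P Q) (\<lambda>i. \<psi> i (snd z) \<odot>\<^bsub>dsum P Q\<^esub> (\<zero>\<^bsub>P\<^esub>, q i)) K"
      using D'(2,4) y IK by (intro PQ.M.finsum_cong') (auto simp: P.smult_zero_right Q.smult_closed)
    also have "\<dots> = (\<zero>\<^bsub>P\<^esub>, finsum Q (\<lambda>i. \<psi> i (snd z) \<odot>\<^bsub>Q\<^esub> q i) K)"
      using D'(2,4) y by (intro mhom_dual_expansion [OF Q PQ mhom_inr [OF P] D'(1), symmetric]) auto
    finally have "finsum (dsum P Q) (\<lambda>i. ?\<chi> i z \<odot>\<^bsub>dsum P Q\<^esub> ?r i) (I \<union> K) =
        (finsum P (\<lambda>i. \<phi> i (fst z) \<odot>\<^bsub>P\<^esub> p i) I, finsum Q (\<lambda>i. \<psi> i (snd z) \<odot>\<^bsub>Q\<^esub> q i) K)"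
      using D(5) [OF x] D'(5) [OF y] by (simp add: mcong_def)
    then show ?thesis using mcong_dsumI [OF J P Q D(5) [OF x] D'(5) [OF y]] by simp
  qed
  then have "dual_basis_mod R J (dsum P Q) (I \<union> K) ?r ?\<chi>"
    unfolding dual_basis_mod_def using r \<chi> D(1) D'(1) by blast
  moreover have "cong_mod R J (?\<chi> i (?r j)) (block R I K E F i j)" if "i \<in> I \<union> K" "j \<in> I \<union> K" for i j
    using that IK E F mhom_zero [OF P reg D(3)] mhom_zero [OF Q reg D'(3)] cong_mod_refl [OF J P.R.zero_closed]
    by (auto simp: block_def)
  ultimately show ?thesis unfolding gram_mod_def by blast
qed

lemma trace_ideal_retract:
  assumes "ring R" "retract R M N"
  shows "trace_ideal R M \<subseteq> trace_ideal R N"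
proof (rule trace_ideal_least [OF assms(1) trace_ideal_subgroup [OF assms(1)]])
  obtain s g where s: "s \<in> mhom R M N" and g: "g \<in> mhom R N M" and id: "\<And>x. x \<in> carrier M \<Longrightarrow> g (s x) = x"
    using assms(2) by (auto simp: retract_def)
  fix f x assume "f \<in> mhom R M (regular_module R)" "x \<in> carrier M"
  then show "f x \<in> trace_ideal R N"
    using trace_ideal_memI [OF mhom_comp [OF g] mhomD(1) [OF s], of f x] id by simp
qed

text \<open>
  The sum of the two trace ideals, written as a generated subgroup because this expression is the same
  for a ring and its opposite.
\<close>

lemma trace_ideal_dsum:
  assumes "right_module R M" "right_module R N"
  shows "trace_ideal R (dsum M N) = generate (add_monoid R) (trace_ideal R M \<union> trace_ideal R N)"
proof
  interpret M: right_module R M by fact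
  interpret N: right_module R N by fact
  note R = M.R.ring_axioms
  let ?U = "trace_ideal R M \<union> trace_ideal R N"
  have U: "?U \<subseteq> carrier (add_monoid R)"
    using subgroup.subset [OF trace_ideal_subgroup [OF R, of M]]
      subgroup.subset [OF trace_ideal_subgroup [OF R, of N]] by simp
  note sub = group.generate_is_subgroup [OF M.R.a_group U]
  show "trace_ideal R (dsum M N) \<subseteq> generate (add_monoid R) ?U"
  proof (rule trace_ideal_least [OF R sub])
    fix f z assume f: "f \<in> mhom R (dsum M N) (regular_module R)" and z: "z \<in> carrier (dsum M N)"
    have "f z = f ((fst z, \<zero>\<^bsub>N\<^esub>) \<oplus>\<^bsub>dsum M N\<^esub> (\<zero>\<^bsub>M\<^esub>, snd z))" using z by auto
    also have "\<dots> = f (fst z, \<zero>\<^bsub>N\<^esub>) \<oplus>\<^bsub>R\<^esub> f (\<zero>\<^bsub>M\<^esub>, snd z)"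
      using mhomD(2) [OF f, of "(fst z, \<zero>\<^bsub>N\<^esub>)" "(\<zero>\<^bsub>M\<^esub>, snd z)"] z by auto
    finally have eq: "f z = f (fst z, \<zero>\<^bsub>N\<^esub>) \<oplus>\<^bsub>R\<^esub> f (\<zero>\<^bsub>M\<^esub>, snd z)" .
    have "f (fst z, \<zero>\<^bsub>N\<^esub>) \<in> generate (add_monoid R) ?U"
      using trace_ideal_memI [OF mhom_comp [OF mhom_inl [OF assms(2)] f], of "fst z"] z
      by (intro generate.incl) auto
    moreover have "f (\<zero>\<^bsub>M\<^esub>, snd z) \<in> generate (add_monoid R) ?U"
      using trace_ideal_memI [OF mhom_comp [OF mhom_inr [OF assms(1)] f], of "snd z"] z
      by (intro generate.incl) auto
    ultimately show "f z \<in> generate (add_monoid R) ?U"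
      using subgroup.m_closed [OF sub] by (simp add: eq)
  qed
  have *: "retract R M (dsum M N)" "retract R N (dsum M N)"
    by (auto intro!: retractI [OF mhom_inl mhom_fst] retractI [OF mhom_inr mhom_snd] assms)
  then have "?U \<subseteq> trace_ideal R (dsum M N)" using trace_ideal_retract [OF R *(1)] trace_ideal_retract [OF R *(2)] by simp
  then show "generate (add_monoid R) ?U \<subseteq> trace_ideal R (dsum M N)"
    by (intro group.generate_subgroup_incl [OF M.R.a_group] trace_ideal_subgroup R)
qed

text \<open>
  The witness is the direct sum of the two witnesses, moved to the carrier type that the definition
  asks for.
\<close>

lemma absorbs_dsum:
  assumes "absorbs R J P" "absorbs R K Q"
  shows "absorbs R (generate (add_monoid R) (J \<union> K)) (dsum P Q)"
proof -
  obtain T :: "'a cmod" where T: "cgp R T" and J: "trace_ideal R T = J"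
    and isoT: "miso R (dsum P (omega_power T)) P"
    using assms(1) by (auto simp: absorbs_def)
  obtain S :: "'a cmod" where S: "cgp R S" and K: "trace_ideal R S = K"
    and isoS: "miso R (dsum Q (omega_power S)) Q"
    using assms(2) by (auto simp: absorbs_def)
  let ?N = "UNIV :: nat set"
  note P = cgp_right_module [OF absorbs_cgp [OF assms(1)]] and Q = cgp_right_module [OF absorbs_cgp [OF assms(2)]]
  note TM = cgp_right_module [OF T] and SM = cgp_right_module [OF S]
  note R = right_module_ring [OF TM] and TS = dsum_right_module [OF TM SM]
  obtain U :: "'a cmod" where U: "cgp R U" and iso: "miso R (dsum T S) U"
    using cg_projective_representative [of R "dsum T S"] cgp_dsum [OF T S]
    by (auto simp: cg_projective_iff_cgp)
  note UM = cgp_right_module [OF U]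
  note cp = copower_right_module [of R _ ?N]
  have iso': "miso R U (dsum T S)" by (rule miso_sym [OF iso TS])
  have "trace_ideal R U = trace_ideal R (dsum T S)"
    by (intro equalityI trace_ideal_retract R miso_imp_retract iso iso' UM TS)
  then have tr: "trace_ideal R U = generate (add_monoid R) (J \<union> K)"
    by (simp add: trace_ideal_dsum [OF TM SM] J K)
  note PQ = dsum_right_module [OF P Q]
  have "miso R (dsum (dsum P Q) (copower U ?N)) (dsum (dsum P Q) (copower (dsum T S) ?N))"
    by (intro dsum_cong PQ cp UM miso_refl copower_cong TS iso')
  also have "miso R \<dots> (dsum (dsum P Q) (dsum (copower T ?N) (copower S ?N)))"
    by (intro dsum_cong PQ cp TS miso_refl miso_sym [OF dsum_copower [OF TM SM]]
        dsum_right_module cp TM SM)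
  also have "miso R \<dots> (dsum (dsum P (copower T ?N)) (dsum Q (copower S ?N)))"
    by (rule dsum_interchange)
  also have "miso R \<dots> (dsum P Q)"
    by (intro dsum_cong dsum_right_module P Q cp TM SM isoT isoS)
  finally show ?thesis
    using U tr cgp_dsum [OF absorbs_cgp [OF assms(1)] absorbs_cgp [OF assms(2)]] by (auto simp: absorbs_def)
qed

section \<open>Existence\<close>

text \<open>
  The matrix \<open>E\<close>, extended by zero to all indices, is an endomorphism of the free module of countable
  rank that is idempotent modulo \<open>J\<close>.
\<close>

theorem represents_exists:
  fixes T :: "'a cmod"
  assumes T: "cgp R T" and I: "finite I"
    and E: "\<And>i j. i \<in> I \<Longrightarrow> j \<in> I \<Longrightarrow> cong_mod R (trace_ideal R T) (mat_mul R I E E i j) (E i j)"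
  shows "\<exists>P :: 'a cmod. represents R (trace_ideal R T) I E P"
proof -
  let ?J = "trace_ideal R T"
  note J = trace_ideal_ideal [OF cgp_right_module [OF T]]
  interpret J: ideal ?J R by (rule J)
  note R = J.ring_axioms
  note reg = regular_right_module [OF R] and F = free_right_module [OF R]
  interpret F: ideal_module R "free R" ?J by (intro ideal_moduleI F J)
  note refl = cong_mod_refl [OF J] and sym = cong_mod_sym [OF J] and trans = cong_mod_trans [OF J]
  have Ec: "E i j \<in> carrier R" if "i \<in> I" "j \<in> I" for i j using cong_modD(2) [OF E [OF that]] .
  define e where "e u = (\<lambda>i\<in>UNIV. if i \<in> I then finsum R (\<lambda>j. E i j \<otimes>\<^bsub>R\<^esub> u j) I else \<zero>\<^bsub>R\<^esub>)" for u :: "nat \<Rightarrow> 'a"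
  have nth: "(\<lambda>u. u j) \<in> mhom R (free R) (regular_module R)" for j :: nat
    by (rule mhom_copower_nth) simp
  have nthc: "u j \<in> carrier R" if "u \<in> carrier (free R)" for u and j :: nat
    using mhomD(1) [OF nth that] by simp
  have e: "e \<in> mhom R (free R) (free R)" unfolding e_def [abs_def]
  proof (rule mhom_copowerI)
    fix i :: nat
    have "(\<lambda>u. finsum (regular_module R) (\<lambda>j. E i j \<otimes>\<^bsub>R\<^esub> u j) I) \<in> mhom R (free R) (regular_module R)"
      if "i \<in> I"
      using that Ec by (intro mhom_finsum_fun F reg I mhom_smult_left R nth) auto
    then show "(\<lambda>u. if i \<in> I then finsum R (\<lambda>j. E i j \<otimes>\<^bsub>R\<^esub> u j) I else \<zero>\<^bsub>R\<^esub>) \<in> mhom R (free R) (regular_module R)"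
      using mhom_const_zero [OF reg, of "free R"] by (cases "i \<in> I") (auto simp: finsum_regular)
    show "finite {i \<in> UNIV. (if i \<in> I then finsum R (\<lambda>j. E i j \<otimes>\<^bsub>R\<^esub> u j) I else \<zero>\<^bsub>R\<^esub>) \<noteq> \<zero>\<^bsub>regular_module R\<^esub>}" for u
      by (rule finite_subset [OF _ I]) auto
  qed
  have ei: "e u i = mat_mul R I E (\<lambda>j _. u j) i ()" if "i \<in> I" for u i using that by (simp add: e_def mat_mul_def)
  have ec: "e u \<in> carrier (free R)" if "u \<in> carrier (free R)" for u by (rule mhomD(1) [OF e that])
  have ee: "mcong (free R) ?J (e (e u)) (e u)" if u: "u \<in> carrier (free R)" for u
  proof (rule mcong_copowerI [OF J reg ec [OF ec [OF u]] ec [OF u]])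
    fix i :: nat
    show "mcong (regular_module R) ?J (e (e u) i) (e u i)"
    proof (cases "i \<in> I")
      case True
      have "e (e u) i = mat_mul R I E (mat_mul R I E (\<lambda>j _. u j)) i ()"
        unfolding ei [OF True] unfolding mat_mul_def [of R I E _ i]
        using True Ec nthc [OF u] nthc [OF ec [OF u]]
        by (intro J.finsum_cong') (auto simp: ei simp flip: ei)
      also have "\<dots> = mat_mul R I (mat_mul R I E E) (\<lambda>j _. u j) i ()"
        using True Ec nthc [OF u] by (intro mat_mul_assoc [symmetric] R I) auto
      finally have eq: "e (e u) i = mat_mul R I (mat_mul R I E E) (\<lambda>j _. u j) i ()" .
      have "cong_mod R ?J (e (e u) i) (e u i)"
        by (subst eq, subst ei [OF True]) (intro cong_mod_mat_mul [OF J I] E refl True nthc [OF u])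
      then show ?thesis by (simp add: mcong_regular_iff [OF J])
    next
      case False
      then show ?thesis using refl J.zero_closed by (simp add: e_def mcong_regular_iff [OF J])
    qed
  qed
  then have idem: "\<forall>u\<in>carrier (free R). mcong (free R) ?J (e (e u)) (e u)" by blast
  from absorbs_exists [OF cgp_free [OF R] T e idem]
  obtain P :: "('a, ((nat \<Rightarrow> nat \<Rightarrow> 'a) \<times> (nat \<Rightarrow> nat \<Rightarrow> 'a)) \<times> (nat \<Rightarrow> nat \<Rightarrow> 'a)) module" and a b
    where P: "absorbs R ?J P" and a: "a \<in> mhom R (free R) P" and b: "b \<in> mhom R P (free R)"
      and ba': "\<forall>u\<in>carrier (free R). mcong (free R) ?J (b (a u)) (e u)"
      and ab': "\<forall>z\<in>carrier P. mcong P ?J (a (b z)) z"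
    by (elim exE conjE)
  note ba = bspec [OF ba'] and ab = bspec [OF ab']
  note PM = cgp_right_module [OF absorbs_cgp [OF P]]
  interpret P: ideal_module R P ?J by (intro ideal_moduleI PM J)
  note uv = unit_vec_closed [OF R]
  have "mcong P ?J (finsum P (\<lambda>i. b z i \<odot>\<^bsub>P\<^esub> a (unit_vec R i)) I) z" if z: "z \<in> carrier P" for z
  proof -
    have bz: "b z \<in> carrier (free R)" by (rule mhomD(1) [OF b z])
    define w where "w = finsum (free R) (\<lambda>i. b z i \<odot>\<^bsub>free R\<^esub> unit_vec R i) I"
    have w: "w \<in> carrier (free R)" unfolding w_def
      using nthc [OF bz] uv by (intro F.M.finsum_closed) (auto intro!: F.smult_closed simp del: copower_simps)
    have aw: "a w = finsum P (\<lambda>i. b z i \<odot>\<^bsub>P\<^esub> a (unit_vec R i)) I" unfolding w_def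
      using nthc [OF bz] uv by (intro mhom_dual_expansion [OF F PM a I])
    have "w j = b z j" if j: "j \<in> I" for j
    proof -
      have "w j = finsum R (\<lambda>i. unit_vec R i j \<otimes>\<^bsub>R\<^esub> b z i) I" unfolding w_def
        using mhom_dual_expansion [OF F reg nth I, of "unit_vec R" "b z"] nthc [OF bz] uv
        by (simp add: finsum_regular del: copower_simps)
      also have "\<dots> = finsum R (\<lambda>i. if j = i then b z i else \<zero>\<^bsub>R\<^esub>) I"
        using nthc [OF bz] by (intro J.finsum_cong') (auto simp: inj_at_def)
      also have "\<dots> = b z j" using nthc [OF bz] by (intro J.finsum_singleton j I) auto
      finally show ?thesis .
    qed
    then have ew: "e w = e (b z)" using nthc [OF bz] Ec
      by (auto simp: e_def fun_eq_iff intro!: J.finsum_cong')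
    \<comment> \<open>The truncation \<open>w\<close> of \<open>b z\<close> to \<open>I\<close> has the same image under \<open>e\<close>, and \<open>a e\<close> agrees with \<open>a\<close> modulo \<open>J\<close>.\<close>
    have "mcong P ?J (a w) (a (b (a w)))"
      by (rule P.mcong_sym [OF ab [OF mhomD(1) [OF a w]]])
    also have "mcong P ?J (a (b (a w))) (a (e w))" by (rule mcong_hom [OF J F PM a ba [OF w]])
    also have "mcong P ?J (a (e w)) (a (b (a (b z))))"
      unfolding ew by (rule mcong_hom [OF J F PM a F.mcong_sym [OF ba [OF bz]]])
    also have "mcong P ?J (a (b (a (b z)))) (a (b z))" by (rule ab [OF mhomD(1) [OF a bz]])
    also have "mcong P ?J (a (b z)) z" by (rule ab [OF z])
    finally show ?thesis unfolding aw .
  qed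
  then have "dual_basis_mod R ?J P I (\<lambda>i. a (unit_vec R i)) (\<lambda>i z. b z i)"
    unfolding dual_basis_mod_def using I mhomD(1) [OF a uv] mhom_comp [OF b nth] by blast
  moreover have "cong_mod R ?J (b (a (unit_vec R j)) i) (E i j)" if "i \<in> I" "j \<in> I" for i j
  proof -
    have "e (unit_vec R j) i = finsum R (\<lambda>k. if j = k then E i k else \<zero>\<^bsub>R\<^esub>) I"
      using that Ec by (auto simp: e_def inj_at_def intro!: J.finsum_cong')
    also have "\<dots> = E i j" using that Ec by (intro J.finsum_singleton I) auto
    finally show ?thesis
      using mcong_hom [OF J F reg nth ba [OF uv], of j i] by (simp add: mcong_regular_iff [OF J])
  qed
  ultimately have gram: "gram_mod R ?J P I E" unfolding gram_mod_def by blast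
  obtain Q :: "'a cmod" where Q: "cgp R Q" and iso: "miso R P Q"
    using cg_projective_representative [of R P] absorbs_cgp [OF P] by (auto simp: cg_projective_iff_cgp)
  note QM = cgp_right_module [OF Q]
  show ?thesis
    using absorbs_miso [OF P iso QM] gram_mod_miso [OF J PM QM iso gram] by (auto simp: represents_def)
qed

section \<open>Relatively big modules\<close>

text \<open>
  Finitely many generators of \<open>P\<close> modulo \<open>PJ\<close> involve only finitely many members of an infinite dual
  basis.  The expansion by these members is the identity on the generators and, up to elements of
  \<open>PJ\<close>, on \<open>PJ\<close>.
\<close>

lemma dual_basis_mod_exists:
  assumes P: "cgp R P" and J: "ideal J R" and S: "finite S" "S \<subseteq> carrier P"
    and gen: "\<And>H. submodule H R P \<Longrightarrow> S \<subseteq> H \<Longrightarrow> module_ideal_prod P J \<subseteq> H \<Longrightarrow> carrier P \<subseteq> H"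
  shows "\<exists>I p \<phi>. dual_basis_mod R J P I p \<phi>"
proof -
  note PM = cgp_right_module [OF P]
  interpret P: ideal_module R P J by (intro ideal_moduleI PM J)
  note R = P.R.ring_axioms
  note reg = regular_right_module [OF R] and F = free_right_module [OF R]
  obtain s g where s: "s \<in> mhom R P (free R)" and g: "g \<in> mhom R (free R) P"
    and id: "\<And>x. x \<in> carrier P \<Longrightarrow> g (s x) = x"
    using P by (auto simp: cgp_def retract_def)
  let ?p = "\<lambda>i. g (unit_vec R i)" and ?\<phi> = "\<lambda>i x. s x i"
  define I where "I = (\<Union>x\<in>S. {i. s x i \<noteq> \<zero>\<^bsub>R\<^esub>})"
  have I: "finite I" unfolding I_def using S mhomD(1) [OF s] by (auto simp: copower_carrier subset_iff)
  have p: "?p i \<in> carrier P" for i by (rule mhomD(1) [OF g unit_vec_closed [OF R]])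
  have \<phi>: "?\<phi> i \<in> mhom R P (regular_module R)" for i
    by (rule mhom_comp [OF s mhom_copower_nth]) simp
  let ?\<theta> = "\<lambda>x. finsum P (\<lambda>i. ?\<phi> i x \<odot>\<^bsub>P\<^esub> ?p i) I"
  have \<theta>: "?\<theta> \<in> mhom R P P" by (intro mhom_finsum_fun PM I mhom_smult_right p \<phi>)
  have hi: "(\<lambda>a. a \<odot>\<^bsub>P\<^esub> ?p i) \<in> mhom R (regular_module R) P" for i
    by (rule mhom_smult_right [OF PM p mhom_id])
  let ?h = "copair P (regular_module R) UNIV (\<lambda>i a. a \<odot>\<^bsub>P\<^esub> ?p i)"
  have gh: "g u = ?h u" if "u \<in> carrier (free R)" for u
    using p by (intro free_mhom_ext [OF PM g mhom_copair [OF reg PM hi] _ that])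
      (simp add: copair_inj_at [OF reg PM hi] P.smult_one)
  have \<theta>S: "?\<theta> x = x" if x: "x \<in> S" for x
  proof -
    have xP: "x \<in> carrier P" using x S by auto
    have sx: "s x \<in> carrier (free R)" by (rule mhomD(1) [OF s xP])
    have "?h (s x) = ?\<theta> x"
      using x by (intro copair_superset [OF reg PM hi sx I]) (auto simp: I_def)
    then show ?thesis using gh [OF sx] id [OF xP] by simp
  qed
  have "carrier P \<subseteq> {x \<in> carrier P. ?\<theta> x \<ominus>\<^bsub>P\<^esub> x \<in> module_ideal_prod P J}"
  proof (rule gen)
    show "submodule {x \<in> carrier P. ?\<theta> x \<ominus>\<^bsub>P\<^esub> x \<in> module_ideal_prod P J} R P"
      by (rule mhom_preimage_submodule [OF PM PM mhom_diff [OF PM PM \<theta> mhom_id] P.mip_submodule])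
    show "S \<subseteq> {x \<in> carrier P. ?\<theta> x \<ominus>\<^bsub>P\<^esub> x \<in> module_ideal_prod P J}"
    proof
      fix x assume "x \<in> S"
      then show "x \<in> {x \<in> carrier P. ?\<theta> x \<ominus>\<^bsub>P\<^esub> x \<in> module_ideal_prod P J}"
        using S(2) P.mcong_refl [of x] unfolding mem_Collect_eq \<theta>S [OF \<open>x \<in> S\<close>] by (auto simp: mcong_def)
    qed
    show "module_ideal_prod P J \<subseteq> {x \<in> carrier P. ?\<theta> x \<ominus>\<^bsub>P\<^esub> x \<in> module_ideal_prod P J}"
      using mip_hom [OF J PM PM \<theta>] P.mip(1,6) by auto
  qed
  then have "dual_basis_mod R J P I ?p ?\<phi>"
    unfolding dual_basis_mod_def mcong_def using I p \<phi> mhomD(1) [OF \<theta>] by blast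
  then show ?thesis by blast
qed

context right_module
begin

lemma submodule_abelian_subgroup: "submodule N R M \<Longrightarrow> abelian_subgroup N M"
  by (intro abelian_subgroupI3 additive_subgroupI submodule_subgroup M.abelian_group_axioms)

lemma quotient_simps:
  "zero (quotient_module M N) = N" "X \<oplus>\<^bsub>quotient_module M N\<^esub> Y = X <+>\<^bsub>M\<^esub> Y"
  by (simp_all add: quotient_module_def)

lemma quotient_carrier: "carrier (quotient_module M N) = (\<lambda>x. N +>\<^bsub>M\<^esub> x) ` carrier M"
  by (simp add: quotient_module_def A_RCOSETS_def' UNION_singleton_eq_range)

context
  fixes N assumes N: "submodule N R M"
begin

interpretation N: abelian_subgroup N M by (rule submodule_abelian_subgroup [OF N])

lemma coset_eq_iff:
  assumes "x \<in> carrier M" "y \<in> carrier M"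
  shows "N +>\<^bsub>M\<^esub> x = N +>\<^bsub>M\<^esub> y \<longleftrightarrow> x \<ominus>\<^bsub>M\<^esub> y \<in> N"
proof -
  have "N +>\<^bsub>M\<^esub> x = N +>\<^bsub>M\<^esub> y \<longleftrightarrow> x \<in> N +>\<^bsub>M\<^esub> y"
    using M.a_repr_independence [OF _ assms(2) submodule_subgroup [OF N]] N.a_rcos_self [OF assms(1)] by auto
  also have "\<dots> \<longleftrightarrow> x \<ominus>\<^bsub>M\<^esub> y \<in> N"
    using N.a_rcos_module [OF assms(2,1)] by (simp add: a_minus_def)
  finally show ?thesis .
qed

lemma quotient_smult:
  assumes "a \<in> carrier R" "x \<in> carrier M"
  shows "a \<odot>\<^bsub>quotient_module M N\<^esub> (N +>\<^bsub>M\<^esub> x) = N +>\<^bsub>M\<^esub> (a \<odot>\<^bsub>M\<^esub> x)"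
proof -
  have "N +>\<^bsub>M\<^esub> (a \<odot>\<^bsub>M\<^esub> y) = N +>\<^bsub>M\<^esub> (a \<odot>\<^bsub>M\<^esub> x)" if "y \<in> N +>\<^bsub>M\<^esub> x" for y
  proof -
    have y: "y \<in> carrier M"
      using that assms(2) N.a_elemrcos_carrier by blast
    have "y \<ominus>\<^bsub>M\<^esub> x \<in> N"
      using that N.a_rcos_module [OF assms(2) y] by (simp add: a_minus_def)
    then have "a \<odot>\<^bsub>M\<^esub> (y \<ominus>\<^bsub>M\<^esub> x) \<in> N" by (rule submoduleD(4) [OF N assms(1)])
    then have "a \<odot>\<^bsub>M\<^esub> y \<ominus>\<^bsub>M\<^esub> a \<odot>\<^bsub>M\<^esub> x \<in> N"
      using assms y by (simp add: a_minus_def smult_r_distr smult_a_inv)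
    then show ?thesis using assms y by (simp add: coset_eq_iff smult_closed)
  qed
  then have "\<forall>y\<in>N +>\<^bsub>M\<^esub> x. N +>\<^bsub>M\<^esub> (a \<odot>\<^bsub>M\<^esub> y) = N +>\<^bsub>M\<^esub> (a \<odot>\<^bsub>M\<^esub> x)" ..
  from UN_constant_eq [OF N.a_rcos_self [OF assms(2)] this] show ?thesis
    by (simp add: quotient_module_def)
qed

lemma quotient_add:
  "\<lbrakk>x \<in> carrier M; y \<in> carrier M\<rbrakk> \<Longrightarrow>
    (N +>\<^bsub>M\<^esub> x) \<oplus>\<^bsub>quotient_module M N\<^esub> (N +>\<^bsub>M\<^esub> y) = N +>\<^bsub>M\<^esub> (x \<oplus>\<^bsub>M\<^esub> y)"
  by (simp add: quotient_simps N.a_rcos_sum)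

lemma quotient_right_module: "right_module R (quotient_module M N)"
proof -
  have N0: "N = N +>\<^bsub>M\<^esub> \<zero>\<^bsub>M\<^esub>" using N.a_subset by (simp add: M.a_coset_add_zero)
  have zero: "zero (quotient_module M N) = N +>\<^bsub>M\<^esub> \<zero>\<^bsub>M\<^esub>" using N0 by (simp add: quotient_simps)
  have "abelian_group (quotient_module M N)"
  proof (rule abelian_groupI)
    fix X assume "X \<in> carrier (quotient_module M N)"
    then obtain x where x: "x \<in> carrier M" "X = N +>\<^bsub>M\<^esub> x" by (auto simp: quotient_carrier)
    show "\<exists>Y\<in>carrier (quotient_module M N). Y \<oplus>\<^bsub>quotient_module M N\<^esub> X = \<zero>\<^bsub>quotient_module M N\<^esub>"
      using x by (intro bexI [of _ "N +>\<^bsub>M\<^esub> (\<ominus>\<^bsub>M\<^esub> x)"])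
        (auto simp: quotient_carrier quotient_add zero M.l_neg)
  qed (auto simp: quotient_carrier quotient_add zero M.a_ac)
  moreover have "right_module_axioms R (quotient_module M N)"
    by (rule right_module_axioms.intro)
      (auto simp: quotient_carrier quotient_smult quotient_add smult_closed smult_l_distr
        smult_r_distr smult_assoc smult_one)
  ultimately show ?thesis by (intro right_module.intro R.ring_axioms)
qed

lemma mhom_quotient: "(\<lambda>x. N +>\<^bsub>M\<^esub> x) \<in> mhom R M (quotient_module M N)"
proof (rule mhomI)
  show "N +>\<^bsub>M\<^esub> x \<in> carrier (quotient_module M N)" if "x \<in> carrier M" for x
    unfolding quotient_carrier using that by (rule imageI)
  show "N +>\<^bsub>M\<^esub> (x \<oplus>\<^bsub>M\<^esub> y) = (N +>\<^bsub>M\<^esub> x) \<oplus>\<^bsub>quotient_module M N\<^esub> (N +>\<^bsub>M\<^esub> y)"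
    if "x \<in> carrier M" "y \<in> carrier M" for x y
    by (rule quotient_add [OF that, symmetric])
  show "N +>\<^bsub>M\<^esub> (a \<odot>\<^bsub>M\<^esub> x) = a \<odot>\<^bsub>quotient_module M N\<^esub> (N +>\<^bsub>M\<^esub> x)"
    if "a \<in> carrier R" "x \<in> carrier M" for a x
    by (rule quotient_smult [OF that, symmetric])
qed

text \<open>
  Submodules of the quotient are images, and their preimages are submodules, so generation of the
  quotient can be tested on the submodules of \<open>M\<close> that contain \<open>N\<close>.
\<close>

lemma finitely_generated_quotient_iff:
  "finitely_generated R (quotient_module M N) \<longleftrightarrow>
    (\<exists>S\<subseteq>carrier M. finite S \<and> (\<forall>H. submodule H R M \<longrightarrow> S \<subseteq> H \<longrightarrow> N \<subseteq> H \<longrightarrow> carrier M \<subseteq> H))"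
    (is "?L \<longleftrightarrow> ?R")
proof
  let ?q = "\<lambda>x. N +>\<^bsub>M\<^esub> x" and ?Q = "quotient_module M N"
  note M = right_module_axioms
  {
    assume ?L
    then obtain S' where S': "S' \<subseteq> carrier ?Q" "finite S'" "mspan R ?Q S' = carrier ?Q"
      by (auto simp: finitely_generated_def)
    then obtain S where S: "S \<subseteq> carrier M" "finite S" "S' = ?q ` S"
      using finite_subset_image [of S' ?q "carrier M"] by (auto simp: quotient_carrier)
    show ?R
    proof (intro exI [of _ S] conjI allI impI)
      fix H assume H: "submodule H R M" and SH: "S \<subseteq> H" and NH: "N \<subseteq> H"
      note HM = submoduleD(1) [OF H]
      have "(\<lambda>x. x) \<in> mhom R (M\<lparr>carrier := H\<rparr>) M" using HM by (intro mhomI) auto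
      from mhom_comp [OF this mhom_quotient] have "?q \<in> mhom R (M\<lparr>carrier := H\<rparr>) ?Q" .
      from mhom_image_submodule [OF submodule_right_module [OF H] quotient_right_module this]
      have "submodule (?q ` H) R ?Q" by simp
      then have "carrier ?Q \<subseteq> ?q ` H" using S(3) SH S'(3) by (intro mspan_mem_submodule) auto
      show "carrier M \<subseteq> H"
      proof
        fix x assume x: "x \<in> carrier M"
        then obtain h where h: "h \<in> H" "?q x = ?q h" using \<open>carrier ?Q \<subseteq> ?q ` H\<close> by (auto simp: quotient_carrier)
        then have "x \<ominus>\<^bsub>M\<^esub> h \<in> N" using coset_eq_iff x HM by auto
        then have "(x \<ominus>\<^bsub>M\<^esub> h) \<oplus>\<^bsub>M\<^esub> h \<in> H" using NH h by (intro submoduleD(3) [OF H]) auto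
        then show "x \<in> H" using x h HM by (simp add: M.minus_add_cancel subset_iff)
      qed
    qed (use S in auto)
  next
    assume ?R
    then obtain S where S: "S \<subseteq> carrier M" "finite S"
      "\<And>H. submodule H R M \<Longrightarrow> S \<subseteq> H \<Longrightarrow> N \<subseteq> H \<Longrightarrow> carrier M \<subseteq> H" by auto
    have sub: "?q ` S \<subseteq> carrier ?Q" using S(1) by (auto simp: quotient_carrier)
    have "carrier ?Q \<subseteq> mspan R ?Q (?q ` S)" unfolding mspan_def
    proof (rule Inter_greatest)
      fix H' assume "H' \<in> {N'. submodule N' R ?Q \<and> ?q ` S \<subseteq> N'}"
      then have H': "submodule H' R ?Q" and SH: "?q ` S \<subseteq> H'" by auto
      have "N \<in> H'" using right_module.submoduleD(2) [OF quotient_right_module H'] by (simp add: quotient_simps)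
      moreover have "?q x = N" if "x \<in> N" for x using N.a_rcos_const [OF that] .
      ultimately have "N \<subseteq> {x \<in> carrier M. ?q x \<in> H'}" using N.a_subset by auto
      then have "carrier M \<subseteq> {x \<in> carrier M. ?q x \<in> H'}"
        using SH S(1) by (intro S(3) mhom_preimage_submodule [OF M quotient_right_module mhom_quotient H']) auto
      then show "carrier ?Q \<subseteq> H'" by (auto simp: quotient_carrier)
    qed
    then have "mspan R ?Q (?q ` S) = carrier ?Q"
      using mspan_subset_carrier [OF quotient_right_module sub] by auto
    then show ?L using sub S(2) by (auto simp: finitely_generated_def)
  }
qed

end

end

lemma finitely_generated_quotient_iff_dual_basis:
  assumes P: "cgp R P" and J: "ideal J R"
  shows "finitely_generated R (quotient_module P (module_ideal_prod P J)) \<longleftrightarrow>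
    (\<exists>I p \<phi>. dual_basis_mod R J P I p \<phi>)"
proof -
  note PM = cgp_right_module [OF P]
  interpret P: ideal_module R P J by (intro ideal_moduleI PM J)
  note fg = P.finitely_generated_quotient_iff [OF P.mip_submodule]
  show ?thesis
  proof
    assume "finitely_generated R (quotient_module P (module_ideal_prod P J))"
    then obtain S where S: "S \<subseteq> carrier P" "finite S"
      and gen: "\<forall>H. submodule H R P \<longrightarrow> S \<subseteq> H \<longrightarrow> module_ideal_prod P J \<subseteq> H \<longrightarrow> carrier P \<subseteq> H"
      unfolding fg by (elim exE conjE)
    show "\<exists>I p \<phi>. dual_basis_mod R J P I p \<phi>"
      by (rule dual_basis_mod_exists [OF P J S(2,1)]) (use gen in simp)
  next
    assume "\<exists>I p \<phi>. dual_basis_mod R J P I p \<phi>"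
    then obtain I p \<phi> where b: "dual_basis_mod R J P I p \<phi>" by blast
    note D = dual_basis_modD [OF b]
    show "finitely_generated R (quotient_module P (module_ideal_prod P J))" unfolding fg
    proof (intro exI [of _ "p ` I"] conjI allI impI)
      fix H assume H: "submodule H R P" and pH: "p ` I \<subseteq> H" and JH: "module_ideal_prod P J \<subseteq> H"
      show "carrier P \<subseteq> H"
      proof
        fix x assume x: "x \<in> carrier P"
        let ?y = "finsum P (\<lambda>i. \<phi> i x \<odot>\<^bsub>P\<^esub> p i) I"
        have y: "?y \<in> H"
          using pH D(4) [OF _ x] by (intro submodule_finsum [OF PM H D(1)] P.submoduleD(4) [OF H]) auto
        have "mcong P J x ?y" by (rule P.mcong_sym [OF D(5) [OF x]])
        then have "(x \<ominus>\<^bsub>P\<^esub> ?y) \<oplus>\<^bsub>P\<^esub> ?y \<in> H"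
          using JH y by (intro P.submoduleD(3) [OF H]) (auto simp: mcong_def)
        then show "x \<in> H" using x y P.submoduleD(1) [OF H] by (simp add: P.M.minus_add_cancel subset_iff)
      qed
    qed (use D in auto)
  qed
qed

text \<open>
  The Gram matrix of a dual basis modulo \<open>J\<close> plays the role of the module \<open>P/PJ\<close>.
\<close>

theorem relatively_big_iff_represents:
  fixes P :: "('a, 'm) module"
  shows "relatively_big R P \<longleftrightarrow> (\<exists>J I E. represents R J I E P)"
proof
  assume "relatively_big R P"
  then obtain T :: "'a cmod" where P: "cgp R P" and T: "cgp R T"
    and iso: "miso R (dsum P (omega_power T)) P"
    and fg: "finitely_generated R (quotient_module P (module_ideal_prod P (trace_ideal R T)))"
    by (auto simp: relatively_big_def cg_projective_iff_cgp)
  let ?J = "trace_ideal R T"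
  note J = trace_ideal_ideal [OF cgp_right_module [OF T]]
  obtain I p \<phi> where b: "dual_basis_mod R ?J P I p \<phi>"
    using fg finitely_generated_quotient_iff_dual_basis [OF P J] by blast
  have "gram_mod R ?J P I (\<lambda>i j. \<phi> i (p j))" unfolding gram_mod_def
    using b dual_basis_modD(2,4) [OF b] cong_mod_refl [OF J] by (intro exI conjI ballI) auto
  moreover have "absorbs R ?J P" using P T iso by (auto simp: absorbs_def)
  ultimately show "\<exists>J I E. represents R J I E P" by (auto simp: represents_def)
next
  assume "\<exists>J I E. represents R J I E P"
  then obtain J I E where a: "absorbs R J P" and "gram_mod R J P I E" by (auto simp: represents_def)
  then have "\<exists>I p \<phi>. dual_basis_mod R J P I p \<phi>" by (auto simp: gram_mod_def)
  then have "finitely_generated R (quotient_module P (module_ideal_prod P J))"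
    using finitely_generated_quotient_iff_dual_basis [OF absorbs_cgp [OF a] absorbs_ideal [OF a]] by simp
  then show "relatively_big R P"
    using a by (auto simp: absorbs_def relatively_big_def cg_projective_iff_cgp)
qed

text \<open>
  The witness is the zero module, in the form of the free module on the empty set; its trace ideal is
  zero.
\<close>

lemma finitely_generated_projective_relatively_big:
  fixes P :: "('a, 'm) module"
  assumes "projective R P" "finitely_generated R P"
  shows "relatively_big R P"
proof -
  have PM: "right_module R P" using assms(1) by (simp add: projective_def)
  interpret P: right_module R P by (rule PM)
  note R = P.R.ring_axioms
  note reg = regular_right_module [OF R] and F = free_right_module [OF R]
  have cP: "cg_projective R P"
    using assms by (auto simp: cg_projective_def finitely_generated_def countably_generated_def
        intro: countable_finite)
  let ?Z = "copower (regular_module R) ({} :: nat set)"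
  have Z: "right_module R ?Z" by (rule copower_right_module [OF reg])
  have Z0: "carrier ?Z = {\<zero>\<^bsub>?Z\<^esub>}" by (auto simp: copower_carrier fun_eq_iff)
  have cZ: "cgp R ?Z"
    using Z0 by (auto simp: cgp_def Z intro!: retractI [OF mhom_const_zero [OF F] mhom_const_zero [OF Z]])
  have "trace_ideal R ?Z \<subseteq> {\<zero>\<^bsub>R\<^esub>}"
  proof (rule trace_ideal_least [OF R])
    show "subgroup {\<zero>\<^bsub>R\<^esub>} (add_monoid R)" by (rule group.subgroupI [OF P.R.a_group]) auto
    show "f x \<in> {\<zero>\<^bsub>R\<^esub>}" if "f \<in> mhom R ?Z (regular_module R)" "x \<in> carrier ?Z" for f x
      using mhom_zero [OF Z reg that(1)] that(2) Z0 by auto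
  qed
  interpret PJ: ideal_module R P "trace_ideal R ?Z" by (intro ideal_moduleI PM trace_ideal_ideal Z)
  obtain S where S: "S \<subseteq> carrier P" "finite S" "mspan R P S = carrier P"
    using assms(2) by (auto simp: finitely_generated_def)
  have "finitely_generated R (quotient_module P (module_ideal_prod P (trace_ideal R ?Z)))"
    unfolding P.finitely_generated_quotient_iff [OF PJ.mip_submodule]
    using S mspan_mem_submodule [of _ R P S] by (intro exI [of _ S] conjI allI impI) auto
  moreover have "carrier (omega_power ?Z) = {\<zero>\<^bsub>omega_power ?Z\<^esub>}"
    by (auto simp: copower_carrier fun_eq_iff)
  then have "miso R (dsum P (omega_power ?Z)) P" by (rule dsum_zero [OF PM])
  ultimately show ?thesis unfolding relatively_big_def using cP cZ by (auto simp: cg_projective_iff_cgp)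
qed

section \<open>Isomorphism classes\<close>

lemma represents_right_module: "represents R J I E P \<Longrightarrow> right_module R P"
  by (simp add: represents_def absorbs_def cgp_right_module)

lemma represents_miso:
  assumes "represents R J I E P" "miso R P Q" "right_module R Q"
  shows "represents R J I E Q"
  using assms gram_mod_miso [OF _ represents_right_module [OF assms(1)] assms(3,2)]
  by (auto simp: represents_def absorbs_ideal intro: absorbs_miso)

lemma iso_class_eq_iff:
  fixes P Q :: "'a cmod"
  assumes "right_module R P" "right_module R Q"
  shows "iso_class R P = iso_class R Q \<longleftrightarrow> miso R P Q"
proof
  assume "iso_class R P = iso_class R Q"
  moreover have "Q \<in> iso_class R Q" using assms(2) miso_refl by (simp add: iso_class_def)
  ultimately show "miso R P Q" by (auto simp: iso_class_def)
next
  assume PQ: "miso R P Q"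
  show "iso_class R P = iso_class R Q"
    using miso_trans [OF PQ] miso_trans [OF miso_sym [OF PQ assms(1)]] by (auto simp: iso_class_def)
qed

lemma iso_class_cong:
  assumes "right_module R M" "miso R M N"
  shows "iso_class R M = iso_class R N"
  using miso_trans [OF assms(2)] miso_trans [OF miso_sym [OF assms(2,1)]] by (auto simp: iso_class_def)

lemma VB_r_carrier:
  fixes R :: "('a, 'r) ring_scheme"
  shows "carrier (VB_r R) = {iso_class R P | P :: 'a cmod. relatively_big R P}"
proof -
  have "projective R P" if "relatively_big R P" for P :: "'a cmod"
    using that by (simp add: relatively_big_def cg_projective_def)
  then show ?thesis
    unfolding VB_r_def V_r_def B_r_def
    using finitely_generated_projective_relatively_big [of R] by auto
qed

text \<open>
  The sum of two classes is a union over all pairs of representatives; all members of the union are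
  equal.
\<close>

lemma VB_r_mult:
  fixes P Q :: "'a cmod"
  assumes P: "right_module R P" and Q: "right_module R Q"
  shows "iso_class R P \<otimes>\<^bsub>VB_r R\<^esub> iso_class R Q = iso_class R (dsum P Q)"
proof -
  have eq: "\<forall>Q'\<in>iso_class R Q. iso_class R (dsum P' Q') = iso_class R (dsum P Q)"
    if "P' \<in> iso_class R P" for P'
    using that by (intro ballI iso_class_cong [symmetric] dsum_right_module P Q dsum_cong) (auto simp: iso_class_def)
  have mem: "P \<in> iso_class R P" "Q \<in> iso_class R Q"
    using P Q miso_refl by (auto simp: iso_class_def)
  have "\<forall>P'\<in>iso_class R P. (\<Union>Q'\<in>iso_class R Q. iso_class R (dsum P' Q')) = iso_class R (dsum P Q)"
    using UN_constant_eq [OF mem(2) eq] by blast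
  from UN_constant_eq [OF mem(1) this] show ?thesis
    by (simp add: VB_r_def V_star_r_def)
qed

section \<open>The correspondence between right and left modules\<close>

text \<open>
  The second module is a left module over \<open>R\<close>, and its matrix is the transpose of the first one.
\<close>

definition corresponds :: "('a, 'r) ring_scheme \<Rightarrow> ('a, 'm, 'k) module_scheme \<Rightarrow>
    ('a, 'n, 'l) module_scheme \<Rightarrow> bool" where
  "corresponds R P Q \<longleftrightarrow>
     (\<exists>J I E. represents R J I E P \<and> represents (opp R) J I (\<lambda>i j. E j i) Q)"

lemma corresponds_sym: "corresponds R P Q \<Longrightarrow> corresponds (opp R) Q P"
  unfolding corresponds_def by fastforce

lemma corresponds_right_module:
  assumes "corresponds R P Q" shows "right_module R P" "right_module (opp R) Q"
  using assms by (auto simp: corresponds_def dest: represents_right_module)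

lemma corresponds_miso:
  assumes "corresponds R P Q" "miso R P P'" "right_module R P'" "miso (opp R) Q Q'" "right_module (opp R) Q'"
  shows "corresponds R P' Q'"
proof -
  obtain J I E where E: "represents R J I E P" and Et: "represents (opp R) J I (\<lambda>i j. E j i) Q"
    using assms(1) by (auto simp: corresponds_def)
  show ?thesis unfolding corresponds_def
    using represents_miso [OF E assms(2,3)] represents_miso [OF Et assms(4,5)] by blast
qed

text \<open>
  The ideal is determined by the module, so both pairs use the same one; then the Gram matrices can be
  compared.
\<close>

lemma corresponds_unique:
  assumes "corresponds R P Q" "corresponds R P' Q'" "miso R P P'"
  shows "miso (opp R) Q Q'"
proof -
  obtain J I E where E: "represents R J I E P" and Et: "represents (opp R) J I (\<lambda>i j. E j i) Q"
    using assms(1) by (auto simp: corresponds_def)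
  obtain K I' F where F: "represents R K I' F P'" and Ft: "represents (opp R) K I' (\<lambda>i j. F j i) Q'"
    using assms(2) by (auto simp: corresponds_def)
  note P' = represents_right_module [OF F]
  have E': "represents R J I E P'" by (rule represents_miso [OF E assms(3) P'])
  have aE: "absorbs R J P'" and gE: "gram_mod R J P' I E" using E' by (simp_all add: represents_def)
  have aF: "absorbs R K P'" and gF: "gram_mod R K P' I' F" using F by (simp_all add: represents_def)
  have gEt: "gram_mod (opp R) J Q I (\<lambda>i j. E j i)" using Et by (simp add: represents_def)
  have "K = J"
    using absorbed_ideal_subset [OF aE aF] absorbed_ideal_subset [OF aF aE] gE gF
    unfolding gram_mod_def by blast
  with gF have gF': "gram_mod R J P' I' F" by simp
  have "gram_mod (opp R) J Q I' (\<lambda>k l. F l k)"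
    by (rule gram_mod_transfer [OF absorbs_ideal [OF aE] P' represents_right_module [OF Et] gE gF' gEt])
  then have "represents (opp R) J I' (\<lambda>k l. F l k) Q" using Et by (simp add: represents_def)
  moreover have "represents (opp R) J I' (\<lambda>k l. F l k) Q'" using Ft \<open>K = J\<close> by simp
  ultimately show ?thesis by (rule represents_unique)
qed

text \<open>
  The hypothesis on trace ideals supplies a left module with trace ideal \<open>J\<close>, and the transpose of an
  idempotent matrix is idempotent over the opposite ring.
\<close>

lemma corresponds_exists:
  fixes P :: "('a, 'm) module"
  assumes "trace_ideals_r R = trace_ideals_r (opp R)" "relatively_big R P"
  shows "\<exists>Q :: 'a cmod. corresponds R P Q"
proof -
  obtain J I E where E: "represents R J I E P" using assms(2) relatively_big_iff_represents by blast
  then have a: "absorbs R J P" and g: "gram_mod R J P I E" by (auto simp: represents_def)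
  note J = absorbs_ideal [OF a]
  have "J \<in> trace_ideals_r R" using a by (auto simp: absorbs_def trace_ideals_r_def cg_projective_iff_cgp)
  then have "J \<in> trace_ideals_r (opp R)" using assms(1) by simp
  then obtain T :: "'a cmod" where T: "cgp (opp R) T" and tr: "trace_ideal (opp R) T = J"
    by (auto simp: trace_ideals_r_def cg_projective_iff_cgp)
  have I: "finite I" using g by (auto simp: gram_mod_def dual_basis_mod_def)
  have "cong_mod (opp R) J (mat_mul (opp R) I (\<lambda>i j. E j i) (\<lambda>i j. E j i) i j) (E j i)"
    if "i \<in> I" "j \<in> I" for i j
    using gram_mod_idempotent [OF J represents_right_module [OF E] g that(2,1)]
    by (simp add: mat_mul_opp)
  then have "\<exists>Q :: 'a cmod. represents (opp R) J I (\<lambda>i j. E j i) Q"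
    using represents_exists [OF T I, of "\<lambda>i j. E j i"] tr by simp
  then show ?thesis using E by (auto simp: corresponds_def)
qed

text \<open>
  The index sets are made disjoint by moving them to the even and to the odd numbers.
\<close>

lemma represents_dsum:
  assumes "represents R J I E P" "represents R K I' F Q"
  shows "represents R (generate (add_monoid R) (J \<union> K)) ((\<lambda>n. 2 * n) ` I \<union> (\<lambda>n. 2 * n + 1) ` I')
    (block R ((\<lambda>n. 2 * n) ` I) ((\<lambda>n. 2 * n + 1) ` I') (\<lambda>i j. E (i div 2) (j div 2)) (\<lambda>i j. F (i div 2) (j div 2)))
    (dsum P Q)"
proof -
  let ?L = "generate (add_monoid R) (J \<union> K)"
  note P = represents_right_module [OF assms(1)] and Q = represents_right_module [OF assms(2)]
  have a: "absorbs R J P" "absorbs R K Q" and g: "gram_mod R J P I E" "gram_mod R K Q I' F"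
    using assms by (auto simp: represents_def)
  note aL = absorbs_dsum [OF a] and J = absorbs_ideal [OF a(1)] and K = absorbs_ideal [OF a(2)]
  note L = absorbs_ideal [OF aL]
  have sub: "J \<subseteq> ?L" "K \<subseteq> ?L" by (auto intro: generate.incl)
  have disj: "(\<lambda>n. 2 * n) ` I \<inter> (\<lambda>n. 2 * n + 1) ` I' = {}" by (auto simp: image_iff) presburger
  show ?thesis unfolding represents_def
    by (intro conjI aL gram_mod_dsum [OF L P Q _ _ disj]
        gram_mod_mono [OF sub(1) J L P] gram_mod_mono [OF sub(2) K L Q]
        gram_mod_reindex [OF P g(1)] gram_mod_reindex [OF Q g(2)]) auto
qed

lemma corresponds_dsum:
  assumes "corresponds R P Q" "corresponds R P' Q'"
  shows "corresponds R (dsum P P') (dsum Q Q')"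
proof -
  obtain J I E where E: "represents R J I E P" and Et: "represents (opp R) J I (\<lambda>i j. E j i) Q"
    using assms(1) by (auto simp: corresponds_def)
  obtain K I' F where F: "represents R K I' F P'" and Ft: "represents (opp R) K I' (\<lambda>i j. F j i) Q'"
    using assms(2) by (auto simp: corresponds_def)
  have "block (opp R) A B (\<lambda>i j. E (j div 2) (i div 2)) (\<lambda>i j. F (j div 2) (i div 2)) =
      (\<lambda>i j. block R A B (\<lambda>i j. E (i div 2) (j div 2)) (\<lambda>i j. F (i div 2) (j div 2)) j i)" for A B
    by (auto simp: block_def fun_eq_iff)
  with represents_dsum [OF E F] represents_dsum [OF Et Ft] show ?thesis
    unfolding corresponds_def by (intro exI conjI) auto
qed

text \<open>
  A choice of representatives is avoided: all modules that correspond to some member of the class.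
\<close>

definition dual_class :: "('a, 'r) ring_scheme \<Rightarrow> 'a cmod set \<Rightarrow> 'a cmod set" where
  "dual_class R A = {Q. \<exists>P\<in>A. corresponds R P Q}"

lemma dual_class_iso_class:
  fixes P Q :: "'a cmod"
  assumes "corresponds R P Q"
  shows "dual_class R (iso_class R P) = iso_class (opp R) Q"
proof (intro equalityI subsetI)
  note P = corresponds_right_module(1) [OF assms]
  fix Q' assume "Q' \<in> dual_class R (iso_class R P)"
  then obtain P' :: "'a cmod" where "miso R P P'" and c: "corresponds R P' Q'"
    by (auto simp: dual_class_def iso_class_def)
  then show "Q' \<in> iso_class (opp R) Q"
    using corresponds_unique [OF assms c] corresponds_right_module(2) [OF c] by (simp add: iso_class_def)
next
  note P = corresponds_right_module(1) [OF assms]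
  fix Q' assume "Q' \<in> iso_class (opp R) Q"
  then have "corresponds R P Q'"
    by (intro corresponds_miso [OF assms miso_refl P]) (auto simp: iso_class_def)
  then show "Q' \<in> dual_class R (iso_class R P)"
    using P miso_refl by (auto simp: dual_class_def iso_class_def)
qed

theorem corollary2p9:
  fixes R :: "('a, 'r) ring_scheme"
  assumes "ring R"
    and "trace_ideals_r R = trace_ideals_l R"
  shows "VB_r R \<cong> VB_l R"
proof -
  let ?S = "opp R"
  have tr: "trace_ideals_r R = trace_ideals_r ?S" using assms(2) by (simp add: trace_ideals_l_def)
  have ex: "\<exists>(P :: 'a cmod) (Q :: 'a cmod). A = iso_class R P \<and> corresponds R P Q" if "A \<in> carrier (VB_r R)" for A
  proof -
    obtain P :: "'a cmod" where P: "A = iso_class R P" "relatively_big R P"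
      using \<open>A \<in> _\<close> by (auto simp: VB_r_carrier)
    from corresponds_exists [OF tr P(2)] obtain Q :: "'a cmod" where "corresponds R P Q" ..
    with P(1) show ?thesis by blast
  qed
  have ex': "\<exists>(P :: 'a cmod) (Q :: 'a cmod). B = iso_class ?S Q \<and> corresponds R P Q" if "B \<in> carrier (VB_r ?S)" for B
  proof -
    obtain Q :: "'a cmod" where Q: "B = iso_class ?S Q" "relatively_big ?S Q"
      using \<open>B \<in> _\<close> by (auto simp: VB_r_carrier)
    from tr have "trace_ideals_r ?S = trace_ideals_r (opp ?S)" by simp
    from corresponds_exists [OF this Q(2)] obtain P :: "'a cmod" where "corresponds ?S Q P" ..
    then show ?thesis using corresponds_sym [of ?S Q P] Q(1) unfolding opp_opp by blast
  qed
  have big: "iso_class ?S Q \<in> carrier (VB_r ?S)" and big': "iso_class R P \<in> carrier (VB_r R)"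
    if "corresponds R P Q" for P Q :: "'a cmod"
  proof -
    have "relatively_big R P" "relatively_big ?S Q"
      using that unfolding corresponds_def relatively_big_iff_represents by blast+
    then show "iso_class ?S Q \<in> carrier (VB_r ?S)" "iso_class R P \<in> carrier (VB_r R)"
      unfolding VB_r_carrier by blast+
  qed
  have dual_carrier: "dual_class R A \<in> carrier (VB_r ?S)" if A: "A \<in> carrier (VB_r R)" for A
  proof -
    obtain P Q :: "'a cmod" where "A = iso_class R P" and c: "corresponds R P Q"
      using ex [OF A] by blast
    then show ?thesis using big [OF c] dual_class_iso_class [OF c] by simp
  qed
  have "dual_class R \<in> hom (VB_r R) (VB_r ?S)"
  proof (rule homI)
    fix A assume "A \<in> carrier (VB_r R)"
    then show "dual_class R A \<in> carrier (VB_r ?S)" by (rule dual_carrier)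
    fix B assume "B \<in> carrier (VB_r R)"
    obtain P Q :: "'a cmod" where A: "A = iso_class R P" and PQ: "corresponds R P Q"
      using ex [OF \<open>A \<in> _\<close>] by blast
    obtain P' Q' :: "'a cmod" where B: "B = iso_class R P'" and PQ': "corresponds R P' Q'"
      using ex [OF \<open>B \<in> _\<close>] by blast
    note c = corresponds_dsum [OF PQ PQ']
    note r = corresponds_right_module [OF PQ] corresponds_right_module [OF PQ'] corresponds_right_module [OF c]
    obtain J I E where "represents R J I E (dsum P P')" "represents ?S J I (\<lambda>i j. E j i) (dsum Q Q')"
      using c by (auto simp: corresponds_def)
    then have cg: "cg_projective R (dsum P P')" "cg_projective ?S (dsum Q Q')"
      by (auto simp: represents_def absorbs_def cg_projective_iff_cgp)
    \<comment> \<open>Direct sums have another carrier type, so they are replaced by isomorphic representatives.\<close>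
    obtain U :: "'a cmod" where U: "cg_projective R U" "miso R (dsum P P') U"
      using cg_projective_representative [OF cg(1)] by blast
    obtain W :: "'a cmod" where W: "cg_projective ?S W" "miso ?S (dsum Q Q') W"
      using cg_projective_representative [OF cg(2)] by blast
    have UW: "right_module R U" "right_module ?S W"
      using U(1) W(1) by (auto simp: cg_projective_iff_cgp cgp_right_module)
    have "dual_class R (A \<otimes>\<^bsub>VB_r R\<^esub> B) = dual_class R (iso_class R U)"
      by (simp add: A B VB_r_mult r iso_class_cong [OF r(5) U(2)])
    also have "\<dots> = iso_class ?S W"
      by (rule dual_class_iso_class [OF corresponds_miso [OF c U(2) UW(1) W(2) UW(2)]])
    also have "\<dots> = dual_class R A \<otimes>\<^bsub>VB_r ?S\<^esub> dual_class R B"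
      by (simp add: A B dual_class_iso_class [OF PQ] dual_class_iso_class [OF PQ'] VB_r_mult r
          iso_class_cong [OF r(6) W(2)])
    finally show "dual_class R (A \<otimes>\<^bsub>VB_r R\<^esub> B) = dual_class R A \<otimes>\<^bsub>VB_r ?S\<^esub> dual_class R B" .
  qed
  moreover have "bij_betw (dual_class R) (carrier (VB_r R)) (carrier (VB_r ?S))"
  proof (rule bij_betw_imageI)
    show "inj_on (dual_class R) (carrier (VB_r R))"
    proof (rule inj_onI)
      fix A B assume "A \<in> carrier (VB_r R)" "B \<in> carrier (VB_r R)" and eq: "dual_class R A = dual_class R B"
      obtain P Q :: "'a cmod" where A: "A = iso_class R P" and PQ: "corresponds R P Q"
        using ex [OF \<open>A \<in> _\<close>] by blast
      obtain P' Q' :: "'a cmod" where B: "B = iso_class R P'" and PQ': "corresponds R P' Q'"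
        using ex [OF \<open>B \<in> _\<close>] by blast
      have "miso ?S Q Q'"
        using eq corresponds_right_module(2) [OF PQ] corresponds_right_module(2) [OF PQ']
        by (simp add: A B dual_class_iso_class [OF PQ] dual_class_iso_class [OF PQ'] iso_class_eq_iff)
      then have "miso R P P'"
        using corresponds_unique [OF corresponds_sym [OF PQ] corresponds_sym [OF PQ']] by simp
      then show "A = B" using A B corresponds_right_module(1) [OF PQ] iso_class_cong by blast
    qed
    show "dual_class R ` carrier (VB_r R) = carrier (VB_r ?S)"
    proof
      show "dual_class R ` carrier (VB_r R) \<subseteq> carrier (VB_r ?S)" using dual_carrier by (rule image_subsetI)
      show "carrier (VB_r ?S) \<subseteq> dual_class R ` carrier (VB_r R)"
      proof
        fix B assume B: "B \<in> carrier (VB_r ?S)"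
        obtain P Q :: "'a cmod" where "B = iso_class ?S Q" and c: "corresponds R P Q"
          using ex' [OF B] by blast
        then show "B \<in> dual_class R ` carrier (VB_r R)"
          using big' [OF c] by (intro image_eqI [of _ _ "iso_class R P"]) (simp_all add: dual_class_iso_class [OF c])
      qed
    qed
  qed
  ultimately show ?thesis unfolding VB_l_def is_iso_def iso_def by blast
qed

end
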